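(* Let $\delta$ be a generator of $\mathbb{F}_q[Z]^\ast$ and let $\zeta\in\mathbb{F}_q[Z]^\ast$ be such that $N(\zeta)=\frac{\tau-1}{\tau}$. The arithmetic lattices $G(R)$ and $G(R')$ have finite presentations as follows: $$G(R)=\left\langle d,s,a,b\ \left|\ \begin{array}{c} d^{q+1}=s^2=(ds)^2=1,\ a^2=b^2=(sa)^2=(s\zeta b)^2=1\\ (d^iad^{-i})(d^jbd^{-j})=(d^lbd^{-l})(d^kad^{-k})\\ \text{if } 0\le i,j,k,l\le q \text{ satisfy } (\star)\end{array}\right.\right\rangle,$$ $$G(R')=\left\langle d,a,b\ \left|\ \begin{array}{c} d^{q+1}=a^2=b^2=1\\ (d^iad^{-i})(d^jbd^{-j})=(d^lbd^{-l})(d^kad^{-k})\\ \text{if } 0\le i,j,k,l\le q \text{ satisfy } (\star)\end{array}\right.\right\rangle,$$ where $(\star)$ is the condition in $\mathbb{F}_q[Z]^\ast/\mathbb{F}_q^\ast$: $$\delta^j=\big(\delta^l-\zeta\,\wp(\delta^i)\cdot\delta^{ql}\big)Z\quad\text{and}\quad \delta^k=\big(\delta^i-\zeta^{-1}\wp(\delta^l)\cdot\delta^{qi}\big)Z .$$ In particular, $G(R)=\Lambda_\tau=\Gamma_\tau\rtimes\Delta$ and $G(R')=\Lambda'_\tau=\Gamma_\tau\rtimes\langle d\rangle$.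
   Context: $q$ is a power of an odd prime $p$, $c\in\mathbb{F}_q^\ast$ a non-square, $\tau\in\mathbb{F}_q^\ast\setminus\{1\}$, $K=\mathbb{F}_q(t)$, $D=K\{Z,F\}/(Z^2=c,\ F^2=t(t-1),\ ZF=-FZ)$, $G=\mathrm{PGL}_{1,D}$, $G(K)=D^\ast/K^\ast$. Put $R'=\mathbb{F}_q[t,\frac{1}{t(t-\tau)}]$, $R=R'[\frac1{t-1}]$, $\mathfrak{O}'=R'\oplus R'Z\oplus R'F\oplus R'ZF$, $\mathfrak{O}=\mathfrak{O}'\otimes_{R'}R$; then $G(R')=\mathfrak{O}'^\ast/R'^\ast\subseteq G(R)=\mathfrak{O}^\ast/R^\ast\subseteq G(K)$. $\mathbb{F}_q[Z]\subset D$ is a field with $q^2$ elements; $\bar w=w^q$, $N(w)=w\bar w$, $\wp(w)=w/\bar w$. For $\xi\in\mathbb{F}_q[Z]$ put $\gamma_\xi=tZ+\xi F$. The elements $d,s,a,b\in G(K)$ are the images of $\delta$, $F$, $\gamma_Z=tZ+ZF$ and $\gamma_{Z/\zeta}=tZ+\zeta^{-1}ZF$ respectively; $\Delta=\langle d,s\rangle$ is a dihedral group of order $2(q+1)$. In the relation $(s\zeta b)^2=1$, $\zeta$ stands for its image in $\mathbb{F}_q[Z]^\ast/\mathbb{F}_q^\ast=\langle d\rangle$, i.e. for the power $d^m$ with $\delta^m\equiv\zeta$ modulo $\mathbb{F}_q^\ast$. $\Lambda_\tau=\langle d,s,a,b\rangle$, $\Lambda'_\tau=\langle d,a,b\rangle$,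 and $\Gamma_\tau\subset G(K)$ is the subgroup generated by the images $a_\xi$ of $\gamma_\xi Z$ for all $\xi\in\mathbb{F}_q[Z]$ with $N(\xi)=-c$ and the images $b_\eta$ of $\gamma_\eta Z$ for all $\eta\in\mathbb{F}_q[Z]$ with $N(\eta)=\frac{c\tau}{1-\tau}$. *)

theory Defs
  imports
    "HOL-Algebra.Algebra"
    "HOL-Algebra.Algebraic_Closure_Type"
    "HOL-Library.Cardinality"
    "HOL-Computational_Algebra.Computational_Algebra"
begin

section \<open>Group presentations\<close>

text \<open>A letter is a generator together with a sign; \<open>False\<close> marks the formal inverse.\<close>

type_synonym 'x word = "('x \<times> bool) list"

definition words :: "'x set \<Rightarrow> 'x word set" where
  "words S = lists (S \<times> UNIV)"

definition letter :: "'x \<Rightarrow> 'x word" where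
  "letter x = [(x, True)]"

definition word_pow :: "'x word \<Rightarrow> nat \<Rightarrow> 'x word" where
  "word_pow w n = concat (replicate n w)"

text \<open>The congruence on words generated by free cancellation and by the equations in \<open>E\<close>; its
  classes form the quotient of the free group on \<open>S\<close> by the normal closure of the elements
  $u v^{-1}$ with \<open>(u, v) \<in> E\<close>.\<close>

inductive_set word_cong :: "'x set \<Rightarrow> ('x word \<times> 'x word) set \<Rightarrow> ('x word \<times> 'x word) set"
  for S :: "'x set" and E :: "('x word \<times> 'x word) set" where
  refl: "w \<in> words S \<Longrightarrow> (w, w) \<in> word_cong S E"
| sym: "(u, v) \<in> word_cong S E \<Longrightarrow> (v, u) \<in> word_cong S E"
| trans: "(u, v) \<in> word_cong S E \<Longrightarrow> (v, w) \<in> word_cong S E \<Longrightarrow> (u, w) \<in> word_cong S E"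
| append: "(u, u') \<in> word_cong S E \<Longrightarrow> (v, v') \<in> word_cong S E \<Longrightarrow> (u @ v, u' @ v') \<in> word_cong S E"
| cancel: "x \<in> S \<Longrightarrow> ([(x, e), (x, \<not> e)], []) \<in> word_cong S E"
| equation: "(u, v) \<in> E \<Longrightarrow> u \<in> words S \<Longrightarrow> v \<in> words S \<Longrightarrow> (u, v) \<in> word_cong S E"

definition word_class :: "'x set \<Rightarrow> ('x word \<times> 'x word) set \<Rightarrow> 'x word \<Rightarrow> 'x word set" where
  "word_class S E w = word_cong S E `` {w}"

definition presented_group :: "'x set \<Rightarrow> ('x word \<times> 'x word) set \<Rightarrow> 'x word set monoid" where
  "presented_group S E =
     \<lparr>carrier = words S // word_cong S E,
      monoid.mult = (\<lambda>A B. \<Union>u\<in>A. \<Union>v\<in>B. word_class S E (u @ v)),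
      one = word_class S E []\<rparr>"

text \<open>\<open>G\<close> has the finite presentation with generators \<open>S\<close> and relations \<open>E\<close>, where the generator
  \<open>x\<close> stands for the element \<open>f x\<close> of \<open>G\<close>.\<close>

definition has_finite_presentation ::
    "('g, 'm) monoid_scheme \<Rightarrow> ('x \<Rightarrow> 'g) \<Rightarrow> 'x set \<Rightarrow> ('x word \<times> 'x word) set \<Rightarrow> bool" where
  "has_finite_presentation G f S E \<longleftrightarrow>
     finite S \<and> finite E \<and> E \<subseteq> words S \<times> words S \<and>
     (\<exists>\<phi> \<in> iso (presented_group S E) G. \<forall>x\<in>S. \<phi> (word_class S E (letter x)) = f x)"

lemma words_append: "u \<in> words S \<Longrightarrow> v \<in> words S \<Longrightarrow> u @ v \<in> words S"
  by (auto simp: words_def)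

lemma word_cong_words: "(u, v) \<in> word_cong S E \<Longrightarrow> u \<in> words S \<and> v \<in> words S"
  by (induction rule: word_cong.induct) (auto simp: words_def)

lemma equiv_word_cong: "equiv (words S) (word_cong S E)"
proof (rule equivI)
  show "word_cong S E \<subseteq> words S \<times> words S" using word_cong_words by fastforce
  show "refl_on (words S) (word_cong S E)"
    using word_cong.refl by (auto simp: refl_on_def)
  show "sym (word_cong S E)" by (auto intro: symI word_cong.sym)
  show "trans (word_cong S E)" by (auto intro: transI word_cong.trans)
qed

lemma word_class_eq_iff:
  "u \<in> words S \<Longrightarrow> v \<in> words S \<Longrightarrow>
     word_class S E u = word_class S E v \<longleftrightarrow> (u, v) \<in> word_cong S E"
  unfolding word_class_def using equiv_word_cong by (rule eq_equiv_class_iff)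

lemma carrier_presented_group: "carrier (presented_group S E) = word_class S E ` words S"
  by (auto simp: presented_group_def quotient_def word_class_def)

lemma one_presented_group: "\<one>\<^bsub>presented_group S E\<^esub> = word_class S E []"
  by (simp add: presented_group_def)

lemma mult_presented_group:
  assumes "u \<in> words S" "v \<in> words S"
  shows "word_class S E u \<otimes>\<^bsub>presented_group S E\<^esub> word_class S E v = word_class S E (u @ v)"
proof -
  have eq: "word_class S E (u' @ v') = word_class S E (u @ v)"
    if "u' \<in> word_class S E u" "v' \<in> word_class S E v" for u' v'
  proof -
    have "(u @ v, u' @ v') \<in> word_cong S E"
      using that by (auto simp: word_class_def intro: word_cong.append)
    then show ?thesis
      using word_class_eq_iff word_cong_words by metis
  qed
  have "u \<in> word_class S E u" "v \<in> word_class S E v"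
    using assms by (auto simp: word_class_def intro: word_cong.refl)
  then have "(\<Union>u'\<in>word_class S E u. \<Union>v'\<in>word_class S E v. word_class S E (u @ v))
      = word_class S E (u @ v)"
    by blast
  then show ?thesis by (simp add: presented_group_def eq cong: SUP_cong)
qed

definition word_inv :: "'x word \<Rightarrow> 'x word" where
  "word_inv w = rev (map (\<lambda>(x, e). (x, \<not> e)) w)"

lemma word_inv_words: "w \<in> words S \<Longrightarrow> word_inv w \<in> words S"
  by (auto simp: words_def word_inv_def)

lemma word_inv_cancel: "w \<in> words S \<Longrightarrow> (word_inv w @ w, []) \<in> word_cong S E"
proof (induction w)
  case Nil
  then show ?case by (auto simp: word_inv_def words_def intro: word_cong.refl)
next
  case (Cons l w)
  obtain x e where l: "l = (x, e)" by force
  have x: "x \<in> S" and w: "w \<in> words S" using Cons.prems l by (auto simp: words_def)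
  have "([(x, \<not> e), (x, e)], []) \<in> word_cong S E"
    using word_cong.cancel[OF x, of "\<not> e" E] by simp
  then have "([(x, \<not> e), (x, e)] @ w, [] @ w) \<in> word_cong S E"
    using w by (intro word_cong.append word_cong.refl)
  then have "(word_inv w @ ([(x, \<not> e), (x, e)] @ w), word_inv w @ ([] @ w)) \<in> word_cong S E"
    by (intro word_cong.append[OF word_cong.refl[OF word_inv_words[OF w]]])
  then have "(word_inv (l # w) @ l # w, word_inv w @ w) \<in> word_cong S E"
    by (simp add: word_inv_def l)
  then show ?case using Cons.IH[OF w] word_cong.trans by blast
qed

lemma group_presented_group: "group (presented_group S E)"
proof (rule groupI)
  fix A B C
  assume "A \<in> carrier (presented_group S E)" "B \<in> carrier (presented_group S E)"
    "C \<in> carrier (presented_group S E)"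
  then obtain u v w where "u \<in> words S" "v \<in> words S" "w \<in> words S"
    "A = word_class S E u" "B = word_class S E v" "C = word_class S E w"
    by (auto simp: carrier_presented_group)
  then show "A \<otimes>\<^bsub>presented_group S E\<^esub> B \<in> carrier (presented_group S E)"
    and "A \<otimes>\<^bsub>presented_group S E\<^esub> B \<otimes>\<^bsub>presented_group S E\<^esub> C =
      A \<otimes>\<^bsub>presented_group S E\<^esub> (B \<otimes>\<^bsub>presented_group S E\<^esub> C)"
    by (auto simp: carrier_presented_group mult_presented_group words_append)
next
  show "\<one>\<^bsub>presented_group S E\<^esub> \<in> carrier (presented_group S E)"
    by (auto simp: carrier_presented_group one_presented_group words_def)
next
  fix A assume "A \<in> carrier (presented_group S E)"
  then obtain u where u: "u \<in> words S" and A: "A = word_class S E u"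
    by (auto simp: carrier_presented_group)
  have "[] \<in> words S" by (simp add: words_def)
  then show "\<one>\<^bsub>presented_group S E\<^esub> \<otimes>\<^bsub>presented_group S E\<^esub> A = A"
    using u by (simp add: A one_presented_group mult_presented_group)
  have "word_class S E (word_inv u) \<otimes>\<^bsub>presented_group S E\<^esub> A = \<one>\<^bsub>presented_group S E\<^esub>"
    using u word_inv_cancel[OF u, of E] word_inv_words[OF u] \<open>[] \<in> words S\<close>
    by (simp add: A one_presented_group mult_presented_group words_append word_class_eq_iff)
  then show "\<exists>B\<in>carrier (presented_group S E).
      B \<otimes>\<^bsub>presented_group S E\<^esub> A = \<one>\<^bsub>presented_group S E\<^esub>"
    using word_inv_words[OF u] by (auto simp: carrier_presented_group)
qed

section \<open>Internal semidirect products\<close>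

definition is_semidirect :: "('g, 'm) monoid_scheme \<Rightarrow> 'g set \<Rightarrow> 'g set \<Rightarrow> bool" where
  "is_semidirect P N H \<longleftrightarrow>
     N \<lhd> P \<and> subgroup H P \<and> N <#>\<^bsub>P\<^esub> H = carrier P \<and> N \<inter> H = {\<one>\<^bsub>P\<^esub>}"

section \<open>Quaternion algebras\<close>

text \<open>\<open>Quat x y z w\<close> stands for $x + y Z + z F + w ZF$.\<close>

datatype 'k quat = Quat 'k 'k 'k 'k

fun quat_add :: "'k::comm_ring_1 quat \<Rightarrow> 'k quat \<Rightarrow> 'k quat" where
  "quat_add (Quat x y z w) (Quat x' y' z' w') = Quat (x + x') (y + y') (z + z') (w + w')"

fun quat_mult :: "'k::comm_ring_1 \<Rightarrow> 'k \<Rightarrow> 'k quat \<Rightarrow> 'k quat \<Rightarrow> 'k quat" where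
  "quat_mult \<alpha> \<beta> (Quat x y z w) (Quat x' y' z' w') =
     Quat (x * x' + \<alpha> * y * y' + \<beta> * z * z' - \<alpha> * \<beta> * w * w')
          (x * y' + y * x' - \<beta> * z * w' + \<beta> * w * z')
          (x * z' + z * x' + \<alpha> * y * w' - \<alpha> * w * y')
          (x * w' + w * x' + y * z' - z * y')"

definition quat_alg :: "'k::comm_ring_1 \<Rightarrow> 'k \<Rightarrow> 'k quat ring" where
  "quat_alg \<alpha> \<beta> =
     \<lparr>carrier = UNIV, monoid.mult = quat_mult \<alpha> \<beta>, one = Quat 1 0 0 0,
      ring.zero = Quat 0 0 0 0, add = quat_add\<rparr>"

definition scalar :: "'k::comm_ring_1 \<Rightarrow> 'k quat" where
  "scalar x = Quat x 0 0 0"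

definition elZ :: "'k::comm_ring_1 quat" where
  "elZ = Quat 0 1 0 0"

definition elF :: "'k::comm_ring_1 quat" where
  "elF = Quat 0 0 1 0"

lemma ring_quat_alg: "ring (quat_alg \<alpha> \<beta>)"
proof (rule ringI)
  show "abelian_group (quat_alg \<alpha> \<beta>)"
  proof (rule abelian_groupI)
    fix u assume "u \<in> carrier (quat_alg \<alpha> \<beta>)"
    obtain x y z w where u: "u = Quat x y z w" by (cases u)
    show "\<exists>v\<in>carrier (quat_alg \<alpha> \<beta>). v \<oplus>\<^bsub>quat_alg \<alpha> \<beta>\<^esub> u = \<zero>\<^bsub>quat_alg \<alpha> \<beta>\<^esub>"
      by (rule bexI[of _ "Quat (- x) (- y) (- z) (- w)"]) (auto simp: quat_alg_def u)
  next
    fix u v w assume "u \<in> carrier (quat_alg \<alpha> \<beta>)"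
    show "u \<oplus>\<^bsub>quat_alg \<alpha> \<beta>\<^esub> v \<oplus>\<^bsub>quat_alg \<alpha> \<beta>\<^esub> w = u \<oplus>\<^bsub>quat_alg \<alpha> \<beta>\<^esub> (v \<oplus>\<^bsub>quat_alg \<alpha> \<beta>\<^esub> w)"
      by (cases u; cases v; cases w) (simp add: quat_alg_def algebra_simps)
    show "u \<oplus>\<^bsub>quat_alg \<alpha> \<beta>\<^esub> v = v \<oplus>\<^bsub>quat_alg \<alpha> \<beta>\<^esub> u"
      by (cases u; cases v) (simp add: quat_alg_def algebra_simps)
    show "\<zero>\<^bsub>quat_alg \<alpha> \<beta>\<^esub> \<oplus>\<^bsub>quat_alg \<alpha> \<beta>\<^esub> u = u"
      by (cases u) (simp add: quat_alg_def)
  qed (auto simp: quat_alg_def)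
  show "monoid (quat_alg \<alpha> \<beta>)"
  proof (rule monoidI)
    fix u v w :: "'a quat"
    show "u \<otimes>\<^bsub>quat_alg \<alpha> \<beta>\<^esub> v \<otimes>\<^bsub>quat_alg \<alpha> \<beta>\<^esub> w = u \<otimes>\<^bsub>quat_alg \<alpha> \<beta>\<^esub> (v \<otimes>\<^bsub>quat_alg \<alpha> \<beta>\<^esub> w)"
      by (cases u; cases v; cases w) (simp add: quat_alg_def algebra_simps)
    show "\<one>\<^bsub>quat_alg \<alpha> \<beta>\<^esub> \<otimes>\<^bsub>quat_alg \<alpha> \<beta>\<^esub> u = u"
      by (cases u) (simp add: quat_alg_def)
    show "u \<otimes>\<^bsub>quat_alg \<alpha> \<beta>\<^esub> \<one>\<^bsub>quat_alg \<alpha> \<beta>\<^esub> = u"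
      by (cases u) (simp add: quat_alg_def)
  qed (auto simp: quat_alg_def)
  fix u v w :: "'a quat"
  show "(u \<oplus>\<^bsub>quat_alg \<alpha> \<beta>\<^esub> v) \<otimes>\<^bsub>quat_alg \<alpha> \<beta>\<^esub> w =
      u \<otimes>\<^bsub>quat_alg \<alpha> \<beta>\<^esub> w \<oplus>\<^bsub>quat_alg \<alpha> \<beta>\<^esub> v \<otimes>\<^bsub>quat_alg \<alpha> \<beta>\<^esub> w"
    by (cases u; cases v; cases w) (simp add: quat_alg_def algebra_simps)
  show "w \<otimes>\<^bsub>quat_alg \<alpha> \<beta>\<^esub> (u \<oplus>\<^bsub>quat_alg \<alpha> \<beta>\<^esub> v) =
      w \<otimes>\<^bsub>quat_alg \<alpha> \<beta>\<^esub> u \<oplus>\<^bsub>quat_alg \<alpha> \<beta>\<^esub> w \<otimes>\<^bsub>quat_alg \<alpha> \<beta>\<^esub> v"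
    by (cases u; cases v; cases w) (simp add: quat_alg_def algebra_simps)
qed

lemma quat_alg_relations:
  "elZ \<otimes>\<^bsub>quat_alg \<alpha> \<beta>\<^esub> elZ = scalar \<alpha>"
  "elF \<otimes>\<^bsub>quat_alg \<alpha> \<beta>\<^esub> elF = scalar \<beta>"
  "elZ \<otimes>\<^bsub>quat_alg \<alpha> \<beta>\<^esub> elF \<oplus>\<^bsub>quat_alg \<alpha> \<beta>\<^esub> elF \<otimes>\<^bsub>quat_alg \<alpha> \<beta>\<^esub> elZ = \<zero>\<^bsub>quat_alg \<alpha> \<beta>\<^esub>"
  by (simp_all add: quat_alg_def elZ_def elF_def scalar_def)

lemma quat_alg_basis:
  "Quat x y z w =
     scalar x \<oplus>\<^bsub>quat_alg \<alpha> \<beta>\<^esub> scalar y \<otimes>\<^bsub>quat_alg \<alpha> \<beta>\<^esub> elZ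
       \<oplus>\<^bsub>quat_alg \<alpha> \<beta>\<^esub> scalar z \<otimes>\<^bsub>quat_alg \<alpha> \<beta>\<^esub> elF
       \<oplus>\<^bsub>quat_alg \<alpha> \<beta>\<^esub> scalar w \<otimes>\<^bsub>quat_alg \<alpha> \<beta>\<^esub> (elZ \<otimes>\<^bsub>quat_alg \<alpha> \<beta>\<^esub> elF)"
  by (simp add: quat_alg_def elZ_def elF_def scalar_def)

section \<open>The algebra $D$ and the group $G$\<close>

text \<open>The finite field is the type \<open>'a\<close>, so that $q$ is \<open>CARD('a)\<close>, and $K$ is \<open>'a poly fract\<close>.\<close>

definition fq :: "'a::field \<Rightarrow> 'a poly fract" where
  "fq x = to_fract [:x:]"

definition tK :: "'a::field poly fract" where
  "tK = to_fract [:0, 1:]"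

definition DK :: "'a::field \<Rightarrow> 'a poly fract quat ring" where
  "DK c = quat_alg (fq c) (tK * (tK - 1))"

definition K_star :: "'a::field poly fract quat set" where
  "K_star = scalar ` {x. x \<noteq> 0}"

definition GK :: "'a::field \<Rightarrow> 'a poly fract quat set monoid" where
  "GK c = units_of (DK c) Mod K_star"

definition cls :: "'a::field \<Rightarrow> 'a poly fract quat \<Rightarrow> 'a poly fract quat set" where
  "cls c u = K_star #>\<^bsub>units_of (DK c)\<^esub> u"

definition ringR' :: "'a::field \<Rightarrow> 'a poly fract set" where
  "ringR' \<tau> = generate_ring ring_of_type_algebra
     (range fq \<union> {tK, 1 / (tK * (tK - fq \<tau>))})"

definition ringR :: "'a::field \<Rightarrow> 'a poly fract set" where
  "ringR \<tau> = generate_ring ring_of_type_algebra (ringR' \<tau> \<union> {1 / (tK - 1)})"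

text \<open>The order $S \oplus SZ \oplus SF \oplus SZF$ for a subring $S$ of $K$.\<close>

definition quat_order :: "'a::field \<Rightarrow> 'a poly fract set \<Rightarrow> 'a poly fract quat ring" where
  "quat_order c S = (DK c)\<lparr>carrier := {u. set_quat u \<subseteq> S}\<rparr>"

text \<open>$G(S)$ as a subgroup of $G(K)$: the image of the units of the order, which is the quotient
  of these units by $S^*$ because the kernel of the projection is the set of scalar units
  (lemma \<open>cls_eq_iff_order\<close>).\<close>

definition G_pts :: "'a::field \<Rightarrow> 'a poly fract set \<Rightarrow> 'a poly fract quat set set" where
  "G_pts c S = cls c ` Units (quat_order c S)"

definition GS :: "'a::field \<Rightarrow> 'a poly fract set \<Rightarrow> 'a poly fract quat set monoid" where
  "GS c S = (GK c)\<lparr>carrier := G_pts c S\<rparr>"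

lemma quat_order_simps [simp]:
  "carrier (quat_order c S) = {u. set_quat u \<subseteq> S}"
  "u \<otimes>\<^bsub>quat_order c S\<^esub> v = u \<otimes>\<^bsub>DK c\<^esub> v"
  "\<one>\<^bsub>quat_order c S\<^esub> = \<one>\<^bsub>DK c\<^esub>"
  by (simp_all add: quat_order_def)

lemma ring_DK: "ring (DK c)"
  unfolding DK_def by (rule ring_quat_alg)

lemma carrier_DK [simp]: "carrier (DK c) = UNIV"
  by (simp add: DK_def quat_alg_def)

lemma scalar_mult_DK:
  "scalar x \<otimes>\<^bsub>DK c\<^esub> Quat y0 y1 y2 y3 = Quat (x * y0) (x * y1) (x * y2) (x * y3)"
  "Quat y0 y1 y2 y3 \<otimes>\<^bsub>DK c\<^esub> scalar x = Quat (x * y0) (x * y1) (x * y2) (x * y3)"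
  by (simp_all add: DK_def quat_alg_def scalar_def mult.commute)

lemma scalar_central: "scalar x \<otimes>\<^bsub>DK c\<^esub> u = u \<otimes>\<^bsub>DK c\<^esub> scalar x"
  by (cases u) (simp add: scalar_mult_DK)

lemma one_DK: "\<one>\<^bsub>DK c\<^esub> = scalar 1"
  by (simp add: DK_def quat_alg_def scalar_def)

lemma scalar_mult_scalar: "scalar x \<otimes>\<^bsub>DK c\<^esub> scalar y = scalar (x * y)"
  by (simp add: DK_def quat_alg_def scalar_def)

lemma K_star_Units: "K_star \<subseteq> Units (DK c)"
proof
  fix u :: "'a poly fract quat" assume "u \<in> K_star"
  then obtain x where x: "x \<noteq> 0" "u = scalar x" by (auto simp: K_star_def)
  then have "scalar (inverse x) \<otimes>\<^bsub>DK c\<^esub> u = \<one>\<^bsub>DK c\<^esub>" "u \<otimes>\<^bsub>DK c\<^esub> scalar (inverse x) = \<one>\<^bsub>DK c\<^esub>"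
    by (simp_all add: scalar_mult_scalar one_DK)
  then show "u \<in> Units (DK c)" by (auto simp: Units_def)
qed

lemma group_units_DK: "group (units_of (DK c))"
  using ring_DK ring.is_monoid monoid.units_group by blast

lemma K_star_normal:
  fixes c :: "'a::field"
  shows "K_star \<lhd> units_of (DK c)"
proof -
  interpret group "units_of (DK c)" by (rule group_units_DK)
  interpret D: ring "DK c" by (rule ring_DK)
  have U: "carrier (units_of (DK c)) = Units (DK c)"
    "\<And>u v. u \<otimes>\<^bsub>units_of (DK c)\<^esub> v = u \<otimes>\<^bsub>DK c\<^esub> v" "\<one>\<^bsub>units_of (DK c)\<^esub> = \<one>\<^bsub>DK c\<^esub>"
    by (simp_all add: units_of_def)
  have sub: "subgroup K_star (units_of (DK c))"
  proof (rule subgroupI)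
    show "K_star \<subseteq> carrier (units_of (DK c))" using K_star_Units U by blast
    show "(K_star :: 'a poly fract quat set) \<noteq> {}" by (auto simp: K_star_def intro: exI[of _ 1])
    fix u :: "'a poly fract quat" assume u: "u \<in> K_star"
    then obtain x where x: "x \<noteq> 0" "u = scalar x" by (auto simp: K_star_def)
    have "inv\<^bsub>units_of (DK c)\<^esub> u = scalar (inverse x)"
    proof (rule inv_equality)
      show "scalar (inverse x) \<otimes>\<^bsub>units_of (DK c)\<^esub> u = \<one>\<^bsub>units_of (DK c)\<^esub>"
        using x by (simp add: U scalar_mult_scalar one_DK)
      show "u \<in> carrier (units_of (DK c))" using u K_star_Units U by blast
      have "scalar (inverse x) \<in> K_star" using x by (auto simp: K_star_def)
      then show "scalar (inverse x) \<in> carrier (units_of (DK c))" using K_star_Units U by blast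
    qed
    then show "inv\<^bsub>units_of (DK c)\<^esub> u \<in> K_star" using x by (auto simp: K_star_def)
    fix v :: "'a poly fract quat" assume "v \<in> K_star"
    then obtain y where "y \<noteq> 0" "v = scalar y" by (auto simp: K_star_def)
    then show "u \<otimes>\<^bsub>units_of (DK c)\<^esub> v \<in> K_star"
      using x by (auto simp: U scalar_mult_scalar K_star_def)
  qed
  show ?thesis
  proof (rule normal_invI[OF sub])
    fix u h :: "'a poly fract quat" assume u: "u \<in> carrier (units_of (DK c))" and h: "h \<in> K_star"
    then obtain x where x: "h = scalar x" by (auto simp: K_star_def)
    have "h \<in> carrier (units_of (DK c))" using h K_star_Units U by blast
    moreover have "u \<otimes>\<^bsub>units_of (DK c)\<^esub> h = h \<otimes>\<^bsub>units_of (DK c)\<^esub> u"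
      by (simp add: x U scalar_central)
    ultimately have "u \<otimes>\<^bsub>units_of (DK c)\<^esub> h \<otimes>\<^bsub>units_of (DK c)\<^esub> inv\<^bsub>units_of (DK c)\<^esub> u = h"
      using u by (simp add: m_assoc)
    then show "u \<otimes>\<^bsub>units_of (DK c)\<^esub> h \<otimes>\<^bsub>units_of (DK c)\<^esub> inv\<^bsub>units_of (DK c)\<^esub> u \<in> K_star"
      using h by simp
  qed
qed

lemma group_GK: "group (GK c)"
  unfolding GK_def by (rule normal.factorgroup_is_group) (rule K_star_normal)

lemma cls_mult:
  assumes "u \<in> Units (DK c)" "v \<in> Units (DK c)"
  shows "cls c u \<otimes>\<^bsub>GK c\<^esub> cls c v = cls c (u \<otimes>\<^bsub>DK c\<^esub> v)"
  using normal.rcos_sum[OF K_star_normal, of u c v] assms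
  by (simp add: cls_def GK_def FactGroup_def units_of_def)

lemma subring_closed:
  fixes S :: "'a::field set"
  assumes "subring S ring_of_type_algebra"
  shows "0 \<in> S" "1 \<in> S" "\<And>x y. x \<in> S \<Longrightarrow> y \<in> S \<Longrightarrow> x + y \<in> S"
    "\<And>x y. x \<in> S \<Longrightarrow> y \<in> S \<Longrightarrow> x * y \<in> S"
    "\<And>x y. x \<in> S \<Longrightarrow> y \<in> S \<Longrightarrow> x - y \<in> S"
proof -
  interpret K: ring "ring_of_type_algebra :: 'a ring" by (rule ring_from_type_algebra)
  have neg: "\<ominus>\<^bsub>ring_of_type_algebra\<^esub> y = - y" for y :: 'a
    by (rule K.minus_equality) (simp_all add: ring_of_type_algebra_def)
  note a = subringE[OF assms]
  show "0 \<in> S" "1 \<in> S" using a(2,3) by (simp_all add: ring_of_type_algebra_def)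
  show add: "x + y \<in> S" if "x \<in> S" "y \<in> S" for x y
    using a(7)[OF that] by (simp add: ring_of_type_algebra_def)
  show "x * y \<in> S" if "x \<in> S" "y \<in> S" for x y
    using a(6)[OF that] by (simp add: ring_of_type_algebra_def)
  show "x - y \<in> S" if "x \<in> S" "y \<in> S" for x y
    using add[OF that(1) a(5)[OF that(2)]] by (simp add: neg)
qed

lemma subring_ringR': "subring (ringR' \<tau>) ring_of_type_algebra"
  unfolding ringR'_def
  by (rule ring.generate_ring_is_subring[OF ring_from_type_algebra])
     (simp only: ring_of_type_algebra_def partial_object.simps subset_UNIV)

lemma subring_ringR: "subring (ringR \<tau>) ring_of_type_algebra"
  unfolding ringR_def
  by (rule ring.generate_ring_is_subring[OF ring_from_type_algebra])
     (simp only: ring_of_type_algebra_def partial_object.simps subset_UNIV)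

lemma cls_eq_iff_order:
  fixes c :: "'a::field" and S :: "'a poly fract set"
  assumes c: "fq c \<in> S" and t: "tK \<in> S" and S: "subring S ring_of_type_algebra"
    and u: "u \<in> Units (quat_order c S)" and v: "v \<in> Units (quat_order c S)"
  shows "cls c u = cls c v \<longleftrightarrow> (\<exists>r\<in>S. \<exists>r'\<in>S. r * r' = 1 \<and> u = scalar r \<otimes>\<^bsub>DK c\<^esub> v)"
proof -
  interpret U: group "units_of (DK c)" by (rule group_units_DK)
  interpret D: ring "DK c" by (rule ring_DK)
  have sub: "subgroup K_star (units_of (DK c))"
    using K_star_normal by (rule normal_imp_subgroup)
  have units: "w \<in> Units (DK c)" if "w \<in> Units (quat_order c S)" for w
    using that by (auto simp: Units_def)
  note cl = subring_closed[OF S]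
  have prod: "set_quat (w \<otimes>\<^bsub>DK c\<^esub> w') \<subseteq> S" if "set_quat w \<subseteq> S" "set_quat w' \<subseteq> S" for w w'
    using that c t by (cases w; cases w') (auto simp: DK_def quat_alg_def intro!: cl)
  have quot: "x \<in> S" if w: "w \<in> Units (quat_order c S)" and w': "w' \<in> Units (quat_order c S)"
    and eq: "w = scalar x \<otimes>\<^bsub>DK c\<^esub> w'" for x w w'
  proof -
    obtain w'' where w'': "set_quat w'' \<subseteq> S" "w' \<otimes>\<^bsub>DK c\<^esub> w'' = \<one>\<^bsub>DK c\<^esub>"
      using w' by (auto simp: Units_def)
    have "w \<otimes>\<^bsub>DK c\<^esub> w'' = scalar x"
      using w'' by (simp add: eq D.m_assoc)
    moreover have "set_quat w \<subseteq> S" using w by (auto simp: Units_def)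
    ultimately have "set_quat (scalar x) \<subseteq> S" using prod w'' by metis
    then show ?thesis by (simp add: scalar_def)
  qed
  show ?thesis
  proof
    assume "cls c u = cls c v"
    moreover have "u \<in> cls c u"
      unfolding cls_def using units[OF u] sub by (intro U.rcos_self) (simp_all add: units_of_def)
    ultimately obtain x where x: "x \<noteq> 0" "u = scalar x \<otimes>\<^bsub>DK c\<^esub> v"
      by (auto simp: cls_def r_coset_def K_star_def units_of_def)
    then have "scalar (inverse x) \<otimes>\<^bsub>DK c\<^esub> u = (scalar (inverse x) \<otimes>\<^bsub>DK c\<^esub> scalar x) \<otimes>\<^bsub>DK c\<^esub> v"
      by (simp add: D.m_assoc)
    then have "v = scalar (inverse x) \<otimes>\<^bsub>DK c\<^esub> u"
      using x D.l_one[of v] by (simp add: scalar_mult_scalar one_DK)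
    then show "\<exists>r\<in>S. \<exists>r'\<in>S. r * r' = 1 \<and> u = scalar r \<otimes>\<^bsub>DK c\<^esub> v"
      using x(1) x(2) quot[OF u v x(2)] quot[OF v u, of "inverse x"]
      by (intro bexI[of _ x] bexI[of _ "inverse x"] conjI) simp_all
  next
    assume "\<exists>r\<in>S. \<exists>r'\<in>S. r * r' = 1 \<and> u = scalar r \<otimes>\<^bsub>DK c\<^esub> v"
    then obtain r r' where rr': "r * r' = 1" and ru: "u = scalar r \<otimes>\<^bsub>DK c\<^esub> v" by blast
    from rr' have "r \<noteq> 0" by auto
    note r = this ru
    have "scalar r \<in> K_star" using r by (simp add: K_star_def)
    then have "u \<in> cls c v"
      using r by (auto simp: cls_def r_coset_def units_of_def)
    then show "cls c u = cls c v"
      unfolding cls_def using units[OF v] sub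
      by (intro U.repr_independence[symmetric]) (simp_all add: units_of_def)
  qed
qed

lemma fq_tK_in_ringR': "fq x \<in> ringR' \<tau>" "tK \<in> ringR' \<tau>"
  unfolding ringR'_def by (auto intro: generate_ring.incl)

lemma fq_tK_in_ringR: "fq x \<in> ringR \<tau>" "tK \<in> ringR \<tau>"
  unfolding ringR_def by (auto intro: generate_ring.incl fq_tK_in_ringR')

section \<open>The field $F_q[Z]$\<close>

definition FqZ :: "'a::field poly fract quat set" where
  "FqZ = {Quat (fq x) (fq y) 0 0 | x y. True}"

definition FqZ_star :: "'a::field \<Rightarrow> 'a poly fract quat monoid" where
  "FqZ_star c = units_of ((DK c)\<lparr>carrier := FqZ\<rparr>)"

definition Fq_star :: "'a::field poly fract quat set" where
  "Fq_star = {scalar (fq x) | x. x \<noteq> 0}"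

text \<open>Equality in the quotient of the unit group of $F_q[Z]$ by that of $F_q$; both sides are
  required to be units.\<close>

definition eq_mod_Fq :: "'a::field \<Rightarrow> 'a poly fract quat \<Rightarrow> 'a poly fract quat \<Rightarrow> bool" where
  "eq_mod_Fq c u v \<longleftrightarrow> u \<in> carrier (FqZ_star c) \<and> v \<in> carrier (FqZ_star c) \<and>
     Fq_star #>\<^bsub>FqZ_star c\<^esub> u = Fq_star #>\<^bsub>FqZ_star c\<^esub> v"

definition bar :: "'a::{field,finite} \<Rightarrow> 'a poly fract quat \<Rightarrow> 'a poly fract quat" where
  "bar c w = w [^]\<^bsub>DK c\<^esub> CARD('a)"

definition nrm :: "'a::{field,finite} \<Rightarrow> 'a poly fract quat \<Rightarrow> 'a poly fract quat" where
  "nrm c w = w \<otimes>\<^bsub>DK c\<^esub> bar c w"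

definition wp :: "'a::{field,finite} \<Rightarrow> 'a poly fract quat \<Rightarrow> 'a poly fract quat" where
  "wp c w = w \<otimes>\<^bsub>DK c\<^esub> inv\<^bsub>DK c\<^esub> (bar c w)"

section \<open>Generators, subgroups and relations\<close>

definition gam :: "'a::field \<Rightarrow> 'a poly fract quat \<Rightarrow> 'a poly fract quat" where
  "gam c \<xi> = scalar tK \<otimes>\<^bsub>DK c\<^esub> elZ \<oplus>\<^bsub>DK c\<^esub> \<xi> \<otimes>\<^bsub>DK c\<^esub> elF"

datatype gens = Gd | Gs | Ga | Gb

fun gen_val :: "'a::field \<Rightarrow> 'a poly fract quat \<Rightarrow> 'a poly fract quat \<Rightarrow> gens \<Rightarrow> 'a poly fract quat set"
where
  "gen_val c \<delta> \<zeta> Gd = cls c \<delta>"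
| "gen_val c \<delta> \<zeta> Gs = cls c elF"
| "gen_val c \<delta> \<zeta> Ga = cls c (gam c elZ)"
| "gen_val c \<delta> \<zeta> Gb = cls c (gam c (elZ \<otimes>\<^bsub>DK c\<^esub> inv\<^bsub>DK c\<^esub> \<zeta>))"

definition Lambda :: "'a::field \<Rightarrow> 'a poly fract quat \<Rightarrow> 'a poly fract quat \<Rightarrow> 'a poly fract quat set set" where
  "Lambda c \<delta> \<zeta> = generate (GK c) (gen_val c \<delta> \<zeta> ` {Gd, Gs, Ga, Gb})"

definition Lambda' :: "'a::field \<Rightarrow> 'a poly fract quat \<Rightarrow> 'a poly fract quat \<Rightarrow> 'a poly fract quat set set" where
  "Lambda' c \<delta> \<zeta> = generate (GK c) (gen_val c \<delta> \<zeta> ` {Gd, Ga, Gb})"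

definition Delta :: "'a::field \<Rightarrow> 'a poly fract quat \<Rightarrow> 'a poly fract quat set set" where
  "Delta c \<delta> = generate (GK c) {cls c \<delta>, cls c elF}"

definition Gamma :: "'a::{field,finite} \<Rightarrow> 'a \<Rightarrow> 'a poly fract quat set set" where
  "Gamma c \<tau> = generate (GK c)
     ({cls c (gam c \<xi> \<otimes>\<^bsub>DK c\<^esub> elZ) | \<xi>. \<xi> \<in> FqZ \<and> nrm c \<xi> = scalar (fq (- c))} \<union>
      {cls c (gam c \<eta> \<otimes>\<^bsub>DK c\<^esub> elZ) | \<eta>. \<eta> \<in> FqZ \<and> nrm c \<eta> = scalar (fq (c * \<tau> / (1 - \<tau>)))})"

definition star_cond :: "'a::{field,finite} \<Rightarrow> 'a poly fract quat \<Rightarrow> 'a poly fract quat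
    \<Rightarrow> nat \<Rightarrow> nat \<Rightarrow> nat \<Rightarrow> nat \<Rightarrow> bool" where
  "star_cond c \<delta> \<zeta> i j k l \<longleftrightarrow>
     eq_mod_Fq c (\<delta> [^]\<^bsub>DK c\<^esub> j)
       ((\<delta> [^]\<^bsub>DK c\<^esub> l \<ominus>\<^bsub>DK c\<^esub>
          \<zeta> \<otimes>\<^bsub>DK c\<^esub> wp c (\<delta> [^]\<^bsub>DK c\<^esub> i) \<otimes>\<^bsub>DK c\<^esub> \<delta> [^]\<^bsub>DK c\<^esub> (CARD('a) * l)) \<otimes>\<^bsub>DK c\<^esub> elZ) \<and>
     eq_mod_Fq c (\<delta> [^]\<^bsub>DK c\<^esub> k)
       ((\<delta> [^]\<^bsub>DK c\<^esub> i \<ominus>\<^bsub>DK c\<^esub>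
          inv\<^bsub>DK c\<^esub> \<zeta> \<otimes>\<^bsub>DK c\<^esub> wp c (\<delta> [^]\<^bsub>DK c\<^esub> l) \<otimes>\<^bsub>DK c\<^esub> \<delta> [^]\<^bsub>DK c\<^esub> (CARD('a) * i)) \<otimes>\<^bsub>DK c\<^esub> elZ)"

definition conj_d :: "nat \<Rightarrow> gens \<Rightarrow> gens word" where
  "conj_d i x = word_pow [(Gd, True)] i @ letter x @ word_pow [(Gd, False)] i"

definition square_rels :: "'a::{field,finite} \<Rightarrow> 'a poly fract quat \<Rightarrow> 'a poly fract quat
    \<Rightarrow> (gens word \<times> gens word) set" where
  "square_rels c \<delta> \<zeta> =
     {(conj_d i Ga @ conj_d j Gb, conj_d l Gb @ conj_d k Ga) | i j k l.
        i \<le> CARD('a) \<and> j \<le> CARD('a) \<and> k \<le> CARD('a) \<and> l \<le> CARD('a) \<and> star_cond c \<delta> \<zeta> i j k l}"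

text \<open>The exponent \<open>m\<close> in the relation for \<open>s \<zeta> b\<close> is the unique one in the range $0, \ldots, q$
  for which $\delta^m$ and $\zeta$ agree modulo scalars.\<close>

definition relsR :: "'a::{field,finite} \<Rightarrow> 'a poly fract quat \<Rightarrow> 'a poly fract quat
    \<Rightarrow> (gens word \<times> gens word) set" where
  "relsR c \<delta> \<zeta> =
     {(word_pow (letter Gd) (CARD('a) + 1), []),
      (word_pow (letter Gs) 2, []),
      (word_pow (letter Gd @ letter Gs) 2, []),
      (word_pow (letter Ga) 2, []),
      (word_pow (letter Gb) 2, []),
      (word_pow (letter Gs @ letter Ga) 2, [])} \<union>
     {(word_pow (letter Gs @ word_pow (letter Gd) m @ letter Gb) 2, []) | m.
        m \<le> CARD('a) \<and> eq_mod_Fq c (\<delta> [^]\<^bsub>DK c\<^esub> m) \<zeta>} \<union>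
     square_rels c \<delta> \<zeta>"

definition relsR' :: "'a::{field,finite} \<Rightarrow> 'a poly fract quat \<Rightarrow> 'a poly fract quat
    \<Rightarrow> (gens word \<times> gens word) set" where
  "relsR' c \<delta> \<zeta> =
     {(word_pow (letter Gd) (CARD('a) + 1), []),
      (word_pow (letter Ga) 2, []),
      (word_pow (letter Gb) 2, [])} \<union>
     square_rels c \<delta> \<zeta>"

end

theory Submission
  imports Defs
begin

text \<open>A class in $G(R)$ has a representative $u$ with polynomial coordinates and reduced norm
  $a t^i (t-1)^j (t-\tau)^k$. It acts on the product of the trees at the split places $\infty$ and
  $t = \tau$, where its reduction is a nonzero $2 \times 2$ matrix, singular unless $u$ fixes the base
  vertex of the tree. The involutions $\gamma_\xi$ with $N(\xi) = -c$ (at $\infty$) and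
  $N(\xi) = c\tau/(1-\tau)$ (at $\tau$) have singular reductions, and a singular nonzero reduction is
  annihilated by exactly one of them. Existence gives a descent to the finite stabilizer, hence
  generators; uniqueness shows that a reduced word in the $\gamma_\xi$ of the first kind, then of the
  second kind, then an element of the stabilizer is scalar only if it is trivial. By the square
  relations $\gamma_\xi \gamma_\eta = \gamma_{\eta'} \gamma_{\xi'}$, which amount to $\xi \bar\eta = \eta' \bar\xi'$
  and $\eta - \xi = \xi' - \eta'$, every element of the presented group has such a normal form. The
  intersection of \<open>\<Gamma>\<close> and \<open>\<Delta>\<close> is controlled at the ramified place $t = 1$.\<close>

section \<open>Evaluation of words and the universal property of a presented group\<close>

section \<open>Presentations\<close>

text \<open>Write a quaternion as A + BF with A and B in F_q[Z]. Every local statement rests on the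
  anisotropy of N(x + yZ) = x^2 - c y^2. It yields both existence and uniqueness of the annihilating
  \<gamma>_\<xi>. At the ramified places t = 0 and t = 1, where F^2 = t(t - 1) vanishes, it lets a
  double zero of the reduced norm be divided out of the quaternion. These places therefore carry no
  tree. Of the exponent of t - 1 only the parity survives as an invariant, and F has odd parity:
  this is the whole difference between G(R) and G(R').

  The two values of N(\<xi>) come from the reduced norm t (N(\<xi>) - (c + N(\<xi>)) t) of
  \<gamma>_\<xi>. Its second factor drops to a constant for N(\<xi>) = -c, which is a zero at
  infinity, and vanishes at \<tau> for N(\<xi>) = c\<tau> / (1 - \<tau>). Involutions of the second
  kind are invertible at infinity, so a mixed word can be tested at infinity for its letters of the
  first kind alone.\<close>

primrec word_eval :: "('g, 'm) monoid_scheme \<Rightarrow> ('x \<Rightarrow> 'g) \<Rightarrow> 'x word \<Rightarrow> 'g" where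
  "word_eval G f [] = \<one>\<^bsub>G\<^esub>"
| "word_eval G f (l # w) =
     (if snd l then f (fst l) else inv\<^bsub>G\<^esub> f (fst l)) \<otimes>\<^bsub>G\<^esub> word_eval G f w"

definition satisfies :: "('g, 'm) monoid_scheme \<Rightarrow> ('x \<Rightarrow> 'g) \<Rightarrow> ('x word \<times> 'x word) set \<Rightarrow> bool" where
  "satisfies G f E \<longleftrightarrow> (\<forall>(u, v) \<in> E. word_eval G f u = word_eval G f v)"

lemma words_Nil [simp]: "[] \<in> words S"
  and words_Cons [simp]: "l # w \<in> words S \<longleftrightarrow> fst l \<in> S \<and> w \<in> words S"
  by (cases l; auto simp: words_def)+

lemma words_append_iff [simp]: "u @ v \<in> words S \<longleftrightarrow> u \<in> words S \<and> v \<in> words S"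
  by (induction u) auto

lemma words_pow [simp]: "w \<in> words S \<Longrightarrow> word_pow w n \<in> words S"
  by (induction n) (auto simp: word_pow_def)

lemma words_letter [simp]: "letter x \<in> words S \<longleftrightarrow> x \<in> S"
  by (simp add: letter_def)

context group
begin

lemma word_eval_closed [simp, intro]: "f ` S \<subseteq> carrier G \<Longrightarrow> w \<in> words S \<Longrightarrow> word_eval G f w \<in> carrier G"
  by (induction w) auto

lemma word_eval_append:
  "f ` S \<subseteq> carrier G \<Longrightarrow> u \<in> words S \<Longrightarrow> v \<in> words S \<Longrightarrow>
     word_eval G f (u @ v) = word_eval G f u \<otimes> word_eval G f v"
proof (induction u)
  case (Cons l u)
  have "word_eval G f u \<in> carrier G" "word_eval G f v \<in> carrier G" "f (fst l) \<in> carrier G"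
    using Cons.prems by auto
  with Cons show ?case by (auto simp: m_assoc)
qed auto

lemma word_eval_letter: "f x \<in> carrier G \<Longrightarrow> word_eval G f (letter x) = f x"
  by (simp add: letter_def)

lemma word_eval_pow:
  assumes "f ` S \<subseteq> carrier G" "w \<in> words S"
  shows "word_eval G f (word_pow w n) = word_eval G f w [^] n"
proof (induction n)
  case 0
  then show ?case by (simp add: word_pow_def)
next
  case (Suc n)
  have "word_eval G f (word_pow w (Suc n)) = word_eval G f (w @ word_pow w n)"
    by (simp add: word_pow_def)
  also have "\<dots> = word_eval G f w \<otimes> word_eval G f w [^] n"
    using assms Suc by (simp add: word_eval_append[of f S])
  finally show ?case
    using nat_pow_Suc2 assms by (metis word_eval_closed)
qed

lemma word_eval_cong:
  assumes f: "f ` S \<subseteq> carrier G" and sat: "satisfies G f E"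
    and uv: "(u, v) \<in> word_cong S E"
  shows "word_eval G f u = word_eval G f v"
  using uv
proof induction
  case (append u u' v v')
  then show ?case using word_cong_words f by (metis word_eval_append)
next
  case (cancel x e)
  then have "f x \<in> carrier G" using f by auto
  then show ?case by (cases e) auto
next
  case (equation u v)
  then show ?case using sat by (auto simp: satisfies_def)
qed auto

text \<open>Inverses of generators need no case of their own: if s^n = 1 with n > 0, then s^(n-1) is
  the inverse of s. The induction over \<open>generate\<close> carries the stronger claim that left
  multiplication by \<open>g\<close> maps \<open>Q\<close> into itself; applied to the identity it
  gives the conclusion.\<close>

lemma generate_left_induct [consumes 1, case_names subset one mult]:
  assumes g: "g \<in> generate G S" and S: "\<And>s. s \<in> S \<Longrightarrow> s \<in> carrier G \<and> (\<exists>n::nat>0. s [^] n = \<one>)"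
    and one: "\<one> \<in> Q" and mult: "\<And>s x. s \<in> S \<Longrightarrow> x \<in> Q \<Longrightarrow> s \<otimes> x \<in> Q" and Q: "Q \<subseteq> carrier G"
  shows "g \<in> Q"
proof -
  have "\<forall>x\<in>Q. g \<otimes> x \<in> Q"
    using g
  proof induction
    case (inv s)
    then obtain n :: nat where n: "n > 0" "s [^] n = \<one>" and s: "s \<in> carrier G" using S by blast
    have pow: "s [^] k \<otimes> x \<in> Q" if "x \<in> Q" for k :: nat and x
      using that
    proof (induction k arbitrary: x)
      case (Suc k)
      then have "s [^] k \<otimes> (s \<otimes> x) \<in> Q" using mult inv by blast
      then show ?case using s Suc.prems Q by (simp add: m_assoc subset_eq)
    qed (use Q in auto)
    have "inv s = s [^] (n - 1)"
    proof (rule inv_equality)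
      have "s [^] (n - 1) \<otimes> s = s [^] Suc (n - 1)" by simp
      then show "s [^] (n - 1) \<otimes> s = \<one>" using n by simp
    qed (use s in auto)
    then show ?case using pow by simp
  next
    case (eng h1 h2)
    have "h1 \<in> carrier G" "h2 \<in> carrier G"
      using eng generate_in_carrier[of S] S by blast+
    then show ?case using eng Q by (auto simp: m_assoc subset_eq)
  qed (use mult Q in auto)
  then have "g \<otimes> \<one> \<in> Q" using one by blast
  moreover have "g \<in> carrier G" using generate_in_carrier[of S g] S g by blast
  ultimately show ?thesis by simp
qed

end

lemma word_eval_hom:
  assumes "group G" "group H" "\<phi> \<in> hom G H" "f ` S \<subseteq> carrier G" "w \<in> words S"
  shows "\<phi> (word_eval G f w) = word_eval H (\<phi> \<circ> f) w"
proof -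
  interpret group_hom G H \<phi> using assms by (simp add: group_hom_def group_hom_axioms_def)
  show ?thesis
    using assms(5)
  proof (induction w)
    case (Cons l w)
    have "word_eval G f w \<in> carrier G" "f (fst l) \<in> carrier G"
      using Cons.prems assms(4) by auto
    then show ?case using Cons by auto
  qed simp
qed

lemma word_class_letter_eval:
  assumes "w \<in> words S"
  shows "word_eval (presented_group S E) (word_class S E \<circ> letter) w = word_class S E w"
  using assms
proof (induction w)
  case Nil
  then show ?case by (simp add: one_presented_group)
next
  case (Cons l w)
  interpret P: group "presented_group S E" by (rule group_presented_group)
  obtain x e where l: "l = (x, e)" by force
  have x: "x \<in> S" and w: "w \<in> words S" using Cons.prems by (auto simp: l)
  have inv: "inv\<^bsub>presented_group S E\<^esub> word_class S E (letter x) = word_class S E [(x, False)]"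
  proof (rule P.inv_equality)
    have "([(x, False), (x, True)], []) \<in> word_cong S E"
      using word_cong.cancel[OF x, of False] by simp
    then show "word_class S E [(x, False)] \<otimes>\<^bsub>presented_group S E\<^esub> word_class S E (letter x) =
        \<one>\<^bsub>presented_group S E\<^esub>"
      using x by (simp add: mult_presented_group one_presented_group letter_def word_class_eq_iff)
  qed (use x in \<open>auto simp: carrier_presented_group\<close>)
  show ?case
    using Cons.IH[OF w] x w inv
    by (cases e) (simp_all add: l mult_presented_group letter_def)
qed

lemma generate_presented_group:
  "generate (presented_group S E) (word_class S E ` letter ` S) = carrier (presented_group S E)"
proof
  let ?P = "presented_group S E"
  interpret P: group ?P by (rule group_presented_group)
  have sub: "word_class S E ` letter ` S \<subseteq> carrier ?P" by (auto simp: carrier_presented_group)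
  then show "generate ?P (word_class S E ` letter ` S) \<subseteq> carrier ?P"
    by (rule P.generate_incl)
  have "word_eval ?P (word_class S E \<circ> letter) w \<in> generate ?P (word_class S E ` letter ` S)"
    if "w \<in> words S" for w
    using that
  proof (induction w)
    case (Cons l w)
    then have "word_class S E (letter (fst l)) \<in> word_class S E ` letter ` S" by simp
    from generate.incl[OF this] generate.inv[OF this] Cons show ?case
      by (auto intro!: generate.eng)
  qed (auto intro: generate.one)
  then show "carrier ?P \<subseteq> generate ?P (word_class S E ` letter ` S)"
    by (auto simp: carrier_presented_group word_class_letter_eval)
qed

lemma satisfies_presented_group:
  assumes "E \<subseteq> words S \<times> words S"
  shows "satisfies (presented_group S E) (word_class S E \<circ> letter) E"
proof -
  have "word_class S E u = word_class S E v" if "(u, v) \<in> E" for u v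
    using that assms word_cong.equation[OF that] by (subst word_class_eq_iff) auto
  then show ?thesis
    using assms by (auto simp: satisfies_def word_class_letter_eval)
qed

text \<open>The universal property: word evaluation is constant on congruence classes, so
  \<open>\<phi>\<close> may evaluate an arbitrarily chosen representative of each class.\<close>

lemma von_dyck:
  assumes G: "group G" and f: "f ` S \<subseteq> carrier G" and sat: "satisfies G f E"
  shows "\<exists>\<phi> \<in> hom (presented_group S E) G. \<forall>x\<in>S. \<phi> (word_class S E (letter x)) = f x"
proof -
  interpret group G by (rule G)
  define \<phi> where "\<phi> A = word_eval G f (SOME w. w \<in> A)" for A
  have \<phi>: "\<phi> (word_class S E w) = word_eval G f w" if "w \<in> words S" for w
  proof -
    have "w \<in> word_class S E w" using that by (auto simp: word_class_def intro: word_cong.refl)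
    then have "(SOME w'. w' \<in> word_class S E w) \<in> word_class S E w" by (rule someI)
    then have "(w, SOME w'. w' \<in> word_class S E w) \<in> word_cong S E" by (simp add: word_class_def)
    then show ?thesis using word_eval_cong[OF f sat] by (simp add: \<phi>_def)
  qed
  show ?thesis
  proof (intro bexI ballI)
    show "\<phi> \<in> hom (presented_group S E) G"
      using f by (auto simp: hom_def carrier_presented_group \<phi> mult_presented_group word_eval_append[of f S])
    fix x assume "x \<in> S"
    then show "\<phi> (word_class S E (letter x)) = f x"
      using f by (subst \<phi>) (auto intro: word_eval_letter)
  qed
qed

text \<open>It suffices to show that a homomorphism onto \<open>G\<close> from any other group generated by elements
  that satisfy the relations is injective, so that no argument need mention words.\<close>

lemma has_finite_presentationI:
  fixes G :: "'g monoid" and S :: "'x set"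
  assumes G: "group G" and fin: "finite S" "finite E" and E: "E \<subseteq> words S \<times> words S"
    and gen: "generate G (f ` S) = carrier G" and sat: "satisfies G f E"
    and inj: "\<And>(P :: 'x word set monoid) h \<phi>. group P \<Longrightarrow> h ` S \<subseteq> carrier P \<Longrightarrow>
       generate P (h ` S) = carrier P \<Longrightarrow> satisfies P h E \<Longrightarrow> \<phi> \<in> hom P G \<Longrightarrow>
       (\<And>x. x \<in> S \<Longrightarrow> \<phi> (h x) = f x) \<Longrightarrow> inj_on \<phi> (carrier P)"
  shows "has_finite_presentation G f S E"
proof -
  let ?P = "presented_group S E" and ?h = "word_class S E \<circ> letter"
  interpret group G by (rule G)
  interpret P: group ?P by (rule group_presented_group)
  have f: "f ` S \<subseteq> carrier G" using gen generate.incl by (metis subsetI)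
  obtain \<phi> where \<phi>: "\<phi> \<in> hom ?P G" "\<And>x. x \<in> S \<Longrightarrow> \<phi> (word_class S E (letter x)) = f x"
    using von_dyck[OF G f sat] by blast
  interpret group_hom ?P G \<phi> using \<phi> by unfold_locales
  have h: "?h ` S \<subseteq> carrier ?P" by (auto simp: carrier_presented_group)
  have "inj_on \<phi> (carrier ?P)"
    using \<phi> h generate_presented_group[of S E]
    by (intro inj[of ?P ?h] satisfies_presented_group E P.group_axioms)
      (simp_all add: image_comp)
  moreover have "\<phi> ` carrier ?P = carrier G"
  proof
    show "\<phi> ` carrier ?P \<subseteq> carrier G" by auto
    have "f ` S \<subseteq> \<phi> ` carrier ?P"
      using \<phi>(2) h by force
    then show "carrier G \<subseteq> \<phi> ` carrier ?P"
      using generate_subgroup_incl[OF _ img_is_subgroup] gen by blast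
  qed
  ultimately have "\<phi> \<in> iso ?P G" using \<phi>(1) by (simp add: iso_def bij_betw_def)
  then show ?thesis using fin E \<phi>(2) by (auto simp: has_finite_presentation_def)
qed

section \<open>Products of two families of involutions and a remaining factor\<close>

section \<open>Normal forms\<close>

context group
begin

lemma foldr_mult_closed [simp]:
  "set xs \<subseteq> carrier G \<Longrightarrow> t \<in> carrier G \<Longrightarrow> foldr (\<otimes>) xs t \<in> carrier G"
  by (induction xs) auto

text \<open>Each swap may change both factors, but only within \<open>U\<close> and
  \<open>V\<close>, so the shape of the product survives. Besides the square relations this also
  serves with a singleton for \<open>V\<close>, where it moves one fixed element through a
  word.\<close>

lemma foldr_mult_push:
  assumes U: "U \<subseteq> carrier G" and V: "V \<subseteq> carrier G"
    and swap: "\<And>u v. u \<in> U \<Longrightarrow> v \<in> V \<Longrightarrow> \<exists>u'\<in>U. \<exists>v'\<in>V. v \<otimes> u = u' \<otimes> v'"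
    and us: "set us \<subseteq> U" and t: "t \<in> carrier G" and v: "v \<in> V"
  shows "\<exists>us'. set us' \<subseteq> U \<and> (\<exists>v'\<in>V. v \<otimes> foldr (\<otimes>) us t = foldr (\<otimes>) us' (v' \<otimes> t))"
  using us v
proof (induction us arbitrary: v)
  case Nil
  then show ?case by (intro exI[of _ "[]"]) auto
next
  case (Cons u us)
  then have u: "u \<in> U" "set us \<subseteq> U" by auto
  obtain u' v' where uv: "u' \<in> U" "v' \<in> V" "v \<otimes> u = u' \<otimes> v'"
    using swap u Cons.prems by blast
  obtain us' v'' where us': "set us' \<subseteq> U" "v'' \<in> V"
    "v' \<otimes> foldr (\<otimes>) us t = foldr (\<otimes>) us' (v'' \<otimes> t)"
    using Cons.IH[of v'] u uv by blast
  have c: "foldr (\<otimes>) us t \<in> carrier G" "u \<in> carrier G" "v \<in> carrier G" "u' \<in> carrier G"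
    "v' \<in> carrier G"
    using u Cons.prems uv U V t by auto
  have "v \<otimes> foldr (\<otimes>) (u # us) t = v \<otimes> u \<otimes> foldr (\<otimes>) us t"
    using c by (simp add: m_assoc)
  also have "\<dots> = u' \<otimes> (v' \<otimes> foldr (\<otimes>) us t)"
    unfolding uv(3) using c by (simp add: m_assoc)
  also have "\<dots> = foldr (\<otimes>) (u' # us') (v'' \<otimes> t)"
    by (simp add: us')
  finally show ?case
    using us' uv by (metis insert_subset list.simps(15))
qed

text \<open>The tail is reduced before the new letter is added, so only its head can equal that
  letter; the two are then the same involution and cancel.\<close>

lemma foldr_mult_reduce:
  assumes U: "U \<subseteq> carrier G" and inv: "\<And>u. u \<in> U \<Longrightarrow> u \<otimes> u = \<one>"
    and us: "set us \<subseteq> U" and t: "t \<in> carrier G"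
  shows "\<exists>us'. set us' \<subseteq> U \<and> distinct_adj us' \<and> foldr (\<otimes>) us t = foldr (\<otimes>) us' t"
  using us
proof (induction us)
  case Nil
  then show ?case by (intro exI[of _ "[]"]) auto
next
  case (Cons u us)
  then obtain us' where us': "set us' \<subseteq> U" "distinct_adj us'" "foldr (\<otimes>) us t = foldr (\<otimes>) us' t"
    by auto
  show ?case
  proof (cases "us' \<noteq> [] \<and> hd us' = u")
    case True
    then obtain vs where vs: "us' = u # vs" by (cases us') auto
    have c: "foldr (\<otimes>) vs t \<in> carrier G" "u \<in> carrier G" using us' vs U t by auto
    then have "foldr (\<otimes>) (u # us) t = u \<otimes> u \<otimes> foldr (\<otimes>) vs t"
      using us' by (simp add: vs m_assoc)
    then have "foldr (\<otimes>) (u # us) t = foldr (\<otimes>) vs t"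
      using inv[of u] Cons.prems c by simp
    then show ?thesis
      using us' distinct_adj_ConsD[of u vs] by (intro exI[of _ vs]) (auto simp: vs)
  next
    case False
    then have "distinct_adj (u # us')" using us' by (auto simp: distinct_adj_Cons)
    then show ?thesis using us' Cons.prems by (intro exI[of _ "u # us'"]) auto
  qed
qed

text \<open>The set \<open>N\<close> of all products of a \<open>U\<close>-word, a
  \<open>V\<close>-word and an element of \<open>H\<close> contains the identity and is stable under
  left multiplication by \<open>U\<close>, \<open>V\<close> and \<open>D\<close>, hence is the whole
  group. Words in \<open>N\<close> may be unreduced, because a swap can create equal neighbours;
  these are cancelled at the end, after all swaps.\<close>

lemma normal_form:
  assumes gen: "generate G (insert a (insert b D)) = carrier G"
    and D: "\<And>s. s \<in> D \<Longrightarrow> \<exists>n::nat>0. s [^] n = \<one>"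
    and a: "a \<in> U" and b: "b \<in> V" and U: "U \<subseteq> carrier G" and V: "V \<subseteq> carrier G"
    and invU: "\<And>u. u \<in> U \<Longrightarrow> u \<otimes> u = \<one>" and invV: "\<And>v. v \<in> V \<Longrightarrow> v \<otimes> v = \<one>"
    and swap: "\<And>u v. u \<in> U \<Longrightarrow> v \<in> V \<Longrightarrow> \<exists>u'\<in>U. \<exists>v'\<in>V. v \<otimes> u = u' \<otimes> v'"
    and DU: "\<And>s u. s \<in> D \<Longrightarrow> u \<in> U \<Longrightarrow> \<exists>u'\<in>U. s \<otimes> u = u' \<otimes> s"
    and DV: "\<And>s v. s \<in> D \<Longrightarrow> v \<in> V \<Longrightarrow> \<exists>v'\<in>V. s \<otimes> v = v' \<otimes> s"
    and H: "H \<subseteq> carrier G" "\<one> \<in> H" and DH: "\<And>s h. s \<in> D \<Longrightarrow> h \<in> H \<Longrightarrow> s \<otimes> h \<in> H"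
    and g: "g \<in> carrier G"
  obtains us vs h where "set us \<subseteq> U" "set vs \<subseteq> V" "h \<in> H" "distinct_adj us" "distinct_adj vs"
    "g = foldr (\<otimes>) us (foldr (\<otimes>) vs h)"
proof -
  define N where
    "N = {foldr (\<otimes>) us (foldr (\<otimes>) vs h) | us vs h. set us \<subseteq> U \<and> set vs \<subseteq> V \<and> h \<in> H}"
  have gens: "insert a (insert b D) \<subseteq> carrier G"
    using gen generate.incl by (metis subsetI)
  have ord: "\<exists>n::nat>0. s [^] n = \<one>" if "s \<in> U \<union> V \<union> D" for s
  proof (cases "s \<in> D")
    case False
    then have "s \<otimes> s = \<one>" "s \<in> carrier G" using that invU invV U V by auto
    then have "s [^] (2::nat) = \<one>" by (simp add: numeral_2_eq_2)
    then show ?thesis by (intro exI[of _ 2]) simp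
  qed (use D in auto)
  have closed: "foldr (\<otimes>) vs h \<in> carrier G" if "set vs \<subseteq> V" "h \<in> H" for vs h
    using that V H by (intro foldr_mult_closed) auto
  have U_N: "u \<otimes> x \<in> N" if u: "u \<in> U" and x: "x \<in> N" for u x
  proof -
    obtain us vs h where *: "set us \<subseteq> U" "set vs \<subseteq> V" "h \<in> H"
      "x = foldr (\<otimes>) us (foldr (\<otimes>) vs h)"
      using x unfolding N_def by blast
    then have "u \<otimes> x = foldr (\<otimes>) (u # us) (foldr (\<otimes>) vs h)" by simp
    moreover have "set (u # us) \<subseteq> U" using u * by simp
    ultimately show ?thesis using * unfolding N_def by blast
  qed
  have V_N: "v \<otimes> x \<in> N" if v: "v \<in> V" and x: "x \<in> N" for v x
  proof -
    obtain us vs h where *: "set us \<subseteq> U" "set vs \<subseteq> V" "h \<in> H"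
      "x = foldr (\<otimes>) us (foldr (\<otimes>) vs h)"
      using x unfolding N_def by blast
    obtain us' v' where **: "set us' \<subseteq> U" "v' \<in> V"
      "v \<otimes> x = foldr (\<otimes>) us' (v' \<otimes> foldr (\<otimes>) vs h)"
      using foldr_mult_push[OF U V swap *(1) closed[OF *(2,3)] v] *(4) by blast
    then have "v \<otimes> x = foldr (\<otimes>) us' (foldr (\<otimes>) (v' # vs) h)" by simp
    moreover have "set (v' # vs) \<subseteq> V" using * ** by simp
    ultimately show ?thesis using * ** unfolding N_def by blast
  qed
  have D_N: "s \<otimes> x \<in> N" if s: "s \<in> D" and x: "x \<in> N" for s x
  proof -
    obtain us vs h where *: "set us \<subseteq> U" "set vs \<subseteq> V" "h \<in> H"
      "x = foldr (\<otimes>) us (foldr (\<otimes>) vs h)"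
      using x unfolding N_def by blast
    have sc: "{s} \<subseteq> carrier G" using s gens by auto
    have h: "h \<in> carrier G" using * H by auto
    obtain us' where us': "set us' \<subseteq> U" "s \<otimes> x = foldr (\<otimes>) us' (s \<otimes> foldr (\<otimes>) vs h)"
      using foldr_mult_push[OF U sc _ *(1) closed[OF *(2,3)], of s] DU[OF s] *(4) by blast
    obtain vs' where vs': "set vs' \<subseteq> V" "s \<otimes> foldr (\<otimes>) vs h = foldr (\<otimes>) vs' (s \<otimes> h)"
      using foldr_mult_push[OF V sc _ *(2) h, of s] DV[OF s] by blast
    show ?thesis using us' vs' DH[OF s *(3)] unfolding N_def by fastforce
  qed
  have "g \<in> N"
  proof (rule generate_left_induct[of g "insert a (insert b D)"])
    show "\<one> \<in> N" unfolding N_def using H by (auto intro!: exI[of _ "[]"])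
    show "N \<subseteq> carrier G" unfolding N_def using U V H by (auto intro!: foldr_mult_closed)
  qed (use g gen gens a b ord U_N V_N D_N in auto)
  then obtain us vs h where *: "set us \<subseteq> U" "set vs \<subseteq> V" "h \<in> H"
    "g = foldr (\<otimes>) us (foldr (\<otimes>) vs h)"
    by (auto simp: N_def)
  have h: "h \<in> carrier G" using * H by auto
  obtain vs' where vs': "set vs' \<subseteq> V" "distinct_adj vs'" "foldr (\<otimes>) vs h = foldr (\<otimes>) vs' h"
    using foldr_mult_reduce[OF V invV *(2) h] by blast
  obtain us' where us': "set us' \<subseteq> U" "distinct_adj us'"
    "foldr (\<otimes>) us (foldr (\<otimes>) vs h) = foldr (\<otimes>) us' (foldr (\<otimes>) vs h)"
    using foldr_mult_reduce[OF U invU *(1) closed[OF *(2,3)]] by blast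
  show ?thesis
    by (rule that[OF us'(1) vs'(1) *(3) us'(2) vs'(2)]) (metis *(4) us'(3) vs'(3))
qed

end

section \<open>Reduced norm, conjugation and the traceless elements tZ + \<xi>F\<close>

section \<open>Quaternions over a commutative ring\<close>

fun qnorm :: "'k::comm_ring_1 \<Rightarrow> 'k \<Rightarrow> 'k quat \<Rightarrow> 'k" where
  "qnorm \<alpha> \<beta> (Quat x y z w) = x\<^sup>2 - \<alpha> * y\<^sup>2 - \<beta> * z\<^sup>2 + \<alpha> * \<beta> * w\<^sup>2"

fun qconj :: "'k::comm_ring_1 quat \<Rightarrow> 'k quat" where
  "qconj (Quat x y z w) = Quat x (- y) (- z) (- w)"

abbreviation qzero :: "'k::comm_ring_1 quat" where
  "qzero \<equiv> Quat 0 0 0 0"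

text \<open>The quaternion tZ + \<xi>F for \<xi> = p + rZ. The coefficient of Z is a parameter
  because the same formula is used over F_q[t] with the variable t, at the place \<tau> with t =
  \<tau>, and at infinity with t = 1.\<close>

fun vert :: "'k::comm_ring_1 \<Rightarrow> 'k \<times> 'k \<Rightarrow> 'k quat" where
  "vert t (p, r) = Quat 0 t p r"

lemma quat_mult_assoc:
  "quat_mult \<alpha> \<beta> (quat_mult \<alpha> \<beta> u v) w = quat_mult \<alpha> \<beta> u (quat_mult \<alpha> \<beta> v w)"
  by (cases u; cases v; cases w) (simp add: algebra_simps)

lemma qnorm_mult: "qnorm \<alpha> \<beta> (quat_mult \<alpha> \<beta> u v) = qnorm \<alpha> \<beta> u * qnorm \<alpha> \<beta> v"
  by (cases u; cases v) (simp add: algebra_simps power2_eq_square)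

lemma qconj_mult:
  "quat_mult \<alpha> \<beta> (qconj u) u = Quat (qnorm \<alpha> \<beta> u) 0 0 0"
  "quat_mult \<alpha> \<beta> u (qconj u) = Quat (qnorm \<alpha> \<beta> u) 0 0 0"
  by (cases u; simp add: algebra_simps power2_eq_square)+

lemma qnorm_qconj [simp]: "qnorm \<alpha> \<beta> (qconj u) = qnorm \<alpha> \<beta> u"
  by (cases u) simp

lemma quat_mult_zero [simp]: "quat_mult \<alpha> \<beta> qzero u = qzero" "quat_mult \<alpha> \<beta> u qzero = qzero"
  by (cases u; simp)+

lemma quat_mult_scalar_eq_0:
  fixes s :: "'k::idom"
  assumes "quat_mult \<alpha> \<beta> (Quat s 0 0 0) u = qzero" "s \<noteq> 0"
  shows "u = qzero"
  using assms by (cases u) simp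

text \<open>Multiplication by the conjugate replaces \<open>u\<close> by its norm, a nonzero scalar,
  so only elements of norm 0 can be zero divisors.\<close>

lemma quat_mult_eq_0:
  fixes \<alpha> \<beta> :: "'k::idom"
  assumes "quat_mult \<alpha> \<beta> u v = qzero" "qnorm \<alpha> \<beta> u \<noteq> 0"
  shows "v = qzero"
proof -
  have "quat_mult \<alpha> \<beta> (qconj u) (quat_mult \<alpha> \<beta> u v) = qzero" using assms by simp
  then show ?thesis
    using assms(2) by (simp add: quat_mult_assoc[symmetric] qconj_mult quat_mult_scalar_eq_0)
qed

lemma quat_mult_eq_0':
  fixes \<alpha> \<beta> :: "'k::idom"
  assumes "quat_mult \<alpha> \<beta> u v = qzero" "qnorm \<alpha> \<beta> v \<noteq> 0"
  shows "u = qzero"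
proof -
  obtain x y z w where u: "u = Quat x y z w" by (cases u)
  have "quat_mult \<alpha> \<beta> (quat_mult \<alpha> \<beta> u v) (qconj v) = qzero" using assms by simp
  then show ?thesis using assms(2) by (simp add: quat_mult_assoc qconj_mult u)
qed

text \<open>The trace is 0, so conjugation is negation and the square is minus the norm. Hence
  \<gamma>_\<xi> is an involution modulo scalars, and at a place where its norm vanishes its square
  is 0.\<close>

lemma vert_square: "quat_mult \<alpha> \<beta> (vert t \<xi>) (vert t \<xi>) = Quat (- qnorm \<alpha> \<beta> (vert t \<xi>)) 0 0 0"
  by (cases \<xi>) (simp add: power2_eq_square algebra_simps)

text \<open>With primes for conjugates, (tZ + \<xi>F)(tZ + \<eta>F) = c t^2 + \<beta> \<xi>\<eta>' +
  t (\<eta> - \<xi>) ZF. The product thus depends only on \<xi>\<eta>' and \<eta> - \<xi>; the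
  assumptions equate the coordinates of these two elements.\<close>

lemma vert_commute:
  assumes "p * p' - c * r * r' = p2 * p2' - c * r2 * r2'" "r * p' - p * r' = r2 * p2' - p2 * r2'"
    "p' - p = p2' - p2" "r' - r = r2' - r2"
  shows "quat_mult c \<beta> (vert t (p, r)) (vert t (p', r')) = quat_mult c \<beta> (vert t (p2, r2)) (vert t (p2', r2'))"
proof -
  have "\<beta> * (p * p' - c * r * r') = \<beta> * (p2 * p2' - c * r2 * r2')"
    "\<beta> * (r * p' - p * r') = \<beta> * (r2 * p2' - p2 * r2')"
    "t * (p' - p) = t * (p2' - p2)" "t * (r' - r) * c = t * (r2' - r2) * c"
    using assms by simp_all
  then show ?thesis by (simp add: algebra_simps)
qed

lemma map_quat_mult:
  assumes "\<And>x y. h (x + y) = h x + h y" "\<And>x y. h (x * y) = h x * h y" "\<And>x y. h (x - y) = h x - h y"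
  shows "map_quat h (quat_mult \<alpha> \<beta> u v) = quat_mult (h \<alpha>) (h \<beta>) (map_quat h u) (map_quat h v)"
  by (cases u; cases v) (simp add: assms)

lemma qnorm_map:
  assumes "\<And>x y. h (x + y) = h x + h y" "\<And>x y. h (x * y) = h x * h y" "\<And>x y. h (x - y) = h x - h y"
  shows "qnorm (h \<alpha>) (h \<beta>) (map_quat h u) = h (qnorm \<alpha> \<beta> u)"
  by (cases u) (simp add: assms power2_eq_square)

section \<open>Isotropic quaternions over a field: existence and uniqueness of the
  annihilator\<close>

section \<open>Rank one quaternions over a field\<close>

locale nonsquare =
  fixes c :: "'a::field"
  assumes nonsquare: "c \<noteq> x\<^sup>2"
begin

lemma c_nonzero [simp]: "c \<noteq> 0"
  using nonsquare[of 0] by simp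

lemma norm_eq_0_iff: "x\<^sup>2 - c * y\<^sup>2 = 0 \<longleftrightarrow> x = 0 \<and> y = 0"
proof
  assume *: "x\<^sup>2 - c * y\<^sup>2 = 0"
  show "x = 0 \<and> y = 0"
  proof (cases "y = 0")
    case False
    then have "c = (x / y)\<^sup>2" using * by (simp add: field_simps power_divide)
    then show ?thesis using nonsquare by blast
  qed (use * in simp)
qed auto

text \<open>Subtracting the two equations removes tZ: (\<xi> - \<eta>)F annihilates v \<noteq> 0, so
  its norm -\<beta> N(\<xi> - \<eta>) is 0, and N is anisotropic.\<close>

lemma vert_annihilates_unique:
  assumes \<beta>: "\<beta> \<noteq> 0" and v: "v \<noteq> qzero"
    and "quat_mult c \<beta> (vert t \<xi>) v = qzero" "quat_mult c \<beta> (vert t \<eta>) v = qzero"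
  shows "\<xi> = \<eta>"
proof -
  obtain p r p' r' where \<xi>: "\<xi> = (p, r)" "\<eta> = (p', r')" by (cases \<xi>; cases \<eta>)
  let ?u = "Quat 0 0 (p - p') (r - r')"
  have "quat_mult c \<beta> ?u v = qzero"
  proof -
    obtain x y z w where v': "v = Quat x y z w" by (cases v)
    have e: "c * t * y + \<beta> * p * z - c * \<beta> * r * w = 0" "t * x - \<beta> * p * w + \<beta> * r * z = 0"
      "p * x + c * t * w - c * r * y = 0" "r * x + t * z - p * y = 0"
      "c * t * y + \<beta> * p' * z - c * \<beta> * r' * w = 0" "t * x - \<beta> * p' * w + \<beta> * r' * z = 0"
      "p' * x + c * t * w - c * r' * y = 0" "r' * x + t * z - p' * y = 0"
      using assms(3,4) by (simp_all add: \<xi> v')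
    have "\<beta> * (p - p') * z - c * \<beta> * (r - r') * w = 0" using arg_cong2[OF e(1) e(5), of minus] by (simp add: algebra_simps)
    moreover have "\<beta> * (r - r') * z - \<beta> * (p - p') * w = 0" using arg_cong2[OF e(2) e(6), of minus] by (simp add: algebra_simps)
    moreover have "(p - p') * x - c * (r - r') * y = 0" using arg_cong2[OF e(3) e(7), of minus] by (simp add: algebra_simps)
    moreover have "(r - r') * x - (p - p') * y = 0" using arg_cong2[OF e(4) e(8), of minus] by (simp add: algebra_simps)
    ultimately show ?thesis by (simp add: v' algebra_simps)
  qed
  then have "qnorm c \<beta> ?u = 0" using quat_mult_eq_0 v by blast
  moreover have "qnorm c \<beta> ?u = - (\<beta> * ((p - p')\<^sup>2 - c * (r - r')\<^sup>2))"
    by (simp add: right_diff_distrib)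
  ultimately have "\<beta> * ((p - p')\<^sup>2 - c * (r - r')\<^sup>2) = 0" by (metis neg_equal_0_iff_equal)
  then have "(p - p')\<^sup>2 - c * (r - r')\<^sup>2 = 0" using \<beta> by (metis mult_eq_0_iff)
  then show ?thesis unfolding norm_eq_0_iff by (simp add: \<xi>)
qed

text \<open>Multiplying on the left by an isotropic \<open>vert t \<xi>\<close> can only annihilate \<open>v \<noteq> 0\<close> for one \<open>\<xi>\<close>,
  and after multiplying by \<open>vert t \<xi>'\<close> this one is \<open>\<xi>'\<close>.\<close>

lemma reduced_product_nonzero:
  assumes \<beta>: "\<beta> \<noteq> 0" and t: "t \<noteq> 0" and iso: "\<And>\<xi>. \<xi> \<in> set L \<Longrightarrow> qnorm c \<beta> (vert t \<xi>) = 0"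
    and L: "distinct_adj L" and v: "qnorm c \<beta> v \<noteq> 0"
  shows "foldr (\<lambda>\<xi>. quat_mult c \<beta> (vert t \<xi>)) L v \<noteq> qzero"
  using iso L
proof (induction L)
  case Nil
  then show ?case using v by (cases v) auto
next
  case (Cons \<xi> L)
  let ?V = "foldr (\<lambda>\<xi>. quat_mult c \<beta> (vert t \<xi>)) L v"
  have V: "?V \<noteq> qzero" 
    using Cons.IH Cons.prems(1) distinct_adj_ConsD[OF Cons.prems(2)] by (metis list.set_intros(2))
  show ?case
  proof (cases L)
    case Nil
    have "vert t \<xi> \<noteq> qzero" using t by (cases \<xi>) simp
    then show ?thesis using v quat_mult_eq_0' by (auto simp: Nil)
  next
    case (Cons \<eta> M)
    then have ne: "\<xi> \<noteq> \<eta>" using \<open>distinct_adj (\<xi> # L)\<close> by simp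
    have "quat_mult c \<beta> (vert t \<eta>) ?V = qzero"
      using Cons.prems(1)[of \<eta>]
      by (simp add: \<open>L = \<eta> # M\<close> quat_mult_assoc[symmetric] vert_square)
    then show ?thesis
      using vert_annihilates_unique[OF \<beta> V, of t \<xi> \<eta>] ne by (simp del: vert.simps) blast
  qed
qed

text \<open>Put v = A + BF with A = x + yZ and B = z + wZ. With primes for conjugates, (tZ + \<xi>F)
  v = (tZA + \<beta>\<xi>B') + (tZB + \<xi>A') F. Both parts vanish for \<xi> = -tZA / (\<beta>B')
  as soon as N(A) = \<beta> N(B), which is the isotropy of v.\<close>

lemma isotropic_annihilator:
  assumes \<beta>: "\<beta> \<noteq> 0" and v: "v \<noteq> qzero" "qnorm c \<beta> v = 0"
  obtains \<xi> where "qnorm c \<beta> (vert t \<xi>) = 0" "quat_mult c \<beta> (vert t \<xi>) v = qzero"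
proof -
  obtain x y z w where v': "v = Quat x y z w" by (cases v)
  define n where "n = z\<^sup>2 - c * w\<^sup>2"
  have eq: "x\<^sup>2 - c * y\<^sup>2 = \<beta> * n"
    using v by (simp add: v' n_def algebra_simps)
  \<comment> \<open>N(B) = 0 would give N(A) = 0 as well, and then A = B = 0 by anisotropy.\<close>
  have n: "n \<noteq> 0"
  proof
    assume "n = 0"
    then have "z = 0" "w = 0" "x = 0" "y = 0"
      using norm_eq_0_iff[of z w] norm_eq_0_iff[of x y] eq by (simp_all add: n_def)
    then show False using v by (simp add: v')
  qed
  \<comment> \<open>The coordinates of -tZAB / (\<beta> N(B)), which is -tZA / (\<beta>B') with the
    denominator made scalar.\<close>
  define p where "p = - t * c * (x * w + y * z) / (\<beta> * n)"
  define r where "r = - t * (x * z + c * y * w) / (\<beta> * n)"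
  have p: "p * (\<beta> * n) = - t * c * (x * w + y * z)" and r: "r * (\<beta> * n) = - t * (x * z + c * y * w)"
    using n \<beta> by (simp_all add: p_def r_def)
  have cancel: "a = 0" if "a * (\<beta> * n) = 0" for a using that n \<beta> by simp
  have 1: "c * t * y + \<beta> * p * z - c * \<beta> * r * w = 0"
  proof (rule cancel)
    have "(c * t * y + \<beta> * p * z - c * \<beta> * r * w) * (\<beta> * n) =
        c * t * y * (\<beta> * n) + \<beta> * z * (p * (\<beta> * n)) - c * \<beta> * w * (r * (\<beta> * n))"
      by (simp add: algebra_simps)
    also have "\<dots> = 0"
      unfolding p r by (simp add: n_def algebra_simps power2_eq_square)
    finally show "(c * t * y + \<beta> * p * z - c * \<beta> * r * w) * (\<beta> * n) = 0" .
  qed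
  have 2: "t * x - \<beta> * p * w + \<beta> * r * z = 0"
  proof (rule cancel)
    have "(t * x - \<beta> * p * w + \<beta> * r * z) * (\<beta> * n) =
        t * x * (\<beta> * n) - \<beta> * w * (p * (\<beta> * n)) + \<beta> * z * (r * (\<beta> * n))"
      by (simp add: algebra_simps)
    also have "\<dots> = 0"
      unfolding p r by (simp add: n_def algebra_simps power2_eq_square)
    finally show "(t * x - \<beta> * p * w + \<beta> * r * z) * (\<beta> * n) = 0" .
  qed
  have 3: "p * x + c * t * w - c * r * y = 0"
  proof (rule cancel)
    have "(p * x + c * t * w - c * r * y) * (\<beta> * n) =
        x * (p * (\<beta> * n)) + c * t * w * (\<beta> * n) - c * y * (r * (\<beta> * n))"
      by (simp add: algebra_simps)
    also have "\<dots> = c * t * w * (\<beta> * n - (x\<^sup>2 - c * y\<^sup>2))"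
      unfolding p r by (simp add: algebra_simps power2_eq_square)
    finally show "(p * x + c * t * w - c * r * y) * (\<beta> * n) = 0" by (simp add: eq)
  qed
  have 4: "r * x + t * z - p * y = 0"
  proof (rule cancel)
    have "(r * x + t * z - p * y) * (\<beta> * n) =
        x * (r * (\<beta> * n)) + t * z * (\<beta> * n) - y * (p * (\<beta> * n))"
      by (simp add: algebra_simps)
    also have "\<dots> = t * z * (\<beta> * n - (x\<^sup>2 - c * y\<^sup>2))"
      unfolding p r by (simp add: algebra_simps power2_eq_square)
    finally show "(r * x + t * z - p * y) * (\<beta> * n) = 0" by (simp add: eq)
  qed
  have ann: "quat_mult c \<beta> (vert t (p, r)) v = qzero"
    using 1 2 3 4 by (simp add: v')
  then have "qnorm c \<beta> (vert t (p, r)) = 0" using quat_mult_eq_0 v by blast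
  then show thesis using ann that by blast
qed

end

section \<open>Degree at infinity, values at points and reduced norm of polynomial
  quaternions\<close>

section \<open>Quaternions over the polynomial ring\<close>

abbreviation pmul :: "'a::field \<Rightarrow> 'a poly quat \<Rightarrow> 'a poly quat \<Rightarrow> 'a poly quat" where
  "pmul c \<equiv> quat_mult [:c:] [:0, - 1, 1:]"

abbreviation pnorm :: "'a::field \<Rightarrow> 'a poly quat \<Rightarrow> 'a poly" where
  "pnorm c \<equiv> qnorm [:c:] [:0, - 1, 1:]"

definition gpoly :: "'a::field \<times> 'a \<Rightarrow> 'a poly quat" where
  "gpoly \<xi> = vert [:0, 1:] ([:fst \<xi>:], [:snd \<xi>:])"

definition nrm2 :: "'a::field \<Rightarrow> 'a \<times> 'a \<Rightarrow> 'a" where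
  "nrm2 c \<xi> = (fst \<xi>)\<^sup>2 - c * (snd \<xi>)\<^sup>2"

definition cquat :: "'a::field \<Rightarrow> 'a \<Rightarrow> 'a poly quat" where
  "cquat x y = Quat [:x:] [:y:] 0 0"

definition cquatF :: "'a::field \<Rightarrow> 'a \<Rightarrow> 'a poly quat" where
  "cquatF x y = Quat 0 0 [:x:] [:y:]"

abbreviation pscale :: "'a::field poly \<Rightarrow> 'a poly quat \<Rightarrow> 'a poly quat" where
  "pscale h \<equiv> map_quat ((*) h)"

text \<open>At the infinite place $D$ has the basis $1, Z, F/t, ZF/t$ with $(F/t)^2 = 1 - 1/t$. The leading
  coefficients with respect to this basis multiply like quaternions with $\beta = 1$.\<close>

fun lead :: "nat \<Rightarrow> 'a::field poly quat \<Rightarrow> 'a quat" where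
  "lead e (Quat x y z w) =
     Quat (coeff x e) (coeff y e) (coeff (pCons 0 z) e) (coeff (pCons 0 w) e)"

text \<open>The pole order at infinity in the basis 1, Z, F/t, ZF/t, where F has the coordinate t.
  The form \<open>pCons 0 z\<close> for tz, instead of one plus the degree of z, makes z = 0
  admissible also for e = 0.\<close>

fun deg_le :: "nat \<Rightarrow> 'a::field poly quat \<Rightarrow> bool" where
  "deg_le e (Quat x y z w) \<longleftrightarrow>
     Polynomial.degree x \<le> e \<and> Polynomial.degree y \<le> e \<and>
     Polynomial.degree (pCons 0 z) \<le> e \<and> Polynomial.degree (pCons 0 w) \<le> e"

abbreviation quat_at :: "'a::field \<Rightarrow> 'a poly quat \<Rightarrow> 'a quat" where
  "quat_at s \<equiv> map_quat (\<lambda>p. poly p s)"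

lemma pnorm_pscale: "pnorm c (pscale h U) = h\<^sup>2 * pnorm c U"
  by (cases U) (simp only: quat.map qnorm.simps power_mult_distrib right_diff_distrib distrib_left mult.left_commute mult.assoc)

lemma pnorm_gpoly: "pnorm c (gpoly \<xi>) = [:0, nrm2 c \<xi>, - c - nrm2 c \<xi>:]"
  by (simp add: gpoly_def nrm2_def power2_eq_square algebra_simps)

lemma pnorm_cquat: "pnorm c (cquat x y) = [:nrm2 c (x, y):]"
  by (simp add: cquat_def nrm2_def power2_eq_square)

lemma pnorm_cquatF: "pnorm c (cquatF x y) = [:0, nrm2 c (x, y), - nrm2 c (x, y):]"
  by (simp add: cquatF_def nrm2_def power2_eq_square algebra_simps)

lemma quat_at_pmul:
  "quat_at s (pmul c U V) = quat_mult c (s * (s - 1)) (quat_at s U) (quat_at s V)"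
  by (subst map_quat_mult) (simp_all add: algebra_simps)

lemma quat_at_qnorm: "qnorm c (s * (s - 1)) (quat_at s U) = poly (pnorm c U) s"
  using qnorm_map[of "\<lambda>p. poly p s" "[:c:]" "[:0, - 1, 1:]" U] by (simp add: algebra_simps)

lemma quat_at_gpoly: "quat_at s (gpoly \<xi>) = vert s \<xi>"
  by (cases \<xi>) (simp add: gpoly_def)

text \<open>\<gamma>_\<xi> equals t (Z + \<xi> F/t), so it raises the degree by 1 and acts on the
  leading part as \<open>vert 1 \<xi>\<close>. The correction -1/t in (F/t)^2 contributes only
  coefficients of degree e + 1 of \<open>U\<close>, which are 0 by assumption.\<close>

lemma lead_pmul_gpoly:
  assumes "lead (Suc e) U = qzero"
  shows "lead (Suc e) (pmul c (gpoly \<xi>) U) = quat_mult c 1 (vert 1 \<xi>) (lead e U)"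
proof -
  obtain x y z w where U: "U = Quat x y z w" by (cases U)
  obtain p r where \<xi>: "\<xi> = (p, r)" by (cases \<xi>)
  have "coeff z e = 0" "coeff w e = 0" using assms by (simp_all add: U)
  then show ?thesis
    by (simp add: U \<xi> gpoly_def coeff_pCons algebra_simps split: nat.splits)
qed

lemma deg_le_lead: "deg_le e U \<Longrightarrow> n > e \<Longrightarrow> lead n U = qzero"
  by (cases U) (auto intro!: coeff_eq_0)

lemma lead_deg_le:
  assumes "\<And>n. n > e \<Longrightarrow> lead n U = qzero"
  shows "deg_le e U"
proof -
  obtain x y z w where U: "U = Quat x y z w" by (cases U)
  show ?thesis
    unfolding U deg_le.simps using assms by (intro conjI degree_le allI impI) (simp_all add: U)
qed

lemma deg_le_pmul_gpoly:
  assumes "deg_le e U"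
  shows "deg_le (Suc e) (pmul c (gpoly \<xi>) U)"
proof (rule lead_deg_le)
  fix n assume n: "n > Suc e"
  then obtain m where m: "n = Suc m" "m > e" by (cases n) auto
  show "lead n (pmul c (gpoly \<xi>) U) = qzero"
    using lead_pmul_gpoly[of m U c \<xi>] deg_le_lead[OF assms] m by simp
qed

lemma coeff_mult_deg_le:
  fixes p q :: "'a::field poly"
  assumes "Polynomial.degree p \<le> m" "Polynomial.degree q \<le> n"
  shows "coeff (p * q) (m + n) = coeff p m * coeff q n"
proof -
  have "coeff (p * q) (m + n) = (\<Sum>i\<le>m + n. coeff p i * coeff q (m + n - i))"
    by (rule coeff_mult)
  also have "\<dots> = (\<Sum>i\<in>{m}. coeff p i * coeff q (m + n - i))"
  proof (rule sum.mono_neutral_right)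
    show "\<forall>i\<in>{..m + n} - {m}. coeff p i * coeff q (m + n - i) = 0"
    proof
      fix i assume "i \<in> {..m + n} - {m}"
      then have "i > m \<or> m + n - i > n" by auto
      then show "coeff p i * coeff q (m + n - i) = 0"
        using assms by (auto intro: coeff_eq_0)
    qed
  qed auto
  finally show ?thesis by simp
qed

text \<open>t(t - 1) z^2 = (tz)^2 - z (tz), and the second term has degree below 2e. So the
  coefficient of t^(2e) is a value of the norm form with \<beta> = 1.\<close>

lemma coeff_pnorm:
  assumes "deg_le e U"
  shows "coeff (pnorm c U) (2 * e) = qnorm c 1 (lead e U)"
proof -
  obtain x y z w where U: "U = Quat x y z w" by (cases U)
  have sq: "coeff (v\<^sup>2) (2 * e) = (coeff v e)\<^sup>2" if "Polynomial.degree v \<le> e" for v :: "'a poly"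
    using coeff_mult_deg_le[of v e v e] that by (simp add: power2_eq_square mult_2)
  have low: "coeff (v * pCons 0 v) (2 * e) = 0" if "Polynomial.degree (pCons 0 v) \<le> e" for v :: "'a poly"
  proof (cases "v = 0")
    case False
    then have "coeff v e = 0" "Polynomial.degree v \<le> e" using that by (auto intro: coeff_eq_0)
    then show ?thesis using coeff_mult_deg_le[of v e "pCons 0 v" e] that by (simp add: mult_2)
  qed simp
  have tt: "[:0, - 1, 1:] * v\<^sup>2 = (pCons 0 v)\<^sup>2 - v * pCons 0 v" for v :: "'a poly"
    by (simp add: power2_eq_square algebra_simps)
  have "pnorm c U =
      x\<^sup>2 - [:c:] * y\<^sup>2 - ((pCons 0 z)\<^sup>2 - z * pCons 0 z) + [:c:] * ((pCons 0 w)\<^sup>2 - w * pCons 0 w)"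
    by (simp only: U qnorm.simps tt[symmetric] mult.assoc)
  then have "coeff (pnorm c U) (2 * e) = coeff (x\<^sup>2) (2 * e) - c * coeff (y\<^sup>2) (2 * e)
      - (coeff ((pCons 0 z)\<^sup>2) (2 * e) - coeff (z * pCons 0 z) (2 * e))
      + c * (coeff ((pCons 0 w)\<^sup>2) (2 * e) - coeff (w * pCons 0 w) (2 * e))"
    by (simp only: coeff_diff coeff_add) simp
  then show ?thesis
    using assms by (simp only: U deg_le.simps sq low) simp
qed

context nonsquare
begin

lemma nrm2_eq_0_iff: "nrm2 c \<xi> = 0 \<longleftrightarrow> \<xi> = (0, 0)"
  using norm_eq_0_iff[of "fst \<xi>" "snd \<xi>"] by (cases \<xi>) (simp add: nrm2_def)

text \<open>At s the factor t(t - 1) vanishes, and the norm reduces to the anisotropic form N(x +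
  yZ).\<close>

lemma pnorm_dvd_imp_roots:
  assumes s: "s = 0 \<or> s = 1" and dvd: "[:- s, 1:] dvd pnorm c (Quat x y z w)"
  shows "poly x s = 0" "poly y s = 0"
proof -
  have "poly (pnorm c (Quat x y z w)) s = 0"
    using dvd by (simp only: poly_eq_0_iff_dvd)
  then have "(poly x s)\<^sup>2 - c * (poly y s)\<^sup>2 = 0" using s by auto
  then show "poly x s = 0" "poly y s = 0" using norm_eq_0_iff by auto
qed

text \<open>Modulo h = t - s the norm is N(x + yZ), so h divides x and y. The norm is then -h h' N(z
  + wZ) modulo h^2, where h' is the other factor of t(t - 1) and does not vanish at s; hence h
  divides z and w too.\<close>

lemma ramified_divisible:
  assumes s: "s = 0 \<or> s = 1" and dvd: "[:- s, 1:]\<^sup>2 dvd pnorm c U"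
  obtains U' where "U = pscale [:- s, 1:] U'"
proof -
  let ?h = "[:- s, 1:]"
  obtain x y z w where U: "U = Quat x y z w" by (cases U)
  define s' where "s' = 1 - s"
  have tt: "[:0, - 1, 1:] = ?h * [:- s', 1:]"
    using s by (auto simp: s'_def)
  have "?h dvd pnorm c (Quat x y z w)"
    using dvd dvd_mult_left unfolding power2_eq_square U by blast
  from pnorm_dvd_imp_roots[OF s this] have "?h dvd x" "?h dvd y"
    by (simp_all only: poly_eq_0_iff_dvd)
  then obtain x' y' where xy: "x = ?h * x'" "y = ?h * y'" unfolding dvd_def by blast
  have "?h\<^sup>2 dvd ?h\<^sup>2 * (x'\<^sup>2 - [:c:] * y'\<^sup>2) - pnorm c U"
    using dvd by (intro dvd_diff dvd_triv_left)
  also have "?h\<^sup>2 * (x'\<^sup>2 - [:c:] * y'\<^sup>2) - pnorm c U = ?h * ([:- s', 1:] * (z\<^sup>2 - [:c:] * w\<^sup>2))"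
  proof -
    have "h\<^sup>2 * (x'\<^sup>2 - k * y'\<^sup>2) - ((h * x')\<^sup>2 - k * (h * y')\<^sup>2 - h * h' * z\<^sup>2 + k * (h * h') * w\<^sup>2) =
        h * (h' * (z\<^sup>2 - k * w\<^sup>2))" for h h' k :: "'a poly"
      by (simp add: algebra_simps power2_eq_square)
    then show ?thesis unfolding U qnorm.simps tt xy .
  qed
  finally have "?h dvd [:- s', 1:] * (z\<^sup>2 - [:c:] * w\<^sup>2)"
    unfolding power2_eq_square by (subst (asm) dvd_mult_cancel_left) simp
  then have "poly ([:- s', 1:] * (z\<^sup>2 - [:c:] * w\<^sup>2)) s = 0"
    by (simp only: poly_eq_0_iff_dvd)
  then have "(poly z s)\<^sup>2 - c * (poly w s)\<^sup>2 = 0" using s by (auto simp: s'_def)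
  then have "poly z s = 0" "poly w s = 0" using norm_eq_0_iff by auto
  then have "?h dvd z" "?h dvd w" by (simp_all only: poly_eq_0_iff_dvd)
  then obtain z' w' where "z = ?h * z'" "w = ?h * w'" unfolding dvd_def by blast
  with xy have "U = pscale ?h (Quat x' y' z' w')" by (simp only: U quat.map)
  then show thesis by (rule that)
qed

end

section \<open>Reduction to the stabilizer by multiplications with involutions\<close>

section \<open>Descent\<close>

abbreviation Spoly :: "'a::field \<Rightarrow> 'a \<Rightarrow> nat \<Rightarrow> nat \<Rightarrow> nat \<Rightarrow> 'a poly" where
  "Spoly \<tau> a i j k \<equiv> smult a ([:0, 1:] ^ i * [:- 1, 1:] ^ j * [:- \<tau>, 1:] ^ k)"

lemma degree_Spoly: "a \<noteq> 0 \<Longrightarrow> Polynomial.degree (Spoly \<tau> a i j k) = i + j + k"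
  by (simp add: degree_mult_eq degree_power_eq)

text \<open>A root of the product is a root of one of the factors, so one linear factor is removed
  at a time. The bound j' \<le> j matters for R': from j = 0 it follows that t - 1 does not enter
  the divisor.\<close>

lemma Spoly_factor:
  fixes \<tau> :: "'a::field"
  assumes "f * g = Spoly \<tau> a i j k" "a \<noteq> 0"
  obtains a' i' j' k' where "a' \<noteq> 0" "i' \<le> i" "j' \<le> j" "k' \<le> k" "f = Spoly \<tau> a' i' j' k'"
proof -
  define n where "n = i + j + k"
  have "\<exists>a' i' j' k'. a' \<noteq> 0 \<and> i' \<le> i \<and> j' \<le> j \<and> k' \<le> k \<and> f = Spoly \<tau> a' i' j' k'"
    using assms n_def
  proof (induction n arbitrary: f g i j k)
    case 0
    then have "f * g = [:a:]" by simp
    moreover have "f \<noteq> 0" "g \<noteq> 0" using \<open>f * g = [:a:]\<close> 0 by auto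
    ultimately have "Polynomial.degree f = 0" by (metis degree_mult_eq degree_pCons_0 add_is_0)
    then obtain b where "f = [:b:]" by (meson degree_eq_zeroE)
    then show ?case using 0 \<open>f \<noteq> 0\<close> by (intro exI[of _ b]) auto
  next
    case (Suc n)
    \<comment> \<open>One argument for all three linear factors: \<open>h\<close> splits off t - s,
      and \<open>up\<close> says that multiplying a smaller divisor by t - s respects the original
      bounds.\<close>
    have step: ?case if h: "Spoly \<tau> a i j k = [:- s, 1:] * Spoly \<tau> a i0 j0 k0"
      and le: "i0 \<le> i" "j0 \<le> j" "k0 \<le> k" "i0 + j0 + k0 = n"
      and up: "\<And>b i1 j1 k1. i1 \<le> i0 \<Longrightarrow> j1 \<le> j0 \<Longrightarrow> k1 \<le> k0 \<Longrightarrow>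
        \<exists>i' j' k'. i' \<le> i \<and> j' \<le> j \<and> k' \<le> k \<and> [:- s, 1:] * Spoly \<tau> b i1 j1 k1 = Spoly \<tau> b i' j' k'"
      for s i0 j0 k0
    proof -
      let ?h = "[:- s, 1:]"
      have fg: "f * g = ?h * Spoly \<tau> a i0 j0 k0" using Suc.prems h by simp
      have "poly (f * g) s = 0" unfolding fg by simp
      then have "?h dvd f \<or> ?h dvd g" by (simp add: poly_eq_0_iff_dvd[symmetric])
      then show ?thesis
      proof
        assume "?h dvd f"
        then obtain f' where f': "f = ?h * f'" by (elim dvdE)
        have "f' * g = Spoly \<tau> a i0 j0 k0"
          using fg unfolding f' mult.assoc by (subst (asm) mult_cancel_left) simp
        from Suc.IH[OF this Suc.prems(2) le(4)[symmetric]] obtain a' i1 j1 k1 where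
          *: "a' \<noteq> 0" "i1 \<le> i0" "j1 \<le> j0" "k1 \<le> k0" "f' = Spoly \<tau> a' i1 j1 k1"
          by blast
        from up[OF *(2-4), of a'] show ?thesis unfolding f' *(5) using *(1) by blast
      next
        assume "?h dvd g"
        then obtain g' where g': "g = ?h * g'" by (elim dvdE)
        have "?h * (f * g') = ?h * Spoly \<tau> a i0 j0 k0"
          using fg unfolding g' by (simp only: mult.left_commute)
        then have "f * g' = Spoly \<tau> a i0 j0 k0"
          by (subst (asm) mult_cancel_left) simp
        from Suc.IH[OF this Suc.prems(2) le(4)[symmetric]] obtain a' i1 j1 k1 where
          *: "a' \<noteq> 0" "i1 \<le> i0" "j1 \<le> j0" "k1 \<le> k0" "f = Spoly \<tau> a' i1 j1 k1"
          by blast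
        moreover have "i1 \<le> i" "j1 \<le> j" "k1 \<le> k" using * le by auto
        ultimately show ?thesis by blast
      qed
    qed
    have "i > 0 \<or> j > 0 \<or> k > 0" using Suc by auto
    then consider i' where "i = Suc i'" | j' where "j = Suc j'" | k' where "k = Suc k'"
      by (metis gr0_conv_Suc)
    then show ?case
    proof cases
      case 1
      show ?thesis
      proof (rule step[of 0 i' j k])
        show "\<exists>i'' j' k'. i'' \<le> i \<and> j' \<le> j \<and> k' \<le> k \<and> [:- 0, 1:] * Spoly \<tau> b i1 j1 k1 = Spoly \<tau> b i'' j' k'"
          if "i1 \<le> i'" "j1 \<le> j" "k1 \<le> k" for b i1 j1 k1
          using that 1 by (intro exI[of _ "Suc i1"] exI[of _ j1] exI[of _ k1]) simp
      qed (use 1 Suc.prems in auto)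
    next
      case 2
      show ?thesis
      proof (rule step[of 1 i j' k])
        show "\<exists>i' j'' k'. i' \<le> i \<and> j'' \<le> j \<and> k' \<le> k \<and> [:- 1, 1:] * Spoly \<tau> b i1 j1 k1 = Spoly \<tau> b i' j'' k'"
          if "i1 \<le> i" "j1 \<le> j'" "k1 \<le> k" for b i1 j1 k1
          using that 2
          by (intro exI[of _ i1] exI[of _ "Suc j1"] exI[of _ k1])
             (simp only: power_Suc mult_smult_right mult.left_commute mult.assoc Suc_le_mono)
        show "Spoly \<tau> a i j k = [:- 1, 1:] * Spoly \<tau> a i j' k"
          by (simp only: 2 power_Suc mult_smult_right mult.left_commute mult.assoc)
      qed (use 2 Suc.prems in auto)
    next
      case 3
      show ?thesis
      proof (rule step[of \<tau> i j k'])
        show "\<exists>i' j' k''. i' \<le> i \<and> j' \<le> j \<and> k'' \<le> k \<and> [:- \<tau>, 1:] * Spoly \<tau> b i1 j1 k1 = Spoly \<tau> b i' j' k''"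
          if "i1 \<le> i" "j1 \<le> j" "k1 \<le> k'" for b i1 j1 k1
          using that 3
          by (intro exI[of _ i1] exI[of _ j1] exI[of _ "Suc k1"])
             (simp only: power_Suc mult_smult_right mult.left_commute mult.assoc Suc_le_mono)
        show "Spoly \<tau> a i j k = [:- \<tau>, 1:] * Spoly \<tau> a i j k'"
          by (simp only: 3 power_Suc mult_smult_right mult.left_commute mult.assoc)
      qed (use 3 Suc.prems in auto)
    qed
  qed
  then show thesis using that by blast
qed

lemma quat_at_zero:
  assumes "quat_at s U = qzero"
  obtains U' where "U = pscale [:- s, 1:] U'"
proof -
  obtain x y z w where U: "U = Quat x y z w" by (cases U)
  have "[:- s, 1:] dvd x" "[:- s, 1:] dvd y" "[:- s, 1:] dvd z" "[:- s, 1:] dvd w"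
    using assms by (simp_all add: U poly_eq_0_iff_dvd)
  then obtain x' y' z' w' where
    "x = [:- s, 1:] * x'" "y = [:- s, 1:] * y'" "z = [:- s, 1:] * z'" "w = [:- s, 1:] * w'"
    unfolding dvd_def by blast
  then have "U = pscale [:- s, 1:] (Quat x' y' z' w')" by (simp only: U quat.map)
  then show thesis by (rule that)
qed

lemma deg_le_pscale_linear:
  assumes "deg_le (Suc e) (pscale [:- s, 1:] U)"
  shows "deg_le e U"
proof -
  obtain x y z w where U: "U = Quat x y z w" by (cases U)
  have deg: "Polynomial.degree v \<le> e" if "Polynomial.degree ([:- s, 1:] * v) \<le> Suc e" for v
    using that by (cases "v = 0") (simp_all add: degree_mult_eq del: mult_pCons_left)
  have "pCons 0 ([:- s, 1:] * v) = [:- s, 1:] * pCons 0 v" for v by simp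
  then show ?thesis
    using assms deg by (simp only: U quat.map deg_le.simps)
qed

lemma ex_deg_le: "\<exists>e. deg_le e U"
proof -
  obtain x y z w where U: "U = Quat x y z w" by (cases U)
  let ?e = "Polynomial.degree x + Polynomial.degree y + Polynomial.degree (pCons 0 z)
    + Polynomial.degree (pCons 0 w)"
  show ?thesis unfolding U deg_le.simps by (rule exI[of _ ?e]) linarith
qed

locale lattice_params = nonsquare c for c :: "'a::field" +
  fixes \<tau> :: 'a
  assumes \<tau>: "\<tau> \<noteq> 0" "\<tau> \<noteq> 1"
begin

definition vertsA :: "('a \<times> 'a) set" where
  "vertsA = {\<xi>. nrm2 c \<xi> = - c}"

definition vertsB :: "('a \<times> 'a) set" where
  "vertsB = {\<eta>. nrm2 c \<eta> = c * \<tau> / (1 - \<tau>)}"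

lemma pnorm_A: "\<xi> \<in> vertsA \<Longrightarrow> pnorm c (gpoly \<xi>) = [:0, - c:]"
  unfolding pnorm_gpoly vertsA_def by simp

lemma pnorm_B:
  assumes "\<eta> \<in> vertsB"
  shows "pnorm c (gpoly \<eta>) = smult (- c / (1 - \<tau>)) ([:0, 1:] * [:- \<tau>, 1:])"
proof -
  have "- c - c * \<tau> / (1 - \<tau>) = - c / (1 - \<tau>)" using \<tau> by (simp add: field_simps)
  moreover have "nrm2 c \<eta> = c * \<tau> / (1 - \<tau>)" using assms by (simp add: vertsB_def)
  ultimately show ?thesis unfolding pnorm_gpoly by simp
qed

text \<open>The value -c - N(\<xi>) is also the coefficient of t^2 in the norm of \<gamma>_\<xi>:
  isotropy at infinity means that this norm has degree below 2.\<close>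

lemma isotropic_at_infinity_iff: "qnorm c 1 (vert 1 \<xi>) = 0 \<longleftrightarrow> \<xi> \<in> vertsA"
proof -
  have "qnorm c 1 (vert 1 \<xi>) = - c - nrm2 c \<xi>" by (cases \<xi>) (simp add: nrm2_def)
  then show ?thesis by (auto simp: vertsA_def algebra_simps)
qed

lemma isotropic_at_\<tau>_iff: "qnorm c (\<tau> * (\<tau> - 1)) (vert \<tau> \<xi>) = 0 \<longleftrightarrow> \<xi> \<in> vertsB"
proof -
  have "qnorm c (\<tau> * (\<tau> - 1)) (vert \<tau> \<xi>) = \<tau> * (nrm2 c \<xi> * (1 - \<tau>) - c * \<tau>)"
    by (cases \<xi>) (simp add: nrm2_def power2_eq_square algebra_simps)
  moreover have "nrm2 c \<xi> * (1 - \<tau>) - c * \<tau> = 0 \<longleftrightarrow> \<xi> \<in> vertsB"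
    using \<tau> by (simp add: vertsB_def eq_divide_eq)
  ultimately show ?thesis using \<tau> by simp
qed

text \<open>As e bounds the degree, i + j \<le> 2e. Three moves are available: dividing by t or t -
  1 when it occurs twice in the norm, lowering e when the leading part is 0, and multiplying by the
  \<gamma>_\<xi> that annihilates an isotropic leading part. They change the pair (e, i + j) by (-1,
  -2), (-1, 0) and (0, +1), so 4e - (i + j) decreases each time, whereas 2e - (i + j) would be
  unchanged by the first. No move changes the parity of j. What cannot be moved lies in F_q[Z] or,
  with j odd, in F_q[Z] F.\<close>

lemma descent_unramified:
  fixes Q :: "'a poly quat \<Rightarrow> bool"
  assumes cquat: "\<And>x y. (x, y) \<noteq> (0, 0) \<Longrightarrow> Q (cquat x y)"
    and cquatF: "\<And>x y. odd j \<Longrightarrow> (x, y) \<noteq> (0, 0) \<Longrightarrow> Q (cquatF x y)"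
    and scale: "\<And>h U. h \<noteq> 0 \<Longrightarrow> pnorm c U \<noteq> 0 \<Longrightarrow> Q U \<Longrightarrow> Q (pscale h U)"
    and step: "\<And>\<xi> U. \<xi> \<in> vertsA \<Longrightarrow> pnorm c U \<noteq> 0 \<Longrightarrow> Q (pmul c (gpoly \<xi>) U) \<Longrightarrow> Q U"
    and norm: "a \<noteq> 0" "pnorm c U = Spoly \<tau> a i j 0"
    and deg: "deg_le e U"
  shows "Q U"
  using cquatF norm deg
proof (induction "4 * e - (i + j)" arbitrary: e i j a U rule: less_induct)
  case less
  note norm = less.prems(2,3) and deg = less.prems(4)
  have degN: "Polynomial.degree (pnorm c U) = i + j"
    unfolding norm using norm(1) by (subst degree_Spoly) auto
  have ne: "pnorm c U \<noteq> 0" using norm by simp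
  obtain x y z w where U: "U = Quat x y z w" by (cases U)
  have le: "i + j \<le> 2 * e"
  proof (rule ccontr)
    assume "\<not> i + j \<le> 2 * e"
    moreover have "Polynomial.degree (pnorm c U) \<le> 2 * e"
    proof -
      have "Polynomial.degree x \<le> e" "Polynomial.degree y \<le> e"
        "Polynomial.degree (pCons 0 z) \<le> e" "Polynomial.degree (pCons 0 w) \<le> e"
        using deg by (simp_all only: U deg_le.simps)
      note d = this
      have sq: "Polynomial.degree (v\<^sup>2) \<le> 2 * e" if "Polynomial.degree v \<le> e" for v :: "'a poly"
        using degree_power_le[of v 2] that by linarith
      have sq': "Polynomial.degree ([:0, - 1, 1:] * v\<^sup>2) \<le> 2 * e"
        if v: "Polynomial.degree (pCons 0 v) \<le> e" for v :: "'a poly"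
      proof (cases "v = 0")
        case False
        then have "Polynomial.degree ([:0, - 1, 1:] * v\<^sup>2) = 2 + 2 * Polynomial.degree v"
          by (simp add: degree_mult_eq degree_power_eq del: mult_pCons_left)
        then show ?thesis using v False by simp
      qed simp
      have "pnorm c U = x\<^sup>2 - [:c:] * y\<^sup>2 - [:0, - 1, 1:] * z\<^sup>2
          + [:c:] * ([:0, - 1, 1:] * w\<^sup>2)"
        by (simp only: U qnorm.simps mult.assoc)
      moreover have "Polynomial.degree ([:c:] * v) = Polynomial.degree v" for v :: "'a poly"
        by simp
      ultimately show ?thesis
        using sq[OF d(1)] sq[OF d(2)] sq'[OF d(3)] sq'[OF d(4)]
        by (simp only:) (intro degree_add_le degree_diff_le; simp only:)
    qed
    ultimately show False using degN by simp
  qed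
  have divide: "Q U" if s: "s = 0 \<or> s = 1" and eq: "Spoly \<tau> a i j 0 = [:- s, 1:]\<^sup>2 * Spoly \<tau> a i' j' 0"
    and par: "odd j' \<Longrightarrow> odd j" and sum: "i + j = i' + j' + 2" for s i' j'
  proof -
    have "[:- s, 1:]\<^sup>2 dvd pnorm c U" unfolding norm eq by (rule dvd_triv_left)
    then obtain U' where U': "U = pscale [:- s, 1:] U'" using ramified_divisible s by blast
    have "[:- s, 1:]\<^sup>2 * pnorm c U' = [:- s, 1:]\<^sup>2 * Spoly \<tau> a i' j' 0"
      using norm(2) unfolding U' pnorm_pscale eq .
    then have N': "pnorm c U' = Spoly \<tau> a i' j' 0"
      by (subst (asm) mult_cancel_left) simp
    obtain e' where e': "e = Suc e'" using le sum by (cases e) auto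
    have "deg_le e' U'" using deg deg_le_pscale_linear unfolding U' e' by blast
    moreover have "4 * e' - (i' + j') < 4 * e - (i + j)" using le sum e' by simp
    ultimately have "Q U'"
      using less.hyps[of e' i' j' a U'] less.prems(1) par norm(1) N' by blast
    then show ?thesis unfolding U' using scale[of "[:- s, 1:]" U'] N' norm(1) by simp
  qed
  show ?case
  proof (cases "i \<ge> 2 \<or> j \<ge> 2")
    case True
    then show ?thesis
    proof
      assume "i \<ge> 2"
      then obtain i' where i': "i = Suc (Suc i')" by (metis Suc_le_D add_2_eq_Suc le_Suc_ex)
      show ?thesis
        by (rule divide[of 0 i' j]) (simp_all add: i' power2_eq_square)
    next
      assume "j \<ge> 2"
      then obtain j' where j': "j = Suc (Suc j')" by (metis Suc_le_D add_2_eq_Suc le_Suc_ex)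
      show ?thesis
      proof (rule divide[of 1 i j'])
        show "Spoly \<tau> a i j 0 = [:- 1, 1:]\<^sup>2 * Spoly \<tau> a i j' 0"
          by (simp only: j' power_Suc power2_eq_square mult_smult_right mult.left_commute mult.assoc)
      qed (auto simp: j')
    qed
  next
    case False
    show ?thesis
    proof (cases "i + j = 2 * e")
      case True
      with False have "i = 0 \<and> j = 0 \<and> e = 0 \<or> i = 1 \<and> j = 1 \<and> e = 1" by presburger
      then consider "i = 0" "j = 0" "e = 0" | "i = 1" "j = 1" "e = 1" by blast
      then show ?thesis
      proof cases
        case 1
        then have "z = 0" "w = 0" "Polynomial.degree x = 0" "Polynomial.degree y = 0"
          using deg by (auto simp: U split: if_splits)
        then obtain x' y' where "x = [:x':]" "y = [:y':]" by (meson degree_eq_zeroE)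
        then have xy: "U = cquat x' y'" using \<open>z = 0\<close> \<open>w = 0\<close> by (simp add: U cquat_def)
        have "(x', y') \<noteq> (0, 0)" using ne by (auto simp: xy cquat_def)
        then show ?thesis unfolding xy by (rule cquat)
      next
        case 2
        \<comment> \<open>The norm vanishes at the ramified points 0 and 1, so x and y vanish there;
          having degree at most 1, they are 0.\<close>
        have "poly x s = 0 \<and> poly y s = 0" if "s = 0 \<or> s = 1" for s
        proof -
          have "[:- s, 1:] dvd Spoly \<tau> a i j 0"
            unfolding poly_eq_0_iff_dvd[symmetric] using that by (auto simp: 2)
          then show ?thesis using pnorm_dvd_imp_roots[OF that] norm U by metis
        qed
        then have roots: "{0, 1} \<subseteq> {s. poly x s = 0}" "{0, 1} \<subseteq> {s. poly y s = 0}" by auto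
        have zero: "v = 0" if "{0, 1} \<subseteq> {s. poly v s = 0}" "Polynomial.degree v \<le> 1" for v :: "'a poly"
        proof (rule ccontr)
          assume v: "v \<noteq> 0"
          have "card {0, 1 :: 'a} \<le> card {s. poly v s = 0}"
            using that poly_roots_finite[OF v] by (intro card_mono) auto
          also have "\<dots> \<le> Polynomial.degree v" by (rule card_poly_roots_bound[OF v])
          finally show False using that by simp
        qed
        have "x = 0" "y = 0" "Polynomial.degree z = 0" "Polynomial.degree w = 0"
          using deg roots zero 2 by (auto simp: U split: if_splits)
        then obtain z' w' where "z = [:z':]" "w = [:w':]" by (meson degree_eq_zeroE)
        then have zw: "U = cquatF z' w'" using \<open>x = 0\<close> \<open>y = 0\<close> by (simp add: U cquatF_def)
        have "(z', w') \<noteq> (0, 0)" using ne by (auto simp: zw cquatF_def)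
        then show ?thesis unfolding zw using less.prems(1) 2 by simp
      qed
    next
      case False
      then have lt: "i + j < 2 * e" using le by simp
      then obtain e' where e': "e = Suc e'" by (cases e) auto
      \<comment> \<open>The norm of the leading part is the coefficient of t^(2e), and the degree i
        + j of the norm of \<open>U\<close> is smaller than 2e.\<close>
      have iso: "qnorm c 1 (lead e U) = 0"
        using coeff_pnorm[OF deg, of c] degN lt by (simp add: coeff_eq_0)
      show ?thesis
      proof (cases "lead e U = qzero")
        case True
        have "deg_le e' U"
        proof (rule lead_deg_le)
          fix n assume "n > e'"
          then have "n = e \<or> n > e" using e' by auto
          then show "lead n U = qzero" using True deg_le_lead[OF deg] by auto
        qed
        moreover have "4 * e' - (i + j) < 4 * e - (i + j)" using e' lt by simp
        ultimately show ?thesis using less.hyps[of e' i j a U] less.prems by blast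
      next
        case False
        obtain \<xi> where \<xi>: "qnorm c 1 (vert 1 \<xi>) = 0" "quat_mult c 1 (vert 1 \<xi>) (lead e U) = qzero"
          using isotropic_annihilator[of 1 "lead e U"] False iso by auto
        then have \<xi>A: "\<xi> \<in> vertsA" by (simp only: isotropic_at_infinity_iff)
        have "deg_le e (pmul c (gpoly \<xi>) U)"
        proof (rule lead_deg_le)
          fix n assume "n > e"
          then have "n = Suc e \<or> n > Suc e" by auto
          then show "lead n (pmul c (gpoly \<xi>) U) = qzero"
            using lead_pmul_gpoly[of e U c \<xi>] \<xi>(2) deg_le_lead[OF deg]
              deg_le_lead[OF deg_le_pmul_gpoly[OF deg, of c \<xi>], of n] by auto
        qed
        moreover have N: "pnorm c (pmul c (gpoly \<xi>) U) = Spoly \<tau> (- c * a) (Suc i) j 0"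
          unfolding qnorm_mult pnorm_A[OF \<xi>A] norm by (simp add: mult.assoc mult.commute[of a c])
        moreover have "4 * e - (Suc i + j) < 4 * e - (i + j)" using lt by simp
        ultimately have "Q (pmul c (gpoly \<xi>) U)"
          using less.hyps[of e "Suc i" j "- c * a"] less.prems(1) norm(1) by simp
        then show ?thesis using step \<xi>A ne by blast
      qed
    qed
  qed
qed

text \<open>The exponent k at \<tau> is lowered. If \<open>U\<close> vanishes at \<tau>, division by
  t - \<tau> lowers k by 2. Otherwise the value of \<open>U\<close> at \<tau> is isotropic and is
  annihilated by a \<gamma>_\<xi> with \<xi> in \<open>vertsB\<close>: the norm of \<gamma>_\<xi> U
  contains t - \<tau> once more, and dividing by t - \<tau> removes it twice, so k drops by 1. The
  additional factor t is harmless, because i is unrestricted.\<close>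

theorem descent:
  fixes Q :: "'a poly quat \<Rightarrow> bool"
  assumes cquat: "\<And>x y. (x, y) \<noteq> (0, 0) \<Longrightarrow> Q (cquat x y)"
    and cquatF: "\<And>x y. odd j \<Longrightarrow> (x, y) \<noteq> (0, 0) \<Longrightarrow> Q (cquatF x y)"
    and scale: "\<And>h U. h \<noteq> 0 \<Longrightarrow> pnorm c U \<noteq> 0 \<Longrightarrow> Q U \<Longrightarrow> Q (pscale h U)"
    and step: "\<And>\<xi> U. \<xi> \<in> vertsA \<union> vertsB \<Longrightarrow> pnorm c U \<noteq> 0 \<Longrightarrow> Q (pmul c (gpoly \<xi>) U) \<Longrightarrow> Q U"
    and norm: "a \<noteq> 0" "pnorm c U = Spoly \<tau> a i j k"
  shows "Q U"
  using norm
proof (induction k arbitrary: i a U rule: less_induct)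
  case (less k)
  note norm = less.prems
  have ne: "pnorm c U \<noteq> 0" using norm by simp
  let ?h = "[:- \<tau>, 1:]"
  show ?case
  proof (cases k)
    case 0
    obtain e where "deg_le e U" using ex_deg_le by blast
    then show ?thesis
      using descent_unramified[of Q j a U i e] cquat cquatF scale step norm 0 by blast
  next
    case (Suc k')
    let ?V = "quat_at \<tau> U"
    have S: "Spoly \<tau> a i j (Suc m) = ?h * Spoly \<tau> a i j m" for a i m
      by (simp only: power_Suc mult_smult_right mult.left_commute mult.assoc)
    show ?thesis
    proof (cases "?V = qzero")
      case True
      then obtain U' where U': "U = pscale ?h U'" by (rule quat_at_zero)
      have "?h * (?h * pnorm c U') = ?h * Spoly \<tau> a i j k'"
        using norm(2) unfolding U' pnorm_pscale Suc S power2_eq_square by (simp only: mult.assoc)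
      then have eq: "?h * pnorm c U' = Spoly \<tau> a i j k'"
        by (subst (asm) mult_cancel_left) simp
      \<comment> \<open>The norm has a double zero at \<tau> in this case, while t and t - 1 do not
        vanish there; so k = 1 is impossible.\<close>
      have "k' \<noteq> 0"
      proof
        assume "k' = 0"
        with eq have "poly (?h * pnorm c U') \<tau> = a * (\<tau> ^ i * (\<tau> - 1) ^ j)" by simp
        then show False using \<tau> norm(1) by simp
      qed
      then obtain k'' where k'': "k' = Suc k''" by (cases k') auto
      have N': "pnorm c U' = Spoly \<tau> a i j k''"
        using eq unfolding k'' S by (subst (asm) mult_cancel_left) simp
      have "Q U'" using less.IH[of k'' a U' i] N' norm(1) Suc k'' by simp
      moreover have "pnorm c U' \<noteq> 0" using N' norm(1) by simp
      ultimately show ?thesis unfolding U' by (intro scale) simp_all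
    next
      case False
      have "qnorm c (\<tau> * (\<tau> - 1)) ?V = 0"
        unfolding quat_at_qnorm norm Suc by simp
      then obtain \<xi> where \<xi>: "qnorm c (\<tau> * (\<tau> - 1)) (vert \<tau> \<xi>) = 0"
        "quat_mult c (\<tau> * (\<tau> - 1)) (vert \<tau> \<xi>) ?V = qzero"
        using isotropic_annihilator[of "\<tau> * (\<tau> - 1)" ?V \<tau>] False \<tau> by auto
      then have \<xi>B: "\<xi> \<in> vertsB" by (simp only: isotropic_at_\<tau>_iff)
      have "quat_at \<tau> (pmul c (gpoly \<xi>) U) = qzero"
        unfolding quat_at_pmul quat_at_gpoly by (rule \<xi>(2))
      then obtain U' where U': "pmul c (gpoly \<xi>) U = pscale ?h U'" by (rule quat_at_zero)
      define b where "b = - c / (1 - \<tau>) * a"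
      have b: "b \<noteq> 0" using \<tau> norm(1) by (simp add: b_def)
      have "?h\<^sup>2 * pnorm c U' = pnorm c (pmul c (gpoly \<xi>) U)"
        unfolding U' pnorm_pscale ..
      also have "\<dots> = smult (- c / (1 - \<tau>)) ([:0, 1:] * ?h) * Spoly \<tau> a i j (Suc k')"
        unfolding qnorm_mult pnorm_B[OF \<xi>B] norm(2) Suc ..
      also have "\<dots> = ?h\<^sup>2 * Spoly \<tau> b (Suc i) j k'"
        unfolding b_def
        by (simp only: power_Suc power2_eq_square mult_smult_right mult_smult_left smult_smult
            mult.left_commute mult.assoc mult.commute)
      finally have N': "pnorm c U' = Spoly \<tau> b (Suc i) j k'"
        by (subst (asm) mult_cancel_left) simp
      have "Q U'" using less.IH[of k' b U' "Suc i"] N' b Suc by simp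
      moreover have "pnorm c U' \<noteq> 0" using N' b by simp
      ultimately have "Q (pscale ?h U')" by (intro scale) simp_all
      then have "Q (pmul c (gpoly \<xi>) U)" unfolding U' .
      then show ?thesis using step \<xi>B ne by blast
    qed
  qed
qed

section \<open>Degrees and values of products of involutions\<close>

section \<open>Reduced words are not scalar\<close>

abbreviation word_poly :: "('a \<times> 'a) list \<Rightarrow> 'a poly quat \<Rightarrow> 'a poly quat" where
  "word_poly \<equiv> foldr (\<lambda>\<xi>. pmul c (gpoly \<xi>))"

lemma word_poly_at:
  "quat_at s (word_poly L U) = foldr (\<lambda>\<xi>. quat_mult c (s * (s - 1)) (vert s \<xi>)) L (quat_at s U)"
  by (induction L) (simp_all add: quat_at_pmul quat_at_gpoly del: vert.simps quat_mult.simps)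

lemma word_poly_lead:
  assumes "deg_le e U"
  shows "deg_le (length L + e) (word_poly L U)"
    and "lead (length L + e) (word_poly L U) = foldr (\<lambda>\<xi>. quat_mult c 1 (vert 1 \<xi>)) L (lead e U)"
proof (induction L)
  case (Cons \<xi> L)
  case 1
  show ?case using Cons(1) deg_le_pmul_gpoly by simp
  case 2
  have "lead (Suc (length L + e)) (word_poly L U) = qzero" using deg_le_lead[OF Cons(1)] by simp
  from lead_pmul_gpoly[OF this, of c \<xi>] show ?case using Cons(2) by simp
qed (use assms in auto)

text \<open>Norms multiply. A letter of the first kind has norm -ct of degree only 1; the missing
  degree is its zero at infinity.\<close>

lemma degree_pnorm_word_poly:
  assumes "set xs \<subseteq> vertsA" "set ys \<subseteq> vertsB" "pnorm c U \<noteq> 0"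
  shows "pnorm c (word_poly xs (word_poly ys U)) \<noteq> 0 \<and>
    Polynomial.degree (pnorm c (word_poly xs (word_poly ys U))) =
      length xs + 2 * length ys + Polynomial.degree (pnorm c U)"
proof -
  have ys: "pnorm c (word_poly ys U) \<noteq> 0 \<and> Polynomial.degree (pnorm c (word_poly ys U)) =
      2 * length ys + Polynomial.degree (pnorm c U)"
    using assms(2)
  proof (induction ys)
    case (Cons \<eta> ys)
    then have "pnorm c (gpoly \<eta>) = smult (- c / (1 - \<tau>)) ([:0, 1:] * [:- \<tau>, 1:])"
      by (intro pnorm_B) auto
    then have "pnorm c (gpoly \<eta>) \<noteq> 0" "Polynomial.degree (pnorm c (gpoly \<eta>)) = 2"
      using \<tau> by simp_all
    then show ?case using Cons by (simp add: qnorm_mult degree_mult_eq)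
  qed (use assms in simp)
  show ?thesis
    using assms(1)
  proof (induction xs)
    case (Cons \<xi> xs)
    then have "pnorm c (gpoly \<xi>) = [:0, - c:]" by (intro pnorm_A) auto
    then have "pnorm c (gpoly \<xi>) \<noteq> 0" "Polynomial.degree (pnorm c (gpoly \<xi>)) = 1" by simp_all
    then show ?case using Cons by (simp add: qnorm_mult degree_mult_eq)
  qed (use ys in simp)
qed

text \<open>Two counts contradict each other. At infinity the letters of \<open>ys\<close> are
  invertible and the reduced word \<open>xs\<close> does not annihilate the leading part, so a
  scalar value h has the full degree |xs| + |ys| + e, and its norm h^2 has degree 2|xs| + 2|ys| +
  2e. The product of the norms of the factors has degree |xs| + 2|ys| + 2e, whence \<open>xs\<close>
  is empty. At \<tau> the reduced word \<open>ys\<close> gives a nonzero value h(\<tau>), although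
  the norm h^2 vanishes at \<tau> if \<open>ys\<close> has a letter.\<close>

lemma word_poly_not_scalar:
  assumes xs: "set xs \<subseteq> vertsA" "distinct_adj xs" and ys: "set ys \<subseteq> vertsB" "distinct_adj ys"
    and U: "U = cquat x y \<or> U = cquatF x y" and xy: "(x, y) \<noteq> (0, 0)"
    and scalar: "word_poly xs (word_poly ys U) = Quat h 0 0 0"
  shows "xs = [] \<and> ys = []"
proof -
  \<comment> \<open>The degree of \<open>U\<close> in the basis adapted to infinity, where F has
    degree 1.\<close>
  define e :: nat where "e = (if U = cquat x y then 0 else 1)"
  have nz: "nrm2 c (x, y) \<noteq> 0" using xy nrm2_eq_0_iff by blast
  have deg: "deg_le e U"
  proof -
    have "Polynomial.degree (pCons 0 [:v:]) \<le> 1" for v :: 'a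
      using degree_pCons_le[of 0 "[:v:]"] by simp
    then show ?thesis using U by (simp add: e_def cquat_def cquatF_def del: degree_pCons_eq_if) auto
  qed
  have degN: "Polynomial.degree (pnorm c U) = 2 * e" and N: "pnorm c U \<noteq> 0"
    using U nz pnorm_cquat[of c x y] pnorm_cquatF[of c x y] by (auto simp: e_def)
  have lead: "qnorm c 1 (lead e U) \<noteq> 0"
    using U nz by (auto simp: e_def cquat_def cquatF_def nrm2_def)
  have at: "qnorm c (\<tau> * (\<tau> - 1)) (quat_at \<tau> U) \<noteq> 0"
    unfolding quat_at_qnorm using U nz \<tau> pnorm_cquat[of c x y] pnorm_cquatF[of c x y]
    by (auto simp: algebra_simps)
  let ?W = "word_poly xs (word_poly ys U)"
  have NW: "pnorm c ?W = h\<^sup>2" unfolding scalar by simp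
  have norm_foldr: "qnorm c \<beta> (foldr (\<lambda>\<xi>. quat_mult c \<beta> (vert t \<xi>)) L v) \<noteq> 0"
    if "\<And>\<xi>. \<xi> \<in> set L \<Longrightarrow> qnorm c \<beta> (vert t \<xi>) \<noteq> 0" "qnorm c \<beta> v \<noteq> 0" for \<beta> t L v
    using that by (induction L) (simp_all add: qnorm_mult del: vert.simps quat_mult.simps)
  let ?fl = "foldr (\<lambda>\<xi>. quat_mult c 1 (vert 1 \<xi>))"
  \<comment> \<open>Together with the criterion for isotropy this makes the letters from
    \<open>vertsB\<close> invertible at infinity.\<close>
  have disj: "\<xi> \<notin> vertsB" if "\<xi> \<in> vertsA" for \<xi>
  proof
    assume "\<xi> \<in> vertsB"
    with that have "- c = c * \<tau> / (1 - \<tau>)" by (simp add: vertsA_def vertsB_def)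
    then have "- c * (1 - \<tau>) = c * \<tau>" using \<tau> by (simp add: eq_divide_eq)
    then show False by (simp add: algebra_simps)
  qed
  have "lead (length ys + e) (word_poly ys U) = ?fl ys (lead e U)"
    "deg_le (length ys + e) (word_poly ys U)"
    using word_poly_lead[OF deg] by simp_all
  then have "lead (length xs + (length ys + e)) ?W = ?fl xs (?fl ys (lead e U))"
    and bound: "deg_le (length xs + (length ys + e)) ?W"
    using word_poly_lead[of "length ys + e" "word_poly ys U" xs] by simp_all
  moreover have "qnorm c 1 (?fl ys (lead e U)) \<noteq> 0"
    using lead ys disj by (intro norm_foldr) (auto simp: isotropic_at_infinity_iff)
  then have "?fl xs (?fl ys (lead e U)) \<noteq> qzero"
    using xs by (intro reduced_product_nonzero) (auto simp: isotropic_at_infinity_iff)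
  ultimately have "lead (length xs + (length ys + e)) ?W \<noteq> qzero" by simp
  then have "coeff h (length xs + (length ys + e)) \<noteq> 0" unfolding scalar by simp
  moreover have "Polynomial.degree h \<le> length xs + (length ys + e)"
    using bound unfolding scalar by simp
  ultimately have "Polynomial.degree h = length xs + (length ys + e)" "h \<noteq> 0"
    by (auto intro: antisym le_degree)
  then have "Polynomial.degree (pnorm c ?W) = 2 * (length xs + (length ys + e))"
    unfolding NW by (simp add: degree_power_eq)
  then have "xs = []"
    using degree_pnorm_word_poly[OF xs(1) ys(1) N] degN by simp
  let ?ft = "foldr (\<lambda>\<xi>. quat_mult c (\<tau> * (\<tau> - 1)) (vert \<tau> \<xi>))"
  have "?ft ys (quat_at \<tau> U) \<noteq> qzero"
    using \<tau> at ys by (intro reduced_product_nonzero) (auto simp: isotropic_at_\<tau>_iff)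
  then have "quat_at \<tau> ?W \<noteq> qzero" using \<open>xs = []\<close> by (simp add: word_poly_at)
  then have "poly h \<tau> \<noteq> 0" unfolding scalar by simp
  then have "poly (pnorm c ?W) \<tau> \<noteq> 0" unfolding NW by simp
  moreover have "poly (pnorm c ?W) \<tau> = 0" if nonempty: "ys \<noteq> []"
  proof -
    obtain \<eta> ys' where "ys = \<eta> # ys'" using nonempty by (cases ys) auto
    then show ?thesis
      using ys(1) pnorm_B[of \<eta>] by (simp add: \<open>xs = []\<close> qnorm_mult)
  qed
  ultimately show ?thesis using \<open>xs = []\<close> by blast
qed

end

section \<open>F_q[Z] as a subfield of the algebraic closure of F_q\<close>

section \<open>The quadratic extension\<close>

text \<open>Multiplication by x \<noteq> 0 permutes the nonzero elements, so their product is
  unchanged when each of them is multiplied by x.\<close>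

lemma finite_power_card:
  fixes x :: "'a::{field,finite}"
  shows "x ^ CARD('a) = x"
proof (cases "x = 0")
  case False
  let ?U = "UNIV - {0 :: 'a}"
  have "(\<Prod>y\<in>?U. x * y) = (\<Prod>y\<in>?U. y)"
    using False by (intro prod.reindex_bij_witness[of _ "\<lambda>y. y / x" "\<lambda>y. x * y"]) auto
  then have "x ^ (CARD('a) - 1) * \<Prod>?U = \<Prod>?U"
    by (simp add: prod.distrib card_Diff_singleton)
  then have "x ^ (CARD('a) - 1) = 1" by (simp add: prod_zero_iff)
  moreover have "Suc (CARD('a) - 1) = CARD('a)" by (simp add: Suc_diff_1)
  ultimately show ?thesis using power_Suc[of x "CARD('a) - 1"] by simp
next
  case True
  then show ?thesis by (simp add: zero_power)
qed

text \<open>Translation by 1 permutes the field. Comparing the sums of all elements shows that the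
  characteristic divides p^n.\<close>

lemma prime_power_CHAR:
  assumes "Factorial_Ring.prime p" "CARD('a::{field,finite}) = p ^ n"
  shows "CHAR('a) = p"
proof -
  have "(\<Sum>x\<in>UNIV. x + 1 :: 'a) = (\<Sum>x\<in>UNIV. x)"
    by (rule sum.reindex_bij_witness[of _ "\<lambda>x. x - 1" "\<lambda>x. x + 1"]) auto
  then have "of_nat (CARD('a)) = (0 :: 'a)" by (simp add: sum.distrib)
  then have dvd: "CHAR('a) dvd p ^ n" unfolding of_nat_eq_0_iff_char_dvd assms(2) .
  moreover have "p ^ n \<noteq> 0" using assms(1) by (auto simp: prime_gt_0_nat)
  ultimately have "CHAR('a) > 0" by (metis dvd_0_left_iff gr0I)
  then have "Factorial_Ring.prime CHAR('a)" by (rule prime_CHAR_semidom)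
  then show ?thesis
    using dvd assms(1) prime_dvd_power primes_dvd_imp_eq by blast
qed

locale finite_params = lattice_params c \<tau> for c \<tau> :: "'a::{field,finite}" +
  fixes p n :: nat
  assumes p: "Factorial_Ring.prime p" and CARD: "CARD('a) = p ^ n"
begin

abbreviation gmult :: "'a poly fract quat set \<Rightarrow> 'a poly fract quat set \<Rightarrow> 'a poly fract quat set"
    (infixl "\<cdot>" 70) where
  "u \<cdot> v \<equiv> u \<otimes>\<^bsub>GK c\<^esub> v"

definition q :: nat where "q = p ^ n"

lemma CARD_q [simp]: "CARD('a) = q"
  by (simp add: q_def CARD)

lemma frobenius_add: "(x + y :: 'a alg_closure) ^ q = x ^ q + y ^ q"
proof -
  have "CHAR('a alg_closure) = p" using prime_power_CHAR[OF p CARD] by simp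
  then show ?thesis using p CARD by (intro freshmans_dream'[where n = n]) (auto simp: q_def)
qed

lemma frobenius_diff: "(x - y :: 'a alg_closure) ^ q = x ^ q - y ^ q"
  using frobenius_add[of "x - y" y] by (simp add: algebra_simps)

lemma to_ac_pow_q [simp]: "to_ac x ^ q = to_ac (x :: 'a)"
  using finite_power_card[of x] by (metis to_ac_power CARD_q)

text \<open>\<iota> stands for Z. In the algebraic closure quotients and q-th powers belong to a
  field type, and the conjugation of F_q[Z] becomes x \<mapsto> x^q; inside D these operations would
  concern a subset of a noncommutative ring.\<close>

definition \<iota> :: "'a alg_closure" where
  "\<iota> = (SOME x. x\<^sup>2 = to_ac c)"

lemma \<iota>_square: "\<iota> * \<iota> = to_ac c"
proof -
  have "\<exists>x. x\<^sup>2 = to_ac c" by (rule nth_root_exists) simp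
  then have "\<iota>\<^sup>2 = to_ac c" unfolding \<iota>_def by (rule someI_ex)
  then show ?thesis by (simp add: power2_eq_square)
qed

definition quad :: "'a \<times> 'a \<Rightarrow> 'a alg_closure" where
  "quad \<xi> = to_ac (fst \<xi>) + to_ac (snd \<xi>) * \<iota>"

lemma quad_mult: "quad (x, y) * quad (x', y') = quad (x * x' + c * y * y', x * y' + y * x')"
proof -
  have "quad (x, y) * quad (x', y') = to_ac x * to_ac x' + to_ac y * to_ac y' * (\<iota> * \<iota>)
      + (to_ac x * to_ac y' + to_ac y * to_ac x') * \<iota>"
    by (simp add: quad_def algebra_simps)
  then show ?thesis unfolding \<iota>_square by (simp add: quad_def algebra_simps)
qed

lemma quad_diff: "quad (x, y) - quad (x', y') = quad (x - x', y - y')"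
  by (simp add: quad_def algebra_simps)

lemma quad_to_ac: "quad (x, 0) = to_ac x"
  by (simp add: quad_def)

lemma quad_eq_0_iff: "quad \<xi> = 0 \<longleftrightarrow> \<xi> = (0, 0)"
proof
  assume "quad \<xi> = 0"
  then have "quad (fst \<xi>, snd \<xi>) * quad (fst \<xi>, - snd \<xi>) = 0" by simp
  then have "to_ac (nrm2 c \<xi>) = 0"
    unfolding quad_mult by (simp add: quad_def nrm2_def power2_eq_square mult.assoc mult.commute)
  then show "\<xi> = (0, 0)" by (simp add: nrm2_eq_0_iff)
qed (simp add: quad_def)

lemma inj_quad: "inj quad"
proof (rule injI)
  fix \<xi> \<eta> assume "quad \<xi> = quad \<eta>"
  then have "quad (fst \<xi> - fst \<eta>, snd \<xi> - snd \<eta>) = 0"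
    using quad_diff[of "fst \<xi>" "snd \<xi>" "fst \<eta>" "snd \<eta>"] by simp
  then show "\<xi> = \<eta>" unfolding quad_eq_0_iff by (simp add: prod_eq_iff)
qed

text \<open>If \<open>\<iota>\<close> were fixed by Frobenius, it would be one of the \<open>q\<close> roots of $X^q - X$, which are the
  elements of $F_q$.\<close>

lemma frobenius_\<iota>_neq: "\<iota> ^ q \<noteq> \<iota>"
proof
  assume \<iota>: "\<iota> ^ q = \<iota>"
  define f :: "'a alg_closure poly" where "f = Polynomial.monom 1 q - Polynomial.monom 1 1"
  have "card {0, 1 :: 'a} \<le> CARD('a)" by (intro card_mono) auto
  then have q1: "q > 1" by simp
  then have cf: "coeff f q = 1" by (simp add: f_def)
  then have f0: "f \<noteq> 0" by auto
  have "Polynomial.degree f \<le> q"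
    unfolding f_def using q1 by (intro degree_diff_le order_trans[OF degree_monom_le]) auto
  then have le: "card {x. poly f x = 0} \<le> q" using card_poly_roots_bound[OF f0] by linarith
  have root: "poly f x = x ^ q - x" for x by (simp add: f_def poly_monom)
  have "insert \<iota> (range to_ac) \<subseteq> {x. poly f x = 0}" using \<iota> by (auto simp: root)
  then have "card (insert \<iota> (range to_ac)) \<le> card {x. poly f x = 0}"
    by (rule card_mono[OF poly_roots_finite[OF f0]])
  then have small: "card (insert \<iota> (range to_ac)) \<le> q" using le by (rule order_trans)
  have card: "card (range (to_ac :: 'a \<Rightarrow> _)) = q"
    unfolding card_image[OF inj_to_ac] by (rule CARD_q)
  have "\<iota> \<in> range to_ac"
  proof (rule ccontr)
    assume "\<iota> \<notin> range to_ac"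
    then have "card (insert \<iota> (range to_ac)) = Suc q"
      unfolding card[symmetric] by (intro card_insert_disjoint finite_imageI finite)
    then show False using small by linarith
  qed
  then obtain x where "\<iota> = to_ac x" by auto
  then have "to_ac (x * x) = to_ac c" using \<iota>_square by simp
  then have "x * x = c" by (simp only: to_ac_eq_iff)
  then show False using nonsquare[of x] by (simp add: power2_eq_square)
qed

text \<open>Both \<iota> and \<iota>^q are square roots of c, and they are different.\<close>

lemma frobenius_\<iota>: "\<iota> ^ q = - \<iota>"
proof -
  have "(\<iota> ^ q) * (\<iota> ^ q) = \<iota> * \<iota>"
    by (simp only: power_mult_distrib[symmetric] \<iota>_square to_ac_pow_q)
  then show ?thesis using frobenius_\<iota>_neq square_eq_iff by blast
qed

lemma uminus_\<iota>_neq: "- \<iota> \<noteq> \<iota>"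
  using frobenius_\<iota>_neq frobenius_\<iota> by simp

lemma quad_pow_q: "quad (x, y) ^ q = quad (x, - y)"
  by (simp add: quad_def frobenius_add power_mult_distrib frobenius_\<iota>)

definition F2 :: "'a alg_closure set" where
  "F2 = range quad"

abbreviation co :: "'a alg_closure \<Rightarrow> 'a \<times> 'a" where
  "co \<equiv> inv_into UNIV quad"

lemma quad_co [simp]: "v \<in> F2 \<Longrightarrow> quad (co v) = v"
  by (simp add: F2_def f_inv_into_f)

lemma co_quad [simp]: "co (quad \<xi>) = \<xi>"
  by (simp add: inj_quad)

lemma quad_F2 [simp]: "quad \<xi> \<in> F2"
  by (simp add: F2_def)

lemma co_inject: "v \<in> F2 \<Longrightarrow> w \<in> F2 \<Longrightarrow> co v = co w \<longleftrightarrow> v = w"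
  by (metis quad_co)

lemma F2_cases:
  assumes "v \<in> F2"
  obtains x y where "v = quad (x, y)"
  using assms by (auto simp: F2_def)

lemma F2_to_ac [simp]: "to_ac x \<in> F2"
  by (metis quad_F2 quad_to_ac)

lemma F2_01 [simp]: "0 \<in> F2" "1 \<in> F2"
  using F2_to_ac[of 0] F2_to_ac[of 1] by simp_all

lemma F2_\<iota> [simp]: "\<iota> \<in> F2"
  using quad_F2[of "(0, 1)"] by (simp add: quad_def)

lemma \<iota>_nonzero [simp]: "\<iota> \<noteq> 0"
  using \<iota>_square by auto

lemma F2_mult [simp]: "v \<in> F2 \<Longrightarrow> w \<in> F2 \<Longrightarrow> v * w \<in> F2"
  by (elim F2_cases) (simp add: quad_mult)

lemma F2_diff [simp]: "v \<in> F2 \<Longrightarrow> w \<in> F2 \<Longrightarrow> v - w \<in> F2"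
  by (elim F2_cases) (simp add: quad_diff)

lemma F2_uminus [simp]: "v \<in> F2 \<Longrightarrow> - v \<in> F2"
  using F2_diff[of 0 v] by simp

lemma F2_add [simp]: "v \<in> F2 \<Longrightarrow> w \<in> F2 \<Longrightarrow> v + w \<in> F2"
  using F2_diff[of v "- w"] by simp

lemma F2_power [simp]: "v \<in> F2 \<Longrightarrow> v ^ k \<in> F2"
  by (induction k) auto

lemma pow_q_q [simp]: "v \<in> F2 \<Longrightarrow> (v ^ q) ^ q = v"
  by (elim F2_cases) (simp add: quad_pow_q)

lemma mult_pow_q: "v \<in> F2 \<Longrightarrow> v * v ^ q = to_ac (nrm2 c (co v))"
  by (elim F2_cases) (simp add: quad_pow_q quad_mult quad_to_ac[symmetric] nrm2_def power2_eq_square algebra_simps)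

lemma nrm2_co_eq_0_iff: "v \<in> F2 \<Longrightarrow> nrm2 c (co v) = 0 \<longleftrightarrow> v = 0"
  by (metis nrm2_eq_0_iff quad_co quad_eq_0_iff)

lemma F2_inverse [simp]: "v \<in> F2 \<Longrightarrow> inverse v \<in> F2"
proof (cases "v = 0")
  case False
  assume v: "v \<in> F2"
  have "v * (v ^ q * to_ac (inverse (nrm2 c (co v)))) = to_ac (nrm2 c (co v) * inverse (nrm2 c (co v)))"
    by (simp only: mult.assoc[symmetric] mult_pow_q[OF v] to_ac_mult)
  also have "\<dots> = 1" using False v by (simp add: nrm2_co_eq_0_iff)
  finally have "inverse v = v ^ q * to_ac (inverse (nrm2 c (co v)))" by (rule inverse_unique)
  then show ?thesis using v by (simp only: F2_mult F2_power F2_to_ac)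
qed simp

lemma F2_divide [simp]: "v \<in> F2 \<Longrightarrow> w \<in> F2 \<Longrightarrow> v / w \<in> F2"
  by (simp add: divide_inverse)

text \<open>The embedding of the field \<open>F2\<close> in D with image F_q[Z]. Outside
  \<open>F2\<close> its values are unspecified, since \<open>co\<close> is then an arbitrary choice;
  hence the membership assumptions below.\<close>

definition zq :: "'a alg_closure \<Rightarrow> 'a poly fract quat" where
  "zq v = Quat (fq (fst (co v))) (fq (snd (co v))) 0 0"

lemma fq_simps:
  "fq (x + y) = fq x + fq y" "fq (x - y) = fq x - fq y" "fq (x * y) = fq x * fq y" "fq (- x) = - fq x"
  "fq 0 = 0" "fq 1 = 1"
  unfolding fq_def to_fract_add[symmetric] to_fract_diff[symmetric] to_fract_mult[symmetric]
    to_fract_uminus[symmetric]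
  by (simp_all add: one_pCons[symmetric])

lemma fq_eq_iff [simp]: "fq x = fq y \<longleftrightarrow> x = y"
  by (simp add: fq_def)

lemma DK_mult: "u \<otimes>\<^bsub>DK c\<^esub> v = quat_mult (fq c) (tK * (tK - 1)) u v"
  by (simp add: DK_def quat_alg_def)

lemma DK_minus: "Quat x y z w \<ominus>\<^bsub>DK c\<^esub> Quat x' y' z' w' = Quat (x - x') (y - y') (z - z') (w - w')"
proof -
  interpret ring "DK c" by (rule ring_DK)
  have "\<ominus>\<^bsub>DK c\<^esub> Quat x' y' z' w' = Quat (- x') (- y') (- z') (- w')"
    by (rule minus_equality) (simp_all, simp_all add: DK_def quat_alg_def)
  then show ?thesis by (simp add: a_minus_def) (simp add: DK_def quat_alg_def)
qed

lemma zq_mult: "v \<in> F2 \<Longrightarrow> w \<in> F2 \<Longrightarrow> zq v \<otimes>\<^bsub>DK c\<^esub> zq w = zq (v * w)"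
  by (elim F2_cases) (simp add: zq_def quad_mult DK_mult fq_simps mult.assoc)

lemma zq_diff: "v \<in> F2 \<Longrightarrow> w \<in> F2 \<Longrightarrow> zq v \<ominus>\<^bsub>DK c\<^esub> zq w = zq (v - w)"
  by (elim F2_cases) (simp add: zq_def quad_diff DK_minus fq_simps)

lemma zq_to_ac: "zq (to_ac x) = scalar (fq x)"
  by (simp add: zq_def quad_to_ac[symmetric] scalar_def fq_simps)

lemma zq_one: "\<one>\<^bsub>DK c\<^esub> = zq 1"
  using zq_to_ac[of 1] by (simp add: one_DK fq_simps)

lemma zq_\<iota>: "elZ = zq \<iota>"
proof -
  have "\<iota> = quad (0, 1)" by (simp add: quad_def)
  then show ?thesis by (simp add: zq_def elZ_def fq_simps)
qed

lemma zq_pow: "v \<in> F2 \<Longrightarrow> zq v [^]\<^bsub>DK c\<^esub> (k :: nat) = zq (v ^ k)"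
proof (induction k)
  case 0
  then show ?case by (simp add: nat_pow_def zq_one)
next
  case (Suc k)
  interpret ring "DK c" by (rule ring_DK)
  show ?case using Suc by (simp add: zq_mult mult.commute)
qed

lemma zq_inv:
  assumes v: "v \<in> F2" "v \<noteq> 0"
  shows "zq v \<in> Units (DK c)" "inv\<^bsub>DK c\<^esub> zq v = zq (inverse v)"
proof -
  interpret ring "DK c" by (rule ring_DK)
  have *: "zq v \<otimes>\<^bsub>DK c\<^esub> zq (inverse v) = \<one>\<^bsub>DK c\<^esub>" "zq (inverse v) \<otimes>\<^bsub>DK c\<^esub> zq v = \<one>\<^bsub>DK c\<^esub>"
    using v by (simp_all add: zq_mult zq_one)
  then show "zq v \<in> Units (DK c)" by (auto simp: Units_def)
  show "inv\<^bsub>DK c\<^esub> zq v = zq (inverse v)"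
    by (rule inv_char) (use * in auto)
qed

lemma zq_bar: "v \<in> F2 \<Longrightarrow> bar c (zq v) = zq (v ^ q)"
  by (simp add: bar_def zq_pow)

lemma zq_nrm: "v \<in> F2 \<Longrightarrow> nrm c (zq v) = scalar (fq (nrm2 c (co v)))"
  by (simp add: nrm_def zq_bar zq_mult mult_pow_q zq_to_ac)

lemma zq_wp: "v \<in> F2 \<Longrightarrow> v \<noteq> 0 \<Longrightarrow> wp c (zq v) = zq (v / v ^ q)"
  by (simp add: wp_def zq_bar zq_inv zq_mult divide_inverse)

lemma zq_inject: "v \<in> F2 \<Longrightarrow> w \<in> F2 \<Longrightarrow> zq v = zq w \<longleftrightarrow> v = w"
  using co_inject[of v w] by (auto simp: zq_def prod_eq_iff)

lemma FqZ_eq: "FqZ = zq ` F2"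
proof (intro equalityI subsetI)
  fix u assume "u \<in> (FqZ :: 'a poly fract quat set)"
  then obtain x y where "u = Quat (fq x) (fq y) 0 0" by (auto simp: FqZ_def)
  then have "u = zq (quad (x, y))" by (simp add: zq_def)
  then show "u \<in> zq ` F2" by simp
qed (auto simp: FqZ_def zq_def)

lemma FqZ_star_simps:
  "carrier (FqZ_star c) = zq ` (F2 - {0})" (is ?thesis1)
  "u \<otimes>\<^bsub>FqZ_star c\<^esub> v = u \<otimes>\<^bsub>DK c\<^esub> v"
  "\<one>\<^bsub>FqZ_star c\<^esub> = zq 1"
proof -
  let ?R = "(DK c)\<lparr>carrier := FqZ\<rparr>"
  have "zq v \<in> Units ?R \<longleftrightarrow> v \<noteq> 0" if v: "v \<in> F2" for v
  proof
    assume "zq v \<in> Units ?R"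
    then obtain w where "w \<in> F2" "zq v \<otimes>\<^bsub>DK c\<^esub> zq w = \<one>\<^bsub>DK c\<^esub>"
      by (auto simp: Units_def FqZ_eq)
    then have "v * w = 1" using v by (simp add: zq_mult zq_one zq_inject)
    then show "v \<noteq> 0" by auto
  next
    assume "v \<noteq> 0"
    then have "zq v \<otimes>\<^bsub>DK c\<^esub> zq (inverse v) = \<one>\<^bsub>DK c\<^esub>" "zq (inverse v) \<otimes>\<^bsub>DK c\<^esub> zq v = \<one>\<^bsub>DK c\<^esub>"
      using v by (simp_all add: zq_mult zq_one)
    then show "zq v \<in> Units ?R" using v by (auto simp: Units_def FqZ_eq)
  qed
  moreover have "Units ?R \<subseteq> zq ` F2" by (auto simp: Units_def FqZ_eq)
  ultimately show ?thesis1 unfolding FqZ_star_def units_of_def by auto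
qed (simp_all add: FqZ_star_def units_of_def zq_one)

lemma group_FqZ_star: "group (FqZ_star c)"
proof (rule groupI)
  fix u assume "u \<in> carrier (FqZ_star c)"
  then obtain v where "v \<in> F2" "v \<noteq> 0" "u = zq v" by (auto simp: FqZ_star_simps)
  then show "\<exists>w\<in>carrier (FqZ_star c). w \<otimes>\<^bsub>FqZ_star c\<^esub> u = \<one>\<^bsub>FqZ_star c\<^esub>"
    by (intro bexI[of _ "zq (inverse v)"]) (auto simp: FqZ_star_simps zq_mult)
qed (auto simp: FqZ_star_simps zq_mult mult.assoc)

lemma FqZ_star_pow: "v \<in> F2 \<Longrightarrow> zq v [^]\<^bsub>FqZ_star c\<^esub> (k :: nat) = zq (v ^ k)"
proof (induction k)
  case (Suc k)
  interpret group "FqZ_star c" by (rule group_FqZ_star)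
  show ?case using Suc by (simp add: FqZ_star_simps zq_mult mult.commute)
qed (simp add: nat_pow_def FqZ_star_simps)

lemma Fq_coset_zq:
  assumes "v \<in> F2"
  shows "Fq_star #>\<^bsub>FqZ_star c\<^esub> zq v = (\<lambda>x. zq (to_ac x * v)) ` (UNIV - {0})"
proof -
  have Fs: "(Fq_star :: 'a poly fract quat set) = (\<lambda>x. zq (to_ac x)) ` (UNIV - {0})"
    by (auto simp: Fq_star_def zq_to_ac)
  have m: "zq (to_ac x) \<otimes>\<^bsub>DK c\<^esub> zq v = zq (to_ac x * v)" for x
    using assms by (simp add: zq_mult)
  have "Fq_star #>\<^bsub>FqZ_star c\<^esub> zq v = (\<lambda>u. u \<otimes>\<^bsub>DK c\<^esub> zq v) ` Fq_star"
    by (simp add: r_coset_def FqZ_star_simps UNION_singleton_eq_range)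
  then show ?thesis unfolding Fs image_image m .
qed

text \<open>Equality of cosets is proportionality over F_q. The scalar x is nonzero automatically,
  because v is.\<close>

lemma eq_mod_Fq_zq:
  assumes v: "v \<in> F2" and w: "w \<in> F2"
  shows "eq_mod_Fq c (zq v) (zq w) \<longleftrightarrow> v \<noteq> 0 \<and> w \<noteq> 0 \<and> (\<exists>x. v = to_ac x * w)"
proof -
  have mem: "zq v \<in> carrier (FqZ_star c) \<longleftrightarrow> v \<noteq> 0" if "v \<in> F2" for v
    using that by (auto simp: FqZ_star_simps zq_inject)
  have "(\<lambda>x. zq (to_ac x * v)) ` (UNIV - {0}) = (\<lambda>x. zq (to_ac x * w)) ` (UNIV - {0})
      \<longleftrightarrow> (\<exists>x. v = to_ac x * w)" (is "?l v = ?l w \<longleftrightarrow> _")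
    if nz: "v \<noteq> 0" "w \<noteq> 0"
  proof
    assume eq: "?l v = ?l w"
    have "zq (to_ac 1 * v) \<in> ?l v" by (rule imageI) simp
    then obtain x where "zq (to_ac 1 * v) = zq (to_ac x * w)" unfolding eq by (rule imageE)
    then show "\<exists>x. v = to_ac x * w" using v w by (intro exI[of _ x]) (simp add: zq_inject)
  next
    assume "\<exists>x. v = to_ac x * w"
    then obtain x where x: "v = to_ac x * w" by blast
    then have x0: "x \<noteq> 0" using nz by auto
    have "?l v \<subseteq> ?l w"
    proof (rule image_subsetI)
      fix y :: 'a assume y: "y \<in> UNIV - {0}"
      have "zq (to_ac y * v) = zq (to_ac (y * x) * w)" by (simp add: x mult.assoc)
      then show "zq (to_ac y * v) \<in> ?l w" using x0 y by (intro image_eqI[of _ _ "y * x"]) auto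
    qed
    moreover have "?l w \<subseteq> ?l v"
    proof (rule image_subsetI)
      fix y :: 'a assume y: "y \<in> UNIV - {0}"
      have "zq (to_ac y * w) = zq (to_ac (y / x) * v)" using x0 by (simp add: x)
      then show "zq (to_ac y * w) \<in> ?l v" using x0 y by (intro image_eqI[of _ _ "y / x"]) auto
    qed
    ultimately show "?l v = ?l w" by (rule equalityI)
  qed
  then show ?thesis
    unfolding eq_mod_Fq_def mem[OF v] mem[OF w] Fq_coset_zq[OF v] Fq_coset_zq[OF w] by blast
qed

section \<open>Classes modulo scalars of polynomial quaternions, and their commutation rules\<close>

section \<open>Classes of quaternions\<close>

abbreviation emb :: "'a poly quat \<Rightarrow> 'a poly fract quat" where
  "emb \<equiv> map_quat to_fract"

definition cl :: "'a poly quat \<Rightarrow> 'a poly fract quat set" where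
  "cl U = cls c (emb U)"

abbreviation knorm :: "'a poly fract quat \<Rightarrow> 'a poly fract" where
  "knorm \<equiv> qnorm (fq c) (tK * (tK - 1))"

lemma to_fract_\<beta>: "to_fract [:0, - 1, 1:] = tK * (tK - 1 :: 'a poly fract)"
proof -
  have "tK * (tK - 1 :: 'a poly fract) = to_fract ([:0, 1:] * ([:0, 1:] - 1))"
    by (simp only: tK_def to_fract_mult to_fract_diff to_fract_1)
  then show ?thesis by (simp add: one_pCons)
qed

lemma emb_pmul: "emb (pmul c U V) = emb U \<otimes>\<^bsub>DK c\<^esub> emb V"
  unfolding DK_mult to_fract_\<beta>[symmetric] fq_def by (rule map_quat_mult) simp_all

lemma knorm_emb: "knorm (emb U) = to_fract (pnorm c U)"
  unfolding to_fract_\<beta>[symmetric] fq_def by (rule qnorm_map) simp_all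

lemma knorm_mult: "knorm (u \<otimes>\<^bsub>DK c\<^esub> v) = knorm u * knorm v"
  unfolding DK_mult by (rule qnorm_mult)

text \<open>The inverse r of the norm is a parameter so that the same formula later locates the
  inverse inside an order: there r is known to lie in the subring.\<close>

lemma DK_inverse:
  assumes "knorm u * r = 1"
  shows "u \<otimes>\<^bsub>DK c\<^esub> (scalar r \<otimes>\<^bsub>DK c\<^esub> qconj u) = \<one>\<^bsub>DK c\<^esub>"
    "(scalar r \<otimes>\<^bsub>DK c\<^esub> qconj u) \<otimes>\<^bsub>DK c\<^esub> u = \<one>\<^bsub>DK c\<^esub>"
proof -
  interpret ring "DK c" by (rule ring_DK)
  have conj: "qconj u \<otimes>\<^bsub>DK c\<^esub> u = scalar (knorm u)" "u \<otimes>\<^bsub>DK c\<^esub> qconj u = scalar (knorm u)"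
    by (simp_all only: DK_mult qconj_mult scalar_def)
  then show "(scalar r \<otimes>\<^bsub>DK c\<^esub> qconj u) \<otimes>\<^bsub>DK c\<^esub> u = \<one>\<^bsub>DK c\<^esub>"
    using assms by (simp add: m_assoc scalar_mult_scalar one_DK mult.commute)
  have "u \<otimes>\<^bsub>DK c\<^esub> (scalar r \<otimes>\<^bsub>DK c\<^esub> qconj u) = scalar r \<otimes>\<^bsub>DK c\<^esub> (u \<otimes>\<^bsub>DK c\<^esub> qconj u)"
    by (simp add: m_assoc[symmetric] scalar_central[of c r u])
  then show "u \<otimes>\<^bsub>DK c\<^esub> (scalar r \<otimes>\<^bsub>DK c\<^esub> qconj u) = \<one>\<^bsub>DK c\<^esub>"
    using assms by (simp add: conj scalar_mult_scalar one_DK mult.commute)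
qed

lemma unit_DK:
  assumes "knorm u \<noteq> 0"
  shows "u \<in> Units (DK c)"
proof -
  have "knorm u * inverse (knorm u) = 1" using assms by simp
  from DK_inverse[OF this] show ?thesis unfolding Units_def by auto
qed

lemma unit_emb: "pnorm c U \<noteq> 0 \<Longrightarrow> emb U \<in> Units (DK c)"
  by (rule unit_DK) (simp add: knorm_emb)

lemma cls_closed: "u \<in> Units (DK c) \<Longrightarrow> cls c u \<in> carrier (GK c)"
  by (auto simp: cls_def GK_def FactGroup_def RCOSETS_def units_of_def)

text \<open>The field K is itself an admissible subring, and its order is D. This is that case of
  \<open>cls_eq_iff_order\<close>.\<close>

lemma cls_eq_iff:
  assumes "u \<in> Units (DK c)" "v \<in> Units (DK c)"
  shows "cls c u = cls c v \<longleftrightarrow> (\<exists>x. x \<noteq> 0 \<and> u = scalar x \<otimes>\<^bsub>DK c\<^esub> v)"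
proof -
  interpret K: ring "ring_of_type_algebra :: 'a poly fract ring" by (rule ring_from_type_algebra)
  have S: "subring (UNIV :: 'a poly fract set) ring_of_type_algebra"
    using K.carrier_is_subring by (simp add: ring_of_type_algebra_def)
  have "quat_order c UNIV = DK c" by (simp add: quat_order_def DK_def quat_alg_def)
  then have "cls c u = cls c v \<longleftrightarrow> (\<exists>r\<in>UNIV. \<exists>r'\<in>UNIV. r * r' = 1 \<and> u = scalar r \<otimes>\<^bsub>DK c\<^esub> v)"
    using assms by (intro cls_eq_iff_order[OF _ _ S]) simp_all
  moreover have "(\<exists>r'. r * r' = 1) \<longleftrightarrow> r \<noteq> 0" for r :: "'a poly fract"
    by (metis mult_zero_left right_inverse zero_neq_one)
  ultimately show ?thesis by blast
qed

lemma one_GK: "\<one>\<^bsub>GK c\<^esub> = cls c (scalar 1)"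
proof -
  interpret U: group "units_of (DK c)" by (rule group_units_DK)
  have "scalar 1 = \<one>\<^bsub>units_of (DK c)\<^esub>" by (simp add: units_of_def one_DK)
  moreover have "K_star #>\<^bsub>units_of (DK c)\<^esub> \<one>\<^bsub>units_of (DK c)\<^esub> = K_star"
    using K_star_Units by (intro U.coset_mult_one) (simp add: units_of_def)
  ultimately show ?thesis by (simp add: GK_def FactGroup_def cls_def)
qed

lemma cl_closed [simp]: "pnorm c U \<noteq> 0 \<Longrightarrow> cl U \<in> carrier (GK c)"
  unfolding cl_def by (intro cls_closed unit_emb)

lemma cl_mult: "pnorm c U \<noteq> 0 \<Longrightarrow> pnorm c V \<noteq> 0 \<Longrightarrow> cl U \<cdot> cl V = cl (pmul c U V)"
  unfolding cl_def emb_pmul by (intro cls_mult unit_emb)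

lemma emb_pscale: "emb (pscale h U) = scalar (to_fract h) \<otimes>\<^bsub>DK c\<^esub> emb U"
  by (cases U) (simp add: scalar_mult_DK)

lemma cl_pscale:
  assumes "h \<noteq> 0" "pnorm c U \<noteq> 0"
  shows "cl (pscale h U) = cl U"
proof -
  have "emb (pscale h U) \<in> Units (DK c)" "emb U \<in> Units (DK c)"
    using assms by (simp_all add: unit_emb pnorm_pscale)
  moreover have "to_fract h \<noteq> 0" using assms by simp
  ultimately show ?thesis
    using emb_pscale cls_eq_iff unfolding cl_def by blast
qed

text \<open>The factor of proportionality lies in K; its denominator is moved to the other side so
  that coordinates can be compared as polynomials.\<close>

lemma cl_eqE:
  assumes "cl U = cl V" "pnorm c U \<noteq> 0" "pnorm c V \<noteq> 0"
  obtains h k where "h \<noteq> 0" "k \<noteq> 0" "pscale h U = pscale k V"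
proof -
  obtain x where x: "x \<noteq> 0" "emb U = scalar x \<otimes>\<^bsub>DK c\<^esub> emb V"
    using assms(1) cls_eq_iff[OF unit_emb[OF assms(2)] unit_emb[OF assms(3)]]
    unfolding cl_def by blast
  obtain k h where "x = Fract k h" and h: "h \<noteq> 0" by (cases x rule: Fract_cases)
  then have kh: "x = to_fract k / to_fract h" "h \<noteq> 0" by (simp_all add: Fract_conv_to_fract)
  have "scalar (to_fract h) \<otimes>\<^bsub>DK c\<^esub> emb U = scalar (to_fract k) \<otimes>\<^bsub>DK c\<^esub> emb V"
  proof -
    interpret ring "DK c" by (rule ring_DK)
    have "to_fract h * x = to_fract k" using kh by simp
    moreover have "scalar (to_fract h) \<otimes>\<^bsub>DK c\<^esub> emb U =
        (scalar (to_fract h) \<otimes>\<^bsub>DK c\<^esub> scalar x) \<otimes>\<^bsub>DK c\<^esub> emb V"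
      unfolding x(2) by (rule m_assoc[symmetric]) simp_all
    ultimately show ?thesis by (simp only: scalar_mult_scalar)
  qed
  then have "emb (pscale h U) = emb (pscale k V)" by (simp only: emb_pscale)
  moreover have "inj (to_fract :: 'a poly \<Rightarrow> _)" by (simp add: inj_def)
  ultimately have "pscale h U = pscale k V" using injD[OF quat.inj_map] by blast
  moreover have "k \<noteq> 0" using x(1) unfolding kh(1) by auto
  ultimately show thesis using that h by blast
qed

lemma cl_scalar:
  assumes "h \<noteq> 0"
  shows "cl (Quat h 0 0 0) = \<one>\<^bsub>GK c\<^esub>"
proof -
  have "cl (pscale h (Quat 1 0 0 0)) = cl (Quat 1 0 0 0)" using assms by (rule cl_pscale) simp
  moreover have "emb (Quat 1 0 0 0) = scalar 1" by (simp add: scalar_def)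
  ultimately show ?thesis by (simp add: cl_def one_GK)
qed

lemma cl_eq_one:
  assumes "cl U = \<one>\<^bsub>GK c\<^esub>" "pnorm c U \<noteq> 0"
  obtains h where "U = Quat h 0 0 0"
proof -
  have eq: "cl U = cl (Quat 1 0 0 0)" using assms(1) by (simp add: cl_scalar)
  have nz: "pnorm c (Quat 1 0 0 0) \<noteq> 0" by simp
  obtain h k where hk: "h \<noteq> 0" "pscale h U = pscale k (Quat 1 0 0 0)"
    by (rule cl_eqE[OF eq assms(2) nz])
  obtain x y z w where U: "U = Quat x y z w" by (cases U)
  have "y = 0" "z = 0" "w = 0" using hk by (simp_all add: U)
  then show thesis using that U by blast
qed

abbreviation cq :: "'a alg_closure \<Rightarrow> 'a poly quat" where
  "cq w \<equiv> cquat (fst (co w)) (snd (co w))"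

text \<open>\<open>CC\<close>, \<open>GG\<close> and \<open>SS\<close> give the classes of w in
  F_q[Z], of \<gamma>_\<xi> and of F. With parameters in \<open>F2\<close> the relations between
  them become identities in a field.\<close>

definition CC :: "'a alg_closure \<Rightarrow> 'a poly fract quat set" where
  "CC w = cl (cq w)"

definition GG :: "'a alg_closure \<Rightarrow> 'a poly fract quat set" where
  "GG \<xi> = cl (gpoly (co \<xi>))"

definition SS :: "'a poly fract quat set" where
  "SS = cl (cquatF 1 0)"

lemma emb_cq: "emb (cq w) = zq w"
  by (simp add: cquat_def zq_def fq_def)

lemma CC_eq: "CC w = cls c (zq w)"
  by (simp add: CC_def cl_def emb_cq)

lemma SS_eq: "SS = cls c elF"
  by (simp add: SS_def cl_def cquatF_def elF_def one_pCons[symmetric])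

lemma gam_zq: "gam c (zq \<xi>) = emb (gpoly (co \<xi>))"
  by (simp add: gam_def zq_def gpoly_def elZ_def elF_def scalar_def DK_def quat_alg_def tK_def fq_def)

lemma GG_eq: "GG \<xi> = cls c (gam c (zq \<xi>))"
  by (simp add: GG_def cl_def gam_zq)

lemma pnorm_cq [simp]: "w \<in> F2 \<Longrightarrow> pnorm c (cq w) = 0 \<longleftrightarrow> w = 0"
  using nrm2_co_eq_0_iff by (simp add: pnorm_cquat)

lemma pnorm_gpoly_nonzero [simp]: "pnorm c (gpoly \<xi>) \<noteq> 0"
  by (auto simp: pnorm_gpoly)

lemma pnorm_cquatF_nonzero [simp]: "pnorm c (cquatF 1 0) \<noteq> 0"
  by (simp add: pnorm_cquatF nrm2_def)

lemma CC_closed [simp]: "w \<in> F2 \<Longrightarrow> w \<noteq> 0 \<Longrightarrow> CC w \<in> carrier (GK c)"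
  and GG_closed [simp]: "GG \<xi> \<in> carrier (GK c)"
  and SS_closed [simp]: "SS \<in> carrier (GK c)"
  by (simp_all add: CC_def GG_def SS_def)

lemma CC_mult:
  assumes "v \<in> F2" "v \<noteq> 0" "w \<in> F2" "w \<noteq> 0"
  shows "CC v \<cdot> CC w = CC (v * w)"
  using assms by (simp add: CC_eq cls_mult zq_inv zq_mult)

lemma CC_to_ac: "x \<noteq> 0 \<Longrightarrow> CC (to_ac x) = \<one>\<^bsub>GK c\<^esub>"
  using cl_scalar[of "[:x:]"] by (simp add: CC_eq cl_def zq_to_ac scalar_def fq_def)

text \<open>Since F w = w^q F, one has w (tZ + \<xi>F) = (tZ + \<xi> (w / w^q) F) w.\<close>

lemma CC_GG:
  assumes w: "w \<in> F2" "w \<noteq> 0" and \<xi>: "\<xi> \<in> F2"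
  shows "CC w \<cdot> GG \<xi> = GG (\<xi> * w / w ^ q) \<cdot> CC w"
proof -
  define \<eta> where "\<eta> = \<xi> * w / w ^ q"
  have \<eta>: "\<eta> \<in> F2" using w \<xi> by (simp add: \<eta>_def)
  obtain w1 w2 where w': "w = quad (w1, w2)" using w by (elim F2_cases)
  obtain p r where \<xi>': "\<xi> = quad (p, r)" using \<xi> by (elim F2_cases)
  obtain p' r' where \<eta>': "\<eta> = quad (p', r')" using \<eta> by (elim F2_cases)
  have co: "co w = (w1, w2)" "co \<xi> = (p, r)" "co \<eta> = (p', r')" by (simp_all add: w' \<xi>' \<eta>')
  have "w * \<xi> = \<eta> * w ^ q" using w by (simp add: \<eta>_def)
  then have "quad (w1 * p + c * w2 * r, w1 * r + w2 * p) = quad (p' * w1 - c * r' * w2, r' * w1 - p' * w2)"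
    unfolding w' \<xi>' \<eta>' quad_pow_q quad_mult by (simp add: algebra_simps)
  then have "(w1 * p + c * w2 * r, w1 * r + w2 * p) = (p' * w1 - c * r' * w2, r' * w1 - p' * w2)"
    by (rule injD[OF inj_quad])
  then have "pmul c (cq w) (gpoly (co \<xi>)) = pmul c (gpoly (co \<eta>)) (cq w)"
    by (simp add: co cquat_def gpoly_def algebra_simps)
  then show ?thesis
    using w unfolding \<eta>_def[symmetric] CC_def GG_def by (simp add: cl_mult)
qed

lemma SS_CC:
  assumes w: "w \<in> F2" "w \<noteq> 0"
  shows "SS \<cdot> CC w = CC (w ^ q) \<cdot> SS"
proof -
  obtain x y where w': "w = quad (x, y)" using w by (elim F2_cases)
  have wq: "w ^ q \<in> F2" "w ^ q \<noteq> 0" using w by auto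
  have "pmul c (cquatF 1 0) (cq w) = pmul c (cq (w ^ q)) (cquatF 1 0)"
    by (simp add: w' quad_pow_q cquat_def cquatF_def)
  then show ?thesis
    using w wq unfolding SS_def CC_def by (simp add: cl_mult)
qed

text \<open>F (tZ + \<xi>F) = -(tZ - \<xi>^q F) F, and the outer sign disappears in the
  class.\<close>

lemma SS_GG:
  assumes \<xi>: "\<xi> \<in> F2"
  shows "SS \<cdot> GG \<xi> = GG (- (\<xi> ^ q)) \<cdot> SS"
proof -
  obtain p r where \<xi>': "\<xi> = quad (p, r)" using \<xi> by (elim F2_cases)
  have "- (\<xi> ^ q) = quad (- p, r)" by (simp add: \<xi>' quad_pow_q) (simp add: quad_def)
  then have "pmul c (cquatF 1 0) (gpoly (co \<xi>)) = pscale (- 1) (pmul c (gpoly (co (- (\<xi> ^ q)))) (cquatF 1 0))"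
    by (simp add: \<xi>' gpoly_def cquatF_def)
  then have "cl (pmul c (cquatF 1 0) (gpoly (co \<xi>))) = cl (pmul c (gpoly (co (- (\<xi> ^ q)))) (cquatF 1 0))"
    by (simp add: cl_pscale qnorm_mult)
  then show ?thesis
    unfolding SS_def GG_def by (simp add: cl_mult)
qed

lemma GG_square: "GG \<xi> \<cdot> GG \<xi> = \<one>\<^bsub>GK c\<^esub>"
proof -
  have "pmul c (gpoly (co \<xi>)) (gpoly (co \<xi>)) = Quat (- pnorm c (gpoly (co \<xi>))) 0 0 0"
    unfolding gpoly_def vert_square ..
  then show ?thesis unfolding GG_def by (simp add: cl_mult cl_scalar)
qed

lemma SS_square: "SS \<cdot> SS = \<one>\<^bsub>GK c\<^esub>"
proof -
  have "pmul c (cquatF 1 0) (cquatF 1 0) = Quat [:0, - 1, 1:] 0 0 0" by (simp add: cquatF_def)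
  then show ?thesis unfolding SS_def by (simp add: cl_mult cl_scalar)
qed

lemma GG_commute:
  assumes F2: "\<xi> \<in> F2" "\<eta> \<in> F2" "\<xi>' \<in> F2" "\<eta>' \<in> F2"
    and "\<xi> * \<eta> ^ q = \<eta>' * \<xi>' ^ q" "\<eta> - \<xi> = \<xi>' - \<eta>'"
  shows "GG \<xi> \<cdot> GG \<eta> = GG \<eta>' \<cdot> GG \<xi>'"
proof -
  obtain p r where e1: "\<xi> = quad (p, r)" using F2(1) by (elim F2_cases)
  obtain p' r' where e2: "\<eta> = quad (p', r')" using F2(2) by (elim F2_cases)
  obtain p2' r2' where e3: "\<xi>' = quad (p2', r2')" using F2(3) by (elim F2_cases)
  obtain p2 r2 where e4: "\<eta>' = quad (p2, r2)" using F2(4) by (elim F2_cases)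
  note e = e1 e2 e3 e4
  have co: "co \<xi> = (p, r)" "co \<eta> = (p', r')" "co \<eta>' = (p2, r2)" "co \<xi>' = (p2', r2')"
    by (simp_all add: e)
  have "quad (p * p' - c * r * r', r * p' - p * r') = quad (p2 * p2' - c * r2 * r2', r2 * p2' - p2 * r2')"
    using assms(5) unfolding e quad_pow_q quad_mult by (simp add: algebra_simps)
  then have 1: "p * p' - c * r * r' = p2 * p2' - c * r2 * r2'" "r * p' - p * r' = r2 * p2' - p2 * r2'"
    by (auto dest: injD[OF inj_quad])
  have "quad (p' - p, r' - r) = quad (p2' - p2, r2' - r2)"
    using assms(6) unfolding e quad_diff .
  then have 2: "p' - p = p2' - p2" "r' - r = r2' - r2"
    by (auto dest: injD[OF inj_quad])
  have poly: "[:p:] * [:p':] - [:c:] * [:r:] * [:r':] = [:p2:] * [:p2':] - [:c:] * [:r2:] * [:r2':]"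
    "[:r:] * [:p':] - [:p:] * [:r':] = [:r2:] * [:p2':] - [:p2:] * [:r2':]"
    "[:p':] - [:p:] = [:p2':] - [:p2:]" "[:r':] - [:r:] = [:r2':] - [:r2:]"
    using 1 2 by (simp_all add: mult.commute)
  have "pmul c (gpoly (co \<xi>)) (gpoly (co \<eta>)) = pmul c (gpoly (co \<eta>')) (gpoly (co \<xi>'))"
    unfolding gpoly_def co fst_conv snd_conv by (rule vert_commute[OF poly])
  then show ?thesis unfolding GG_def by (simp add: cl_mult)
qed

end

section \<open>G(R) and G(R') described by the norms of polynomial representatives\<close>

section \<open>The groups of points\<close>

lemma ring_of_type_uminus:
  "\<ominus>\<^bsub>ring_of_type_algebra\<^esub> (x :: 'k::field) = - x"
proof -
  interpret K: ring "ring_of_type_algebra :: 'k ring" by (rule ring_from_type_algebra)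
  show ?thesis by (rule K.minus_equality) (simp_all add: ring_of_type_algebra_def)
qed

context finite_params
begin

text \<open>Fractions with a denominator t^i (t - 1)^j (t - \<tau>)^k. The flag \<open>J\<close>
  permits the factor t - 1: from here on \<open>True\<close> belongs to R and \<open>False\<close>
  to R', and both rings are treated at once.\<close>

definition localized :: "bool \<Rightarrow> 'a poly fract set" where
  "localized J = {x. \<exists>f i j k. (J \<or> j = 0) \<and> x * to_fract (Spoly \<tau> 1 i j k) = to_fract f}"

lemma Spoly_mult: "Spoly \<tau> a i j k * Spoly \<tau> a' i' j' k' = Spoly \<tau> (a * a') (i + i') (j + j') (k + k')"
  by (simp only: power_add mult_smult_left mult_smult_right smult_smult
      mult.assoc mult.left_commute mult.commute)

lemma localizedI: "J \<or> j = 0 \<Longrightarrow> x * to_fract (Spoly \<tau> 1 i j k) = to_fract f \<Longrightarrow> x \<in> localized J"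
  unfolding localized_def by (rule CollectI, intro exI conjI)

lemma localized_mult:
  assumes "x \<in> localized J" "y \<in> localized J"
  shows "x * y \<in> localized J"
proof -
  obtain f i j k where x: "J \<or> j = 0" "x * to_fract (Spoly \<tau> 1 i j k) = to_fract f"
    using assms(1) unfolding localized_def by blast
  obtain f' i' j' k' where y: "J \<or> j' = 0" "y * to_fract (Spoly \<tau> 1 i' j' k') = to_fract f'"
    using assms(2) unfolding localized_def by blast
  have "x * y * to_fract (Spoly \<tau> 1 (i + i') (j + j') (k + k')) =
      x * y * (to_fract (Spoly \<tau> 1 i j k) * to_fract (Spoly \<tau> 1 i' j' k'))"
    by (simp only: to_fract_mult[symmetric] Spoly_mult mult_1)
  also have "\<dots> = (x * to_fract (Spoly \<tau> 1 i j k)) * (y * to_fract (Spoly \<tau> 1 i' j' k'))"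
    by (simp only: mult.assoc mult.left_commute mult.commute)
  also have "\<dots> = to_fract (f * f')" by (simp only: x y to_fract_mult)
  finally show ?thesis by (rule localizedI[rotated]) (use x(1) y(1) in auto)
qed

lemma localized_add:
  assumes "x \<in> localized J" "y \<in> localized J"
  shows "x + y \<in> localized J"
proof -
  obtain f i j k where x: "J \<or> j = 0" "x * to_fract (Spoly \<tau> 1 i j k) = to_fract f"
    using assms(1) unfolding localized_def by blast
  obtain f' i' j' k' where y: "J \<or> j' = 0" "y * to_fract (Spoly \<tau> 1 i' j' k') = to_fract f'"
    using assms(2) unfolding localized_def by blast
  let ?h = "Spoly \<tau> 1 i j k" and ?h' = "Spoly \<tau> 1 i' j' k'"
  have "(x + y) * to_fract (Spoly \<tau> 1 (i + i') (j + j') (k + k')) = (x + y) * (to_fract ?h * to_fract ?h')"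
    by (simp only: to_fract_mult[symmetric] Spoly_mult mult_1)
  also have "\<dots> = (x * to_fract ?h) * to_fract ?h' + (y * to_fract ?h') * to_fract ?h"
    by (simp only: distrib_right mult.assoc mult.left_commute mult.commute)
  also have "\<dots> = to_fract (f * ?h' + f' * ?h)" by (simp only: x y to_fract_mult to_fract_add)
  finally show ?thesis by (rule localizedI[rotated]) (use x(1) y(1) in auto)
qed

lemma localized_poly: "to_fract f \<in> localized J"
proof (rule localizedI)
  show "J \<or> (0 :: nat) = 0" by simp
  show "to_fract f * to_fract (Spoly \<tau> 1 0 0 0) = to_fract f"
    by (simp only: power_0 mult_1 smult_1_left to_fract_1 mult_1_right)
qed

lemma localized_uminus: "x \<in> localized J \<Longrightarrow> - x \<in> localized J"
  using localized_mult[OF localized_poly[of "- 1"], of x] by simp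

lemma generate_ring_localized:
  assumes "x \<in> generate_ring ring_of_type_algebra B" "B \<subseteq> localized J"
  shows "x \<in> localized J"
  using assms(1)
proof induction
  case one
  then show ?case using localized_poly[of 1 J] by (simp add: ring_of_type_algebra_def)
next
  case (incl h)
  then show ?case using assms(2) by blast
next
  case (a_inv h)
  then show ?case by (simp add: ring_of_type_uminus localized_uminus)
next
  case (eng_add h1 h2)
  then show ?case by (simp add: ring_of_type_algebra_def localized_add)
next
  case (eng_mult h1 h2)
  then show ?case by (simp add: ring_of_type_algebra_def localized_mult)
qed

lemma ringR'_localized: "ringR' \<tau> \<subseteq> localized J"
proof
  fix x assume "x \<in> ringR' \<tau>"
  then show "x \<in> localized J"
    unfolding ringR'_def
  proof (rule generate_ring_localized)
    have "1 / (tK * (tK - fq \<tau>)) * to_fract (Spoly \<tau> 1 1 0 1) = to_fract 1"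
    proof -
      have "Spoly \<tau> 1 1 0 1 = [:0, 1:] * ([:0, 1:] - [:\<tau>:])" by simp
      then have "to_fract (Spoly \<tau> 1 1 0 1) = tK * (tK - fq \<tau>)"
        by (simp only: tK_def fq_def to_fract_mult to_fract_diff)
      moreover have "to_fract (Spoly \<tau> 1 1 0 1) \<noteq> 0" by simp
      ultimately show ?thesis by simp
    qed
    then have "1 / (tK * (tK - fq \<tau>)) \<in> localized J" by (rule localizedI[rotated]) simp
    then show "range fq \<union> {tK, 1 / (tK * (tK - fq \<tau>))} \<subseteq> localized J"
      using localized_poly by (auto simp: fq_def tK_def)
  qed
qed

lemma ringR_localized: "ringR \<tau> \<subseteq> localized True"
proof
  fix x assume "x \<in> ringR \<tau>"
  then show "x \<in> localized True"
    unfolding ringR_def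
  proof (rule generate_ring_localized)
    have "1 / (tK - 1) * to_fract (Spoly \<tau> 1 0 1 0) = to_fract 1"
    proof -
      have "Spoly \<tau> 1 0 1 0 = [:0, 1:] - 1" by (simp add: one_pCons)
      then have "to_fract (Spoly \<tau> 1 0 1 0) = tK - 1"
        by (simp only: tK_def to_fract_diff to_fract_1)
      moreover have "to_fract (Spoly \<tau> 1 0 1 0) \<noteq> 0" by simp
      ultimately show ?thesis by simp
    qed
    then have "1 / (tK - 1) \<in> localized True" by (rule localizedI[rotated]) simp
    then show "ringR' \<tau> \<union> {1 / (tK - 1)} \<subseteq> localized True" using ringR'_localized by auto
  qed
qed

definition denominators :: "bool \<Rightarrow> 'a poly fract set" where
  "denominators J = {to_fract (Spoly \<tau> 1 i j k) | i j k. J \<or> j = 0}"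

lemma denominators_mult:
  assumes "h \<in> denominators J" "h' \<in> denominators J"
  shows "h * h' \<in> denominators J"
proof -
  obtain i j k where h: "J \<or> j = 0" "h = to_fract (Spoly \<tau> 1 i j k)"
    using assms(1) unfolding denominators_def by blast
  obtain i' j' k' where h': "J \<or> j' = 0" "h' = to_fract (Spoly \<tau> 1 i' j' k')"
    using assms(2) unfolding denominators_def by blast
  have "h * h' = to_fract (Spoly \<tau> 1 (i + i') (j + j') (k + k'))"
    by (simp only: h h' to_fract_mult[symmetric] Spoly_mult mult_1)
  moreover have "J \<or> j + j' = 0" using h(1) h'(1) by auto
  ultimately show ?thesis unfolding denominators_def by blast
qed

lemma denominators_range: "h \<in> denominators J \<Longrightarrow> h \<in> range to_fract"
  unfolding denominators_def by blast

lemma range_to_fract_mult: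
  "x \<in> range to_fract \<Longrightarrow> y \<in> range to_fract \<Longrightarrow> x * y \<in> range to_fract"
  by (elim imageE) (simp only: to_fract_mult[symmetric] rangeI)

lemma localizedE:
  assumes "x \<in> localized J"
  obtains h where "h \<in> denominators J" "x * h \<in> range to_fract"
proof -
  obtain f i j k where "J \<or> j = 0" "x * to_fract (Spoly \<tau> 1 i j k) = to_fract f"
    using assms unfolding localized_def by blast
  then show thesis
    by (intro that[of "to_fract (Spoly \<tau> 1 i j k)"]) (unfold denominators_def, blast, simp only: rangeI)
qed

text \<open>A denominator for the coordinates treated so far is enlarged by a factor for one more
  coordinate. That this factor is a polynomial keeps the earlier coordinates polynomial.\<close>

lemma common_denominator2:
  assumes h: "h \<in> denominators J" "x * h \<in> range to_fract" and y: "y \<in> localized J"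
  obtains h' where "h * h' \<in> denominators J" "x * (h * h') \<in> range to_fract" "y * (h * h') \<in> range to_fract"
    "h' \<in> range to_fract"
proof -
  obtain h' where h': "h' \<in> denominators J" "y * h' \<in> range to_fract" using localizedE[OF y] .
  have "x * (h * h') = (x * h) * h'" "y * (h * h') = (y * h') * h"
    by (simp_all only: mult.assoc mult.commute[of h h'])
  moreover have "(x * h) * h' \<in> range to_fract" "(y * h') * h \<in> range to_fract"
    by (intro range_to_fract_mult h h' denominators_range[OF h(1)] denominators_range[OF h'(1)])+
  ultimately have "x * (h * h') \<in> range to_fract" "y * (h * h') \<in> range to_fract"
    by (simp_all only:)
  then show thesis
    by (rule that[OF denominators_mult[OF h(1) h'(1)] _ _ denominators_range[OF h'(1)]])
qed

lemma common_denominator: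
  assumes "set_quat u \<subseteq> localized J"
  obtains U i j k where "J \<or> j = 0" "scalar (to_fract (Spoly \<tau> 1 i j k)) \<otimes>\<^bsub>DK c\<^esub> u = emb U"
proof -
  obtain x y z w where u: "u = Quat x y z w" by (cases u)
  have loc: "x \<in> localized J" "y \<in> localized J" "z \<in> localized J" "w \<in> localized J"
    using assms by (simp_all add: u)
  obtain h0 where 0: "h0 \<in> denominators J" "x * h0 \<in> range to_fract" using localizedE[OF loc(1)] .
  obtain h1 where 1: "h0 * h1 \<in> denominators J" "x * (h0 * h1) \<in> range to_fract" "y * (h0 * h1) \<in> range to_fract"
    using common_denominator2[OF 0 loc(2)] .
  obtain h2 where 2: "h0 * h1 * h2 \<in> denominators J" "x * (h0 * h1 * h2) \<in> range to_fract"
    "z * (h0 * h1 * h2) \<in> range to_fract" "h2 \<in> range to_fract"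
    using common_denominator2[OF 1(1,2) loc(3)] .
  obtain h3 where 3: "h0 * h1 * h2 * h3 \<in> denominators J" "x * (h0 * h1 * h2 * h3) \<in> range to_fract"
    "w * (h0 * h1 * h2 * h3) \<in> range to_fract" "h3 \<in> range to_fract"
    using common_denominator2[OF 2(1,2) loc(4)] .
  let ?h = "h0 * h1 * h2 * h3"
  have "y * ?h = y * (h0 * h1) * h2 * h3" "z * ?h = z * (h0 * h1 * h2) * h3"
    by (simp_all only: mult.assoc)
  moreover have "y * (h0 * h1) * h2 * h3 \<in> range to_fract" "z * (h0 * h1 * h2) * h3 \<in> range to_fract"
    by (intro range_to_fract_mult 1(3) 2(3,4) 3(4))+
  ultimately have y: "y * ?h \<in> range to_fract" and z: "z * ?h \<in> range to_fract"
    by (simp_all only:)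
  obtain x' where "x * ?h = to_fract x'" using 3(2) by (rule imageE)
  moreover obtain y' where "y * ?h = to_fract y'" using y by (rule imageE)
  moreover obtain z' where "z * ?h = to_fract z'" using z by (rule imageE)
  moreover obtain w' where "w * ?h = to_fract w'" using 3(3) by (rule imageE)
  ultimately have "scalar ?h \<otimes>\<^bsub>DK c\<^esub> u = emb (Quat x' y' z' w')"
    by (simp only: u scalar_mult_DK quat.map mult.commute[of ?h])
  moreover obtain i j k where "J \<or> j = 0" "?h = to_fract (Spoly \<tau> 1 i j k)"
    using 3(1) unfolding denominators_def by blast
  ultimately show thesis by (intro that[of j i k]) (simp_all only:)
qed

text \<open>The groups of points in the form that the descent needs: the representative has
  polynomial coordinates, and its norm is composed of t, t - \<tau> and, for R, also t - 1.\<close>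

definition Gset :: "bool \<Rightarrow> 'a poly fract quat set set" where
  "Gset J = {cl U | U a i j k. a \<noteq> 0 \<and> (J \<or> j = 0) \<and> pnorm c U = Spoly \<tau> a i j k}"

text \<open>Denominators are cleared in a unit and in its inverse. As the norms of these two are
  inverse to each other, the norms of the resulting polynomial quaternions multiply to a product of
  squared denominators, so each of them is a divisor of the required kind.\<close>

lemma G_pts_subset:
  assumes S: "S \<subseteq> localized J"
  shows "G_pts c S \<subseteq> Gset J"
proof
  interpret ring "DK c" by (rule ring_DK)
  fix g assume "g \<in> G_pts c S"
  then obtain u where g: "g = cls c u" and u: "u \<in> Units (quat_order c S)"
    by (auto simp: G_pts_def)
  then obtain v where v: "set_quat u \<subseteq> S" "set_quat v \<subseteq> S" "u \<otimes>\<^bsub>DK c\<^esub> v = \<one>\<^bsub>DK c\<^esub>" "v \<otimes>\<^bsub>DK c\<^esub> u = \<one>\<^bsub>DK c\<^esub>"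
    by (auto simp: Units_def)
  obtain U i j k where U: "J \<or> j = 0" "scalar (to_fract (Spoly \<tau> 1 i j k)) \<otimes>\<^bsub>DK c\<^esub> u = emb U"
    using common_denominator[OF subset_trans[OF v(1) S]] .
  obtain V i' j' k' where V: "J \<or> j' = 0" "scalar (to_fract (Spoly \<tau> 1 i' j' k')) \<otimes>\<^bsub>DK c\<^esub> v = emb V"
    using common_denominator[OF subset_trans[OF v(2) S]] .
  let ?h = "Spoly \<tau> 1 i j k" and ?h' = "Spoly \<tau> 1 i' j' k'"
  have knorm_scalar: "knorm (scalar x) = x * x" for x by (simp add: scalar_def power2_eq_square)
  have "to_fract (pnorm c U * pnorm c V) = knorm (emb U) * knorm (emb V)"
    by (simp only: knorm_emb to_fract_mult)
  also have "\<dots> = (to_fract ?h * to_fract ?h) * (to_fract ?h' * to_fract ?h') * (knorm u * knorm v)"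
    unfolding U(2)[symmetric] V(2)[symmetric] knorm_mult knorm_scalar
    by (simp only: mult.assoc mult.left_commute mult.commute)
  also have "knorm u * knorm v = 1"
    unfolding knorm_mult[symmetric] v(3) one_DK knorm_scalar by simp
  finally have "to_fract (pnorm c U * pnorm c V) = to_fract (?h * ?h * (?h' * ?h'))"
    by (simp only: to_fract_mult mult_1_right)
  then have "pnorm c U * pnorm c V = ?h * ?h * (?h' * ?h')" by (simp only: to_fract_eq_iff)
  also have "\<dots> = Spoly \<tau> 1 (i + i + (i' + i')) (j + j + (j' + j')) (k + k + (k' + k'))"
    by (simp only: Spoly_mult mult_1)
  finally have eq: "pnorm c U * pnorm c V =
    Spoly \<tau> 1 (i + i + (i' + i')) (j + j + (j' + j')) (k + k + (k' + k'))" .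
  obtain a i1 j1 k1 where N: "a \<noteq> 0" "j1 \<le> j + j + (j' + j')" "pnorm c U = Spoly \<tau> a i1 j1 k1"
    by (rule Spoly_factor[OF eq one_neq_zero])
  have units: "u \<in> Units (DK c)" using v by (auto simp: Units_def)
  have "cls c (emb U) = cls c u"
  proof (subst cls_eq_iff)
    show "emb U \<in> Units (DK c)" using N by (intro unit_emb) simp
    have "to_fract ?h \<noteq> 0" by simp
    then show "\<exists>x. x \<noteq> 0 \<and> emb U = scalar x \<otimes>\<^bsub>DK c\<^esub> u" using U(2) by (intro exI[of _ "to_fract ?h"]) (simp only: simp_thms)
  qed (rule units)
  then have "g = cl U" by (simp add: g cl_def)
  moreover have "J \<or> j1 = 0" using U(1) V(1) N(2) by auto
  ultimately show "g \<in> Gset J"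
    unfolding Gset_def by (intro CollectI exI[of _ U] exI[of _ a] exI[of _ i1] exI[of _ j1] exI[of _ k1] conjI N)
qed

text \<open>The norm of the representative is a unit of S, hence its conjugate divided by its norm
  is an inverse with coordinates in S.\<close>

lemma G_pts_superset:
  assumes S: "subring S ring_of_type_algebra" and gens: "range fq \<subseteq> S" "tK \<in> S"
    and inv: "1 / tK \<in> S" "1 / (tK - fq \<tau>) \<in> S" "J \<Longrightarrow> 1 / (tK - 1) \<in> S"
  shows "Gset J \<subseteq> G_pts c S"
proof
  fix g assume "g \<in> Gset J"
  then obtain U a i j k where g: "g = cl U" and a: "a \<noteq> 0" and J: "J \<or> j = 0"
    and N: "pnorm c U = Spoly \<tau> a i j k"
    unfolding Gset_def by blast
  note cl = subring_closed[OF S]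
  have poly: "to_fract f \<in> S" for f :: "'a poly"
  proof (induction f)
    case (pCons x f)
    have "pCons x f = [:x:] + [:0, 1:] * f" by simp
    then have "to_fract (pCons x f) = fq x + tK * to_fract f"
      by (simp only: to_fract_add to_fract_mult fq_def tK_def)
    moreover have "fq x \<in> S" using gens by blast
    ultimately show ?case using pCons gens by (simp only: cl)
  qed (simp add: cl)
  have pow: "y ^ m \<in> S" if "y \<in> S" for y and m :: nat
    using that by (induction m) (simp_all add: cl)
  define r where "r = fq (inverse a) * ((1 / tK) ^ i * (1 / (tK - 1)) ^ j * (1 / (tK - fq \<tau>)) ^ k)"
  have "(1 / (tK - 1)) ^ j \<in> S"
    using J inv(3) pow cl(2) by (cases "j = 0") auto
  then have r: "r \<in> S"
  proof -
    have "fq (inverse a) \<in> S" using gens by blast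
    moreover assume "(1 / (tK - 1)) ^ j \<in> S"
    ultimately show ?thesis unfolding r_def by (intro cl(4) pow[OF inv(1)] pow[OF inv(2)])
  qed
  have lin: "to_fract [:- s, 1:] = tK - fq s" for s :: 'a
  proof -
    have "[:- s, 1:] = [:0, 1:] - [:s:]" by simp
    then show ?thesis by (simp only: tK_def fq_def to_fract_diff)
  qed
  have to_fract_pow: "to_fract (f ^ m) = to_fract f ^ m" for f :: "'a poly" and m
    by (induction m) simp_all
  have "smult a f = [:a:] * f" for f :: "'a poly" by simp
  then have kn: "knorm (emb U) = fq a * (tK ^ i * (tK - 1) ^ j * (tK - fq \<tau>) ^ k)"
    unfolding knorm_emb N
    using lin[of 1] lin[of \<tau>]
    by (simp only: to_fract_mult to_fract_pow fq_def[symmetric] tK_def[symmetric] fq_simps)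
  have nz: "tK \<noteq> (0 :: 'a poly fract)" "tK - 1 \<noteq> (0 :: 'a poly fract)" "tK - fq \<tau> \<noteq> 0"
  proof -
    have "to_fract [:- s, 1:] \<noteq> 0" for s :: 'a unfolding to_fract_eq_0_iff by simp
    then have "tK - fq s \<noteq> 0" for s :: 'a unfolding lin .
    from this[of 0] this[of 1] this[of \<tau>] show "tK \<noteq> (0 :: 'a poly fract)" "tK - 1 \<noteq> (0 :: 'a poly fract)" "tK - fq \<tau> \<noteq> 0"
      by (simp_all only: fq_simps diff_zero not_False_eq_True)
  qed
  have one: "x * (inverse a' * y) = 1" if "x = a' * z" "a' \<noteq> 0" "z * y = 1" for x y z a' :: "'a poly fract"
    using that by (simp add: mult.assoc mult.left_commute)
  have fqi: "fq (inverse a) = inverse (fq a)"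
    using a fq_simps(3)[of a "inverse a"] by (intro inverse_unique[symmetric]) (simp add: fq_simps)
  have "knorm (emb U) * r = 1"
    unfolding r_def fqi
  proof (rule one[OF kn])
    show "fq a \<noteq> 0" using a by (simp add: fq_def)
    show "tK ^ i * (tK - 1) ^ j * (tK - fq \<tau>) ^ k * ((1 / tK) ^ i * (1 / (tK - 1)) ^ j * (1 / (tK - fq \<tau>)) ^ k) = 1"
      using nz by (simp add: power_one_over)
  qed
  note inverse = DK_inverse[OF this]
  obtain x y z w where U: "U = Quat x y z w" by (cases U)
  have "set_quat (emb U) \<subseteq> S" using poly by (auto simp: U)
  moreover have "set_quat (scalar r \<otimes>\<^bsub>DK c\<^esub> qconj (emb U)) \<subseteq> S"
    using poly[of "- f" for f] poly r cl by (auto simp: U scalar_mult_DK simp del: to_fract_uminus simp flip: to_fract_uminus)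
  ultimately have "emb U \<in> Units (quat_order c S)"
    unfolding Units_def using inverse by auto
  then show "g \<in> G_pts c S" by (simp add: g cl_def G_pts_def)
qed

lemma G_pts_ringR': "G_pts c (ringR' \<tau>) = Gset False"
proof (rule equalityI[OF G_pts_subset[OF ringR'_localized] G_pts_superset[OF subring_ringR']])
  note cl = subring_closed[OF subring_ringR'[of \<tau>]]
  show "range fq \<subseteq> ringR' \<tau>" "tK \<in> ringR' \<tau>" using fq_tK_in_ringR' by auto
  have 1: "1 / (tK * (tK - fq \<tau>)) \<in> ringR' \<tau>"
    unfolding ringR'_def by (auto intro: generate_ring.incl)
  have nz: "tK - fq \<tau> \<noteq> 0" "tK \<noteq> (0 :: 'a poly fract)"
    unfolding tK_def fq_def to_fract_diff[symmetric] to_fract_eq_0_iff by simp_all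
  \<comment> \<open>Only the inverse of the product t(t - \<tau>) is a generator of the ring; the
    separate inverses arise by multiplying with the other factor.\<close>
  have "(tK - fq \<tau>) * (1 / (tK * (tK - fq \<tau>))) \<in> ringR' \<tau>"
    using 1 fq_tK_in_ringR' by (intro cl)
  then show "1 / tK \<in> ringR' \<tau>" using nz by simp
  have "tK * (1 / (tK * (tK - fq \<tau>))) \<in> ringR' \<tau>"
    using 1 fq_tK_in_ringR' by (intro cl)
  then show "1 / (tK - fq \<tau>) \<in> ringR' \<tau>" using nz by simp
qed simp

lemma G_pts_ringR: "G_pts c (ringR \<tau>) = Gset True"
proof (rule equalityI[OF G_pts_subset[OF ringR_localized] G_pts_superset[OF subring_ringR]])
  note cl = subring_closed[OF subring_ringR'[of \<tau>]]
  show "range fq \<subseteq> ringR \<tau>" "tK \<in> ringR \<tau>" using fq_tK_in_ringR by auto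
  have sub: "x \<in> ringR \<tau>" if "x \<in> ringR' \<tau>" for x
    unfolding ringR_def using that by (auto intro: generate_ring.incl)
  have 1: "1 / (tK * (tK - fq \<tau>)) \<in> ringR' \<tau>"
    unfolding ringR'_def by (auto intro: generate_ring.incl)
  have nz: "tK - fq \<tau> \<noteq> 0" "tK \<noteq> (0 :: 'a poly fract)"
    unfolding tK_def fq_def to_fract_diff[symmetric] to_fract_eq_0_iff by simp_all
  have "(tK - fq \<tau>) * (1 / (tK * (tK - fq \<tau>))) \<in> ringR' \<tau>"
    using 1 fq_tK_in_ringR' by (intro cl)
  then show "1 / tK \<in> ringR \<tau>" using nz sub by simp
  have "tK * (1 / (tK * (tK - fq \<tau>))) \<in> ringR' \<tau>"
    using 1 fq_tK_in_ringR' by (intro cl)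
  then show "1 / (tK - fq \<tau>) \<in> ringR \<tau>" using nz sub by simp
  show "1 / (tK - 1) \<in> ringR \<tau>" unfolding ringR_def by (auto intro: generate_ring.incl)
qed

interpretation G: group "GK c"
  by (rule group_GK)

lemma GsetI: "pnorm c U = Spoly \<tau> a i j k \<Longrightarrow> a \<noteq> 0 \<Longrightarrow> J \<or> j = 0 \<Longrightarrow> cl U \<in> Gset J"
  unfolding Gset_def
  by (rule CollectI, rule exI[of _ U], rule exI[of _ a], rule exI[of _ i], rule exI[of _ j],
      rule exI[of _ k]) (intro conjI HOL.refl)

lemma GsetE:
  assumes "g \<in> Gset J"
  obtains U a i j k where "g = cl U" "a \<noteq> 0" "J \<or> j = 0" "pnorm c U = Spoly \<tau> a i j k"
  using assms unfolding Gset_def by blast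

lemma Spoly_nonzero: "a \<noteq> 0 \<Longrightarrow> Spoly \<tau> a i j k \<noteq> 0"
  by simp

lemma CC_Gset [simp]: "w \<in> F2 \<Longrightarrow> w \<noteq> 0 \<Longrightarrow> CC w \<in> Gset J"
  unfolding CC_def by (rule GsetI[of _ "nrm2 c (co w)" 0 0 0]) (simp_all add: pnorm_cquat nrm2_co_eq_0_iff)

lemma SS_Gset [simp]: "SS \<in> Gset True"
  unfolding SS_def by (rule GsetI[of _ "- 1" 1 1 0]) (simp_all add: pnorm_cquatF nrm2_def)

definition verts :: "'a alg_closure set" where
  "verts = {\<xi> \<in> F2. co \<xi> \<in> vertsA \<union> vertsB}"

lemma vertsA_iff: "\<xi> \<in> F2 \<Longrightarrow> co \<xi> \<in> vertsA \<longleftrightarrow> \<xi> * \<xi> ^ q = to_ac (- c)"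
  unfolding mult_pow_q to_ac_eq_iff vertsA_def by simp

lemma vertsB_iff: "\<xi> \<in> F2 \<Longrightarrow> co \<xi> \<in> vertsB \<longleftrightarrow> \<xi> * \<xi> ^ q = to_ac (c * \<tau> / (1 - \<tau>))"
  unfolding mult_pow_q to_ac_eq_iff vertsB_def by simp

lemma GG_Gset [simp]:
  assumes "\<xi> \<in> verts"
  shows "GG \<xi> \<in> Gset J"
proof (cases "co \<xi> \<in> vertsA")
  case True
  then show ?thesis
    unfolding GG_def by (intro GsetI[of _ "- c" 1 0 0]) (simp_all add: pnorm_A)
next
  case False
  then have B: "co \<xi> \<in> vertsB" using assms by (simp add: verts_def)
  have "pnorm c (gpoly (co \<xi>)) = Spoly \<tau> (- c / (1 - \<tau>)) 1 0 1"
    unfolding pnorm_B[OF B] by simp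
  from GsetI[OF this] show ?thesis unfolding GG_def using \<tau> by simp
qed

lemma subgroup_Gset: "subgroup (Gset J) (GK c)"
proof (rule G.subgroupI)
  show "Gset J \<subseteq> carrier (GK c)"
  proof
    fix g assume "g \<in> Gset J"
    then obtain U a i j k where "g = cl U" "a \<noteq> 0" "pnorm c U = Spoly \<tau> a i j k" by (rule GsetE)
    then show "g \<in> carrier (GK c)" by simp
  qed
  have "CC 1 \<in> Gset J" by simp
  then show "Gset J \<noteq> {}" by blast
next
  fix g h assume "g \<in> Gset J" "h \<in> Gset J"
  then obtain U a i j k V a' i' j' k' where
    g: "g = cl U" "a \<noteq> 0" "J \<or> j = 0" "pnorm c U = Spoly \<tau> a i j k" and
    h: "h = cl V" "a' \<noteq> 0" "J \<or> j' = 0" "pnorm c V = Spoly \<tau> a' i' j' k'"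
    by (elim GsetE)
  have "g \<cdot> h = cl (pmul c U V)"
    unfolding g(1) h(1) using g(2) h(2) by (intro cl_mult) (simp_all add: g(4) h(4))
  moreover have "pnorm c (pmul c U V) = Spoly \<tau> (a * a') (i + i') (j + j') (k + k')"
    unfolding qnorm_mult g(4) h(4) by (rule Spoly_mult)
  moreover have "J \<or> j + j' = 0" using g(3) h(3) by auto
  ultimately show "g \<cdot> h \<in> Gset J" using GsetI g(2) h(2) by simp
next
  fix g assume "g \<in> Gset J"
  then obtain U a i j k where
    g: "g = cl U" "a \<noteq> 0" "J \<or> j = 0" "pnorm c U = Spoly \<tau> a i j k" by (rule GsetE)
  have nz: "pnorm c U \<noteq> 0" unfolding g(4) using g(2) by (rule Spoly_nonzero)
  have "inv\<^bsub>GK c\<^esub> g = cl (qconj U)"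
  proof (rule G.inv_equality)
    show "cl (qconj U) \<cdot> g = \<one>\<^bsub>GK c\<^esub>"
      unfolding g(1) using nz by (simp add: cl_mult qconj_mult cl_scalar)
  qed (use nz g in simp_all)
  then show "inv\<^bsub>GK c\<^esub> g \<in> Gset J" using GsetI[of "qconj U" a i j k J] g by simp
qed

text \<open>The descent read backwards in the group: each \<open>GG \<xi>\<close> is an involution,
  so undoing a descent step is again a left multiplication by the same element.\<close>

lemma Gset_induct [consumes 1, case_names CC CC_SS GG]:
  assumes g: "g \<in> Gset J"
    and CC: "\<And>w. w \<in> F2 \<Longrightarrow> w \<noteq> 0 \<Longrightarrow> CC w \<in> T"
    and CC_SS: "\<And>w. J \<Longrightarrow> w \<in> F2 \<Longrightarrow> w \<noteq> 0 \<Longrightarrow> CC w \<cdot> SS \<in> T"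
    and GG: "\<And>\<xi> t. \<xi> \<in> verts \<Longrightarrow> t \<in> carrier (GK c) \<Longrightarrow> t \<in> T \<Longrightarrow> GG \<xi> \<cdot> t \<in> T"
  shows "g \<in> T"
proof -
  obtain U a i j k where g: "g = cl U" "a \<noteq> 0" "J \<or> j = 0" "pnorm c U = Spoly \<tau> a i j k"
    using g by (rule GsetE)
  have "cl U \<in> T"
  proof (rule descent[where Q = "\<lambda>U. cl U \<in> T", OF _ _ _ _ g(2,4)])
    fix x y :: 'a assume xy: "(x, y) \<noteq> (0, 0)"
    have w: "quad (x, y) \<in> F2" "quad (x, y) \<noteq> 0" using xy by (simp_all add: quad_eq_0_iff)
    have "CC (quad (x, y)) = cl (cquat x y)" by (simp add: CC_def)
    then show "cl (cquat x y) \<in> T" using CC[OF w] by simp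
    assume "odd j"
    \<comment> \<open>For R' the exponent j is 0, so a descent from G(R') never ends at a multiple
      of F.\<close>
    then have J: J using g(3) by (cases J) auto
    have "pmul c (cquat x y) (cquatF 1 0) = cquatF x y" by (simp add: cquat_def cquatF_def)
    moreover have "pnorm c (cquat x y) \<noteq> 0" using xy nrm2_eq_0_iff by (simp add: pnorm_cquat)
    ultimately have "CC (quad (x, y)) \<cdot> SS = cl (cquatF x y)"
      by (simp add: CC_def SS_def cl_mult)
    then show "cl (cquatF x y) \<in> T" using CC_SS[OF J w] by simp
  next
    fix h :: "'a poly" and U assume "h \<noteq> 0" "pnorm c U \<noteq> 0" "cl U \<in> T"
    then show "cl (pscale h U) \<in> T" by (simp add: cl_pscale)
  next
    fix \<xi> U assume \<xi>: "\<xi> \<in> vertsA \<union> vertsB" and U: "pnorm c U \<noteq> 0" and T: "cl (pmul c (gpoly \<xi>) U) \<in> T"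
    have \<xi>': "quad \<xi> \<in> verts" "GG (quad \<xi>) = cl (gpoly \<xi>)" using \<xi> by (simp_all add: verts_def GG_def)
    have eq: "cl (pmul c (gpoly \<xi>) U) = GG (quad \<xi>) \<cdot> cl U"
      using U by (simp add: \<xi>' cl_mult)
    have "GG (quad \<xi>) \<cdot> (GG (quad \<xi>) \<cdot> cl U) \<in> T"
      using GG[OF \<xi>'(1) _ T] U unfolding eq by simp
    moreover have "GG (quad \<xi>) \<cdot> (GG (quad \<xi>) \<cdot> cl U) = cl U"
      using U by (simp add: G.m_assoc[symmetric] GG_square)
    ultimately show "cl U \<in> T" by simp
  qed
  then show ?thesis by (simp add: g(1))
qed

lemma verts_F2: "\<xi> \<in> verts \<Longrightarrow> \<xi> \<in> F2"
  by (simp add: verts_def)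

lemma norm_twist:
  assumes "w \<in> F2" "w \<noteq> 0" "\<xi> \<in> F2"
  shows "(\<xi> * w / w ^ q) * (\<xi> * w / w ^ q) ^ q = \<xi> * \<xi> ^ q"
  using assms by (simp add: power_mult_distrib power_divide)

lemma verts_cong:
  assumes "\<xi> \<in> verts" "\<eta> \<in> F2" "\<eta> * \<eta> ^ q = \<xi> * \<xi> ^ q"
  shows "\<eta> \<in> verts"
proof -
  have "co \<eta> \<in> vertsA \<longleftrightarrow> co \<xi> \<in> vertsA" "co \<eta> \<in> vertsB \<longleftrightarrow> co \<xi> \<in> vertsB"
    using assms(1) by (simp_all only: vertsA_iff vertsB_iff assms(2,3) verts_F2)
  then show ?thesis using assms(1,2) unfolding verts_def by blast
qed

lemma verts_twist: "\<xi> \<in> verts \<Longrightarrow> w \<in> F2 \<Longrightarrow> w \<noteq> 0 \<Longrightarrow> \<xi> * w / w ^ q \<in> verts"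
  by (rule verts_cong[OF _ _ norm_twist]) (simp_all add: verts_F2)

lemma uminus_pow_q: "v \<in> F2 \<Longrightarrow> (- v) ^ q = - (v ^ q)"
  using frobenius_diff[of 0 v] frobenius_diff[of 0 0] by simp

lemma verts_bar: "\<xi> \<in> verts \<Longrightarrow> - (\<xi> ^ q) \<in> verts"
  by (rule verts_cong) (simp_all add: verts_F2 uminus_pow_q mult.commute)

lemma CC_uminus: "w \<in> F2 \<Longrightarrow> w \<noteq> 0 \<Longrightarrow> CC (- w) = CC w"
  using CC_mult[of "to_ac (- 1)" w] CC_to_ac[of "- 1"] by simp

section \<open>Normality of \<Gamma> and its intersection with the stabilizer\<close>

section \<open>The group \<open>\<Gamma>\<close>\<close>

definition Gamma_gens :: "'a poly fract quat set set" where
  "Gamma_gens = (\<lambda>\<xi>. GG \<xi> \<cdot> CC \<iota>) ` verts"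

lemma Gamma_gens_closed: "Gamma_gens \<subseteq> carrier (GK c)"
  by (auto simp: Gamma_gens_def)

lemma Gamma_eq: "Gamma c \<tau> = generate (GK c) Gamma_gens"
proof -
  have norm: "nrm c (zq v) = scalar (fq x) \<longleftrightarrow> nrm2 c (co v) = x" if "v \<in> F2" for v x
    using that by (simp add: zq_nrm scalar_def)
  have "cls c (gam c (zq v) \<otimes>\<^bsub>DK c\<^esub> elZ) = GG v \<cdot> CC \<iota>" if "v \<in> F2" for v
    unfolding GG_eq CC_eq zq_\<iota> gam_zq by (rule cls_mult[symmetric]) (simp_all add: unit_emb zq_inv)
  note gen = this
  have eq: "{cls c (gam c \<xi> \<otimes>\<^bsub>DK c\<^esub> elZ) | \<xi>. \<xi> \<in> FqZ \<and> nrm c \<xi> = scalar (fq x)} =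
      (\<lambda>\<xi>. GG \<xi> \<cdot> CC \<iota>) ` {\<xi> \<in> F2. nrm2 c (co \<xi>) = x}" (is "?l = ?r") for x
  proof (intro equalityI subsetI)
    fix g assume "g \<in> ?l"
    then obtain \<xi> where "g = cls c (gam c \<xi> \<otimes>\<^bsub>DK c\<^esub> elZ)" "\<xi> \<in> FqZ" "nrm c \<xi> = scalar (fq x)"
      by blast
    moreover from this obtain v where v: "v \<in> F2" "\<xi> = zq v" unfolding FqZ_eq by blast
    ultimately show "g \<in> ?r" using gen[OF v(1)] norm[OF v(1)] by simp
  next
    fix g assume "g \<in> ?r"
    then obtain v where v: "v \<in> F2" "nrm2 c (co v) = x" "g = GG v \<cdot> CC \<iota>" by blast
    have "zq v \<in> FqZ" unfolding FqZ_eq using v(1) by (rule imageI)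
    moreover have "nrm c (zq v) = scalar (fq x)" using norm[OF v(1)] v(2) by blast
    moreover have "g = cls c (gam c (zq v) \<otimes>\<^bsub>DK c\<^esub> elZ)" using gen[OF v(1)] v(3) by simp
    ultimately show "g \<in> ?l" by blast
  qed
  show ?thesis
    unfolding Gamma_def eq image_Un[symmetric] Gamma_gens_def verts_def vertsA_def vertsB_def
    by (rule arg_cong[of _ _ "\<lambda>V. generate (GK c) ((\<lambda>\<xi>. GG \<xi> \<cdot> CC \<iota>) ` V)"]) auto
qed

lemma subgroup_Gamma: "subgroup (Gamma c \<tau>) (GK c)"
  unfolding Gamma_eq by (rule G.generate_is_subgroup[OF Gamma_gens_closed])

lemma Gamma_subset: "Gamma c \<tau> \<subseteq> Gset J"
  unfolding Gamma_eq
proof (rule G.generate_subgroup_incl[OF _ subgroup_Gset])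
  show "Gamma_gens \<subseteq> Gset J"
    using subgroup.m_closed[OF subgroup_Gset] by (auto simp: Gamma_gens_def)
qed

text \<open>The elements of \<open>\<Gamma>\<close> have representatives that become a nonzero scalar modulo $F$ at the ramified
  place $t = 1$, which no element of \<open>\<Delta>\<close> but the identity does.\<close>

definition scalar_at_1 :: "'a poly quat \<Rightarrow> bool" where
  "scalar_at_1 U \<longleftrightarrow> pnorm c U \<noteq> 0 \<and> (\<exists>x y z w. U = Quat x y z w \<and> poly x 1 \<noteq> 0 \<and> poly y 1 = 0)"

text \<open>As t(t - 1) vanishes at 1, the first two coordinates at t = 1 multiply like elements of
  F_q[Z]. For a generator, (tZ + \<xi>F) Z = ct - \<xi>ZF, and these coordinates are c and
  0.\<close>

lemma Gamma_scalar_at_1: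
  assumes "g \<in> Gamma c \<tau>"
  obtains U where "g = cl U" "scalar_at_1 U"
proof -
  have mult: "scalar_at_1 (pmul c U V)" if "scalar_at_1 U" "scalar_at_1 V" for U V
    using that unfolding scalar_at_1_def by (auto simp: qnorm_mult)
  have conj: "scalar_at_1 (qconj U)" if "scalar_at_1 U" for U
    using that unfolding scalar_at_1_def by auto
  have gens: "\<exists>U. GG \<xi> \<cdot> CC \<iota> = cl U \<and> scalar_at_1 U" for \<xi>
  proof -
    have "co \<iota> = (0, 1)" using co_quad[of "(0, 1)"] by (simp add: quad_def)
    then have "\<exists>x y z w. pmul c (gpoly (co \<xi>)) (cq \<iota>) = Quat x y z w \<and> poly x 1 \<noteq> 0 \<and> poly y 1 = 0"
      by (simp add: gpoly_def cquat_def)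
    moreover have "pnorm c (pmul c (gpoly (co \<xi>)) (cq \<iota>)) \<noteq> 0" unfolding qnorm_mult by simp
    ultimately have "scalar_at_1 (pmul c (gpoly (co \<xi>)) (cq \<iota>))" unfolding scalar_at_1_def by blast
    moreover have "GG \<xi> \<cdot> CC \<iota> = cl (pmul c (gpoly (co \<xi>)) (cq \<iota>))"
      by (simp add: GG_def CC_def cl_mult)
    ultimately show ?thesis by blast
  qed
  have inv: "inv\<^bsub>GK c\<^esub> cl U = cl (qconj U)" if "scalar_at_1 U" for U
  proof (rule G.inv_equality)
    have nz: "pnorm c U \<noteq> 0" using that by (simp add: scalar_at_1_def)
    then show "cl (qconj U) \<cdot> cl U = \<one>\<^bsub>GK c\<^esub>" by (simp add: cl_mult qconj_mult cl_scalar)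
    show "cl U \<in> carrier (GK c)" "cl (qconj U) \<in> carrier (GK c)" using nz by simp_all
  qed
  have "\<exists>U. g = cl U \<and> scalar_at_1 U"
    using assms unfolding Gamma_eq
  proof induction
    case one
    have "scalar_at_1 (Quat 1 0 0 0)" by (simp add: scalar_at_1_def)
    then show ?case using cl_scalar[OF one_neq_zero, symmetric] by blast
  next
    case (incl h)
    then show ?case using gens by (auto simp: Gamma_gens_def)
  next
    case (inv h)
    then obtain U where "h = cl U" "scalar_at_1 U" using gens by (auto simp: Gamma_gens_def)
    then show ?case using conj \<open>\<And>U. scalar_at_1 U \<Longrightarrow> inv\<^bsub>GK c\<^esub> cl U = cl (qconj U)\<close> by metis
  next
    case (eng h1 h2)
    then obtain U V where UV: "h1 = cl U" "scalar_at_1 U" "h2 = cl V" "scalar_at_1 V" by metis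
    then have "h1 \<cdot> h2 = cl (pmul c U V)"
      unfolding UV(1,3) by (intro cl_mult) (simp_all add: scalar_at_1_def)
    then show ?case using mult UV by metis
  qed
  then show thesis using that by blast
qed

lemma CC_SS_cl:
  assumes "w \<in> F2" "w \<noteq> 0"
  shows "CC w \<cdot> SS = cl (cquatF (fst (co w)) (snd (co w)))"
proof -
  have "pmul c (cq w) (cquatF 1 0) = cquatF (fst (co w)) (snd (co w))" by (simp add: cquat_def cquatF_def)
  then show ?thesis using assms by (simp add: CC_def SS_def cl_mult)
qed

lemma Gamma_Int_CC:
  assumes "w \<in> F2" "w \<noteq> 0"
  shows "CC w \<in> Gamma c \<tau> \<Longrightarrow> CC w = \<one>\<^bsub>GK c\<^esub>" "CC w \<cdot> SS \<notin> Gamma c \<tau>"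
proof -
  assume "CC w \<in> Gamma c \<tau>"
  then obtain U where U: "CC w = cl U" "scalar_at_1 U" by (rule Gamma_scalar_at_1)
  then obtain x y z v where Q: "U = Quat x y z v" "poly x 1 \<noteq> 0" "poly y 1 = 0" "pnorm c U \<noteq> 0"
    by (auto simp: scalar_at_1_def)
  obtain h k where hk: "h \<noteq> 0" "k \<noteq> 0" "pscale h (cq w) = pscale k U"
    using cl_eqE[of "cq w" U] U Q(4) assms by (auto simp: CC_def)
  obtain w1 w2 where w: "co w = (w1, w2)" by (cases "co w")
  have e: "h * [:w1:] = k * x" "h * [:w2:] = k * y" using hk(3) by (simp_all add: Q cquat_def w)
  have "w2 = 0"
  proof (rule ccontr)
    assume "w2 \<noteq> 0"
    \<comment> \<open>The factors h and k may vanish at 1, so they are eliminated by cross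
      multiplication before evaluating there.\<close>
    have "(h * [:w1:]) * [:w2:] = (h * [:w2:]) * [:w1:]" by (simp only: mult.assoc mult.left_commute mult.commute)
    then have "k * (x * [:w2:]) = k * (y * [:w1:])" unfolding e mult.assoc .
    then have "x * [:w2:] = y * [:w1:]" using hk(2) unfolding mult_cancel_left by blast
    then have "poly (x * [:w2:]) 1 = poly (y * [:w1:]) 1" by (simp only:)
    then show False using Q \<open>w2 \<noteq> 0\<close> by simp
  qed
  then have "w = to_ac w1" using w quad_co[OF assms(1)] by (simp add: quad_def)
  then show "CC w = \<one>\<^bsub>GK c\<^esub>" using assms(2) by (simp add: CC_to_ac)
next
  show "CC w \<cdot> SS \<notin> Gamma c \<tau>"
  proof
    let ?V = "cquatF (fst (co w)) (snd (co w))"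
    assume "CC w \<cdot> SS \<in> Gamma c \<tau>"
    then obtain U where U: "CC w \<cdot> SS = cl U" "scalar_at_1 U" by (rule Gamma_scalar_at_1)
    then obtain x y z v where Q: "U = Quat x y z v" "poly x 1 \<noteq> 0" "poly y 1 = 0" "pnorm c U \<noteq> 0"
      by (auto simp: scalar_at_1_def)
    have "pnorm c ?V \<noteq> 0" using assms nrm2_co_eq_0_iff by (simp add: pnorm_cquatF)
    then obtain h k where hk: "h \<noteq> 0" "k \<noteq> 0" "pscale h ?V = pscale k U"
      using cl_eqE[of ?V U] U Q(4) CC_SS_cl[OF assms] by auto
    then have "k * x = 0" by (simp add: Q cquatF_def)
    then show False using hk(2) Q(2) by simp
  qed
qed

text \<open>Conjugation by g is asked to map \<Gamma> into itself. This inclusion is stable under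
  products, which is how the induction over \<open>Gset\<close> builds its elements, and it is the
  form in which normality is verified.\<close>

definition normalizer_Gamma :: "'a poly fract quat set set" where
  "normalizer_Gamma =
     {g \<in> carrier (GK c). \<forall>x\<in>Gamma c \<tau>. g \<cdot> x \<cdot> inv\<^bsub>GK c\<^esub> g \<in> Gamma c \<tau>}"

lemma Gamma_closed: "x \<in> Gamma c \<tau> \<Longrightarrow> x \<in> carrier (GK c)"
  using subgroup.mem_carrier[OF subgroup_Gamma] .

lemma normalizer_Gamma_mult:
  assumes "g \<in> normalizer_Gamma" "h \<in> normalizer_Gamma"
  shows "g \<cdot> h \<in> normalizer_Gamma"
proof -
  have c: "g \<in> carrier (GK c)" "h \<in> carrier (GK c)" using assms by (simp_all add: normalizer_Gamma_def)
  have "g \<cdot> h \<cdot> x \<cdot> inv\<^bsub>GK c\<^esub> (g \<cdot> h) =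
      g \<cdot> (h \<cdot> x \<cdot> inv\<^bsub>GK c\<^esub> h) \<cdot> inv\<^bsub>GK c\<^esub> g" if "x \<in> carrier (GK c)" for x
    using that c by (simp add: G.m_assoc G.inv_mult_group)
  then show ?thesis
    using assms c Gamma_closed unfolding normalizer_Gamma_def by simp
qed

lemma Gamma_subset_normalizer: "Gamma c \<tau> \<subseteq> normalizer_Gamma"
  using subgroup.m_closed[OF subgroup_Gamma] subgroup.m_inv_closed[OF subgroup_Gamma] Gamma_closed
  unfolding normalizer_Gamma_def by blast

lemma normalizer_GammaI:
  assumes g: "g \<in> carrier (GK c)"
    and gens: "\<And>\<xi>. \<xi> \<in> verts \<Longrightarrow> \<exists>\<eta>\<in>verts. g \<cdot> (GG \<xi> \<cdot> CC \<iota>) = GG \<eta> \<cdot> CC \<iota> \<cdot> g"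
  shows "g \<in> normalizer_Gamma"
proof -
  have gen: "g \<cdot> x \<cdot> inv\<^bsub>GK c\<^esub> g \<in> Gamma c \<tau>" if "x \<in> Gamma_gens" for x
  proof -
    obtain \<xi> where \<xi>: "\<xi> \<in> verts" "x = GG \<xi> \<cdot> CC \<iota>" using \<open>x \<in> Gamma_gens\<close> unfolding Gamma_gens_def by blast
    obtain \<eta> where \<eta>: "\<eta> \<in> verts" "g \<cdot> x = GG \<eta> \<cdot> CC \<iota> \<cdot> g"
      using gens[OF \<xi>(1)] unfolding \<xi>(2) by blast
    have "g \<cdot> x \<cdot> inv\<^bsub>GK c\<^esub> g = GG \<eta> \<cdot> CC \<iota>"
      unfolding \<eta>(2) using g by (simp add: G.m_assoc)
    then show ?thesis
      unfolding Gamma_eq using \<eta>(1) by (auto simp: Gamma_gens_def intro: generate.incl)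
  qed
  have "g \<cdot> x \<cdot> inv\<^bsub>GK c\<^esub> g \<in> Gamma c \<tau>" if "x \<in> Gamma c \<tau>" for x
    using that unfolding Gamma_eq
  proof induction
    case one
    then show ?case using g by (simp add: generate.one)
  next
    case (incl h)
    then show ?case using gen unfolding Gamma_eq by blast
  next
    case (inv h)
    then have h: "h \<in> carrier (GK c)" using Gamma_gens_closed by blast
    have "g \<cdot> inv\<^bsub>GK c\<^esub> h \<cdot> inv\<^bsub>GK c\<^esub> g = inv\<^bsub>GK c\<^esub> (g \<cdot> h \<cdot> inv\<^bsub>GK c\<^esub> g)"
      using g h by (simp add: G.m_assoc G.inv_mult_group)
    then show ?case
      using gen[OF inv] subgroup.m_inv_closed[OF subgroup_Gamma] unfolding Gamma_eq by metis
  next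
    case (eng h1 h2)
    have h: "h1 \<in> carrier (GK c)" "h2 \<in> carrier (GK c)"
      using eng G.generate_in_carrier[OF Gamma_gens_closed] by blast+
    have "g \<cdot> (h1 \<cdot> h2) \<cdot> inv\<^bsub>GK c\<^esub> g =
        (g \<cdot> h1 \<cdot> inv\<^bsub>GK c\<^esub> g) \<cdot> (g \<cdot> h2 \<cdot> inv\<^bsub>GK c\<^esub> g)"
      using g h by (simp add: G.m_assoc) (simp add: G.m_assoc[symmetric])
    then show ?case using eng generate.eng by metis
  qed
  then show ?thesis using g by (simp add: normalizer_Gamma_def)
qed

text \<open>w commutes with Z, and the twist of \<xi> by w / w^q keeps the norm of \<xi>.\<close>

lemma CC_normalizer:
  assumes w: "w \<in> F2" "w \<noteq> 0"
  shows "CC w \<in> normalizer_Gamma"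
proof (rule normalizer_GammaI)
  fix \<xi> assume \<xi>: "\<xi> \<in> verts"
  have "CC w \<cdot> (GG \<xi> \<cdot> CC \<iota>) = CC w \<cdot> GG \<xi> \<cdot> CC \<iota>"
    using w by (simp add: G.m_assoc)
  also have "\<dots> = GG (\<xi> * w / w ^ q) \<cdot> (CC w \<cdot> CC \<iota>)"
    unfolding CC_GG[OF w verts_F2[OF \<xi>]] using w by (simp add: G.m_assoc)
  also have "CC w \<cdot> CC \<iota> = CC \<iota> \<cdot> CC w"
    using w by (simp add: CC_mult mult.commute)
  finally show "\<exists>\<eta>\<in>verts. CC w \<cdot> (GG \<xi> \<cdot> CC \<iota>) = GG \<eta> \<cdot> CC \<iota> \<cdot> CC w"
    using verts_twist[OF \<xi> w] w by (auto simp: G.m_assoc)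
qed (use w in simp)

text \<open>F changes the sign of Z, which is invisible modulo scalars, and -\<xi>^q has the norm of
  \<xi>.\<close>

lemma SS_normalizer: "SS \<in> normalizer_Gamma"
proof (rule normalizer_GammaI)
  fix \<xi> assume \<xi>: "\<xi> \<in> verts"
  have "SS \<cdot> (GG \<xi> \<cdot> CC \<iota>) = SS \<cdot> GG \<xi> \<cdot> CC \<iota>"
    by (simp add: G.m_assoc)
  also have "\<dots> = GG (- (\<xi> ^ q)) \<cdot> (SS \<cdot> CC \<iota>)"
    unfolding SS_GG[OF verts_F2[OF \<xi>]] by (simp add: G.m_assoc)
  also have "SS \<cdot> CC \<iota> = CC \<iota> \<cdot> SS"
    using SS_CC[of \<iota>] by (simp add: frobenius_\<iota> CC_uminus)
  finally show "\<exists>\<eta>\<in>verts. SS \<cdot> (GG \<xi> \<cdot> CC \<iota>) = GG \<eta> \<cdot> CC \<iota> \<cdot> SS"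
    using verts_bar[OF \<xi>] by (auto simp: G.m_assoc)
qed simp

text \<open>The generators of \<Gamma> are the \<gamma>_\<xi> Z, so \<gamma>_\<xi> is such a
  generator times the class of the inverse of Z, an element of the stabilizer.\<close>

lemma GG_eq_Gamma: "\<xi> \<in> verts \<Longrightarrow> GG \<xi> = GG \<xi> \<cdot> CC \<iota> \<cdot> CC (inverse \<iota>)"
  using CC_to_ac[of 1] by (simp add: G.m_assoc CC_mult)

lemma Gamma_gen_mem: "\<xi> \<in> verts \<Longrightarrow> GG \<xi> \<cdot> CC \<iota> \<in> Gamma c \<tau>"
  unfolding Gamma_eq by (rule generate.incl) (simp add: Gamma_gens_def)

lemma Gset_normalizer:
  assumes "g \<in> Gset J"
  shows "g \<in> normalizer_Gamma"
  using assms
proof (induction rule: Gset_induct)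
  case (GG \<xi> t)
  have "GG \<xi> \<cdot> CC \<iota> \<in> normalizer_Gamma"
    using Gamma_gen_mem[OF GG(1)] Gamma_subset_normalizer by blast
  then have "GG \<xi> \<cdot> CC \<iota> \<cdot> CC (inverse \<iota>) \<in> normalizer_Gamma"
    by (rule normalizer_Gamma_mult) (rule CC_normalizer, simp_all)
  then have "GG \<xi> \<in> normalizer_Gamma" unfolding GG_eq_Gamma[OF GG(1), symmetric] .
  then show ?case using GG(3) by (rule normalizer_Gamma_mult)
qed (auto intro!: CC_normalizer SS_normalizer normalizer_Gamma_mult)

text \<open>The elements of \<Delta> or, for R', of the cyclic group generated by d, listed
  explicitly: no generator \<delta> is fixed yet. That this is a subgroup follows later from
  \<open>generate_Hset\<close>.\<close>

definition Hset :: "bool \<Rightarrow> 'a poly fract quat set set" where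
  "Hset J = CC ` (F2 - {0}) \<union> (if J then (\<lambda>w. CC w \<cdot> SS) ` (F2 - {0}) else {})"

lemma HsetE:
  assumes "h \<in> Hset J"
  obtains w where "w \<in> F2" "w \<noteq> 0" "h = CC w" | w where "J" "w \<in> F2" "w \<noteq> 0" "h = CC w \<cdot> SS"
  using assms unfolding Hset_def by (auto split: if_splits)

lemma Hset_subset: "Hset J \<subseteq> Gset J"
proof
  fix h assume "h \<in> Hset J"
  then show "h \<in> Gset J"
  proof (cases rule: HsetE)
    case (2 w)
    then show ?thesis using subgroup.m_closed[OF subgroup_Gset[of True]] by simp
  qed simp
qed

lemma CC_mult_Hset:
  assumes v: "v \<in> F2" "v \<noteq> 0" and h: "h \<in> Hset J"
  shows "CC v \<cdot> h \<in> Hset J"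
proof -
  have *: "CC v \<cdot> (CC w \<cdot> SS) = CC (v * w) \<cdot> SS" if "w \<in> F2" "w \<noteq> 0" for w
    using that v by (simp add: G.m_assoc[symmetric] CC_mult)
  show ?thesis
    using h v unfolding Hset_def by (auto simp: CC_mult * split: if_splits)
qed

lemma SS_mult_Hset:
  assumes h: "h \<in> Hset True"
  shows "SS \<cdot> h \<in> Hset True"
proof -
  have 1: "SS \<cdot> CC w \<in> Hset True" if "w \<in> F2" "w \<noteq> 0" for w
    using that unfolding Hset_def by (simp add: SS_CC)
  have 2: "SS \<cdot> (CC w \<cdot> SS) \<in> Hset True" if "w \<in> F2" "w \<noteq> 0" for w
  proof -
    have "SS \<cdot> (CC w \<cdot> SS) = CC (w ^ q) \<cdot> SS \<cdot> SS"
      using that by (simp add: G.m_assoc[symmetric] SS_CC)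
    also have "\<dots> = CC (w ^ q)" using that by (simp add: G.m_assoc SS_square)
    finally show ?thesis using that unfolding Hset_def by simp
  qed
  show ?thesis using h 1 2 unfolding Hset_def by auto
qed

lemma Gset_eq_product:
  assumes "g \<in> Gset J"
  obtains x h where "x \<in> Gamma c \<tau>" "h \<in> Hset J" "g = x \<cdot> h"
proof -
  have "\<exists>x\<in>Gamma c \<tau>. \<exists>h\<in>Hset J. g = x \<cdot> h"
  proof -
    let ?T = "{g. \<exists>x\<in>Gamma c \<tau>. \<exists>h\<in>Hset J. g = x \<cdot> h}"
    have one: "\<one>\<^bsub>GK c\<^esub> \<in> Gamma c \<tau>" using subgroup.one_closed[OF subgroup_Gamma] .
    have HT: "h \<in> ?T" if "h \<in> Hset J" for h
    proof -
      have "h \<in> carrier (GK c)" using that Hset_subset subgroup.mem_carrier[OF subgroup_Gset] by blast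
      then have "h = \<one>\<^bsub>GK c\<^esub> \<cdot> h" by simp
      then show ?thesis using one that by blast
    qed
    have "g \<in> ?T"
      using assms
    proof (rule Gset_induct)
      fix w :: "'a alg_closure" assume w: "w \<in> F2" "w \<noteq> 0"
      then show "CC w \<in> ?T" by (intro HT) (simp add: Hset_def)
      assume J
      with w show "CC w \<cdot> SS \<in> ?T" by (intro HT) (simp add: Hset_def)
    next
      fix \<xi> t assume \<xi>: "\<xi> \<in> verts" and "t \<in> ?T"
      then obtain x h where xh: "x \<in> Gamma c \<tau>" "h \<in> Hset J" "t = x \<cdot> h" by blast
      \<comment> \<open>After \<gamma>_\<xi> is written as a generator of \<Gamma> times ?z, the
        factor ?z is moved past x by conjugation, which keeps x in \<Gamma>, and is absorbed by
        \<open>Hset\<close>.\<close>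
      let ?z = "CC (inverse \<iota>)"
      have c: "x \<in> carrier (GK c)" "h \<in> carrier (GK c)" "?z \<in> carrier (GK c)"
        using xh(1) Gamma_closed subgroup.mem_carrier[OF subgroup_Gset subsetD[OF Hset_subset xh(2)]] by auto
      have "?z \<in> normalizer_Gamma" by (rule CC_normalizer) simp_all
      then have x': "?z \<cdot> x \<cdot> inv\<^bsub>GK c\<^esub> ?z \<in> Gamma c \<tau>"
        using xh(1) unfolding normalizer_Gamma_def by blast
      have "GG \<xi> \<cdot> t = (GG \<xi> \<cdot> CC \<iota>) \<cdot> ?z \<cdot> t"
        using GG_eq_Gamma[OF \<xi>] by simp
      also have "\<dots> = (GG \<xi> \<cdot> CC \<iota>) \<cdot> (?z \<cdot> x \<cdot> inv\<^bsub>GK c\<^esub> ?z) \<cdot> (?z \<cdot> h)"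
        using c unfolding xh(3) by (simp add: G.m_assoc G.inv_solve_left)
      finally have "GG \<xi> \<cdot> t = \<dots>" .
      moreover have "(GG \<xi> \<cdot> CC \<iota>) \<cdot> (?z \<cdot> x \<cdot> inv\<^bsub>GK c\<^esub> ?z) \<in> Gamma c \<tau>"
        using subgroup.m_closed[OF subgroup_Gamma Gamma_gen_mem[OF \<xi>] x'] .
      moreover have "?z \<cdot> h \<in> Hset J" using xh(2) by (intro CC_mult_Hset) simp_all
      ultimately show "GG \<xi> \<cdot> t \<in> ?T" by blast
    qed
    then show ?thesis by blast
  qed
  then show thesis using that by blast
qed

lemma group_Gset: "group ((GK c)\<lparr>carrier := Gset J\<rparr>)"
  by (rule G.subgroup_imp_group[OF subgroup_Gset])

lemma semidirect_Gset:
  assumes H: "subgroup (Hset J) (GK c)"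
  shows "is_semidirect ((GK c)\<lparr>carrier := Gset J\<rparr>) (Gamma c \<tau>) (Hset J)"
proof -
  let ?P = "(GK c)\<lparr>carrier := Gset J\<rparr>"
  interpret P: group ?P by (rule group_Gset)
  have "Gamma c \<tau> \<lhd> ?P"
  proof (rule P.normal_invI)
    show "subgroup (Gamma c \<tau>) ?P"
      by (rule G.subgroup_incl[OF subgroup_Gamma subgroup_Gset Gamma_subset])
    fix g x assume g: "g \<in> carrier ?P" and x: "x \<in> Gamma c \<tau>"
    have "g \<cdot> x \<cdot> inv\<^bsub>GK c\<^esub> g \<in> Gamma c \<tau>"
      using Gset_normalizer[of g J] g x unfolding normalizer_Gamma_def by simp
    moreover have "inv\<^bsub>?P\<^esub> g = inv\<^bsub>GK c\<^esub> g"
      using g by (intro G.m_inv_consistent subgroup_Gset) simp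
    ultimately show "g \<otimes>\<^bsub>?P\<^esub> x \<otimes>\<^bsub>?P\<^esub> inv\<^bsub>?P\<^esub> g \<in> Gamma c \<tau>" by simp
  qed
  moreover have "subgroup (Hset J) ?P"
    by (rule G.subgroup_incl[OF H subgroup_Gset Hset_subset])
  moreover have "Gamma c \<tau> <#>\<^bsub>?P\<^esub> Hset J = carrier ?P"
  proof
    show "Gamma c \<tau> <#>\<^bsub>?P\<^esub> Hset J \<subseteq> carrier ?P"
      using subgroup.m_closed[OF subgroup_Gset] Gamma_subset Hset_subset
      by (auto simp: set_mult_def subset_iff)
    show "carrier ?P \<subseteq> Gamma c \<tau> <#>\<^bsub>?P\<^esub> Hset J"
    proof
      fix g assume "g \<in> carrier ?P"
      then have "g \<in> Gset J" by simp
      then obtain x h where "x \<in> Gamma c \<tau>" "h \<in> Hset J" "g = x \<cdot> h" by (rule Gset_eq_product)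
      then show "g \<in> Gamma c \<tau> <#>\<^bsub>?P\<^esub> Hset J" by (auto simp: set_mult_def)
    qed
  qed
  moreover have "Gamma c \<tau> \<inter> Hset J = {\<one>\<^bsub>?P\<^esub>}"
  proof
    show "Gamma c \<tau> \<inter> Hset J \<subseteq> {\<one>\<^bsub>?P\<^esub>}"
      using Gamma_Int_CC unfolding Hset_def by (auto split: if_splits)
    show "{\<one>\<^bsub>?P\<^esub>} \<subseteq> Gamma c \<tau> \<inter> Hset J"
      using subgroup.one_closed[OF H] subgroup.one_closed[OF subgroup_Gamma] by simp
  qed
  ultimately show ?thesis by (simp add: is_semidirect_def)
qed

end

section \<open>Involutions as conjugates of a and b, and the meaning of (\<star>)\<close>

section \<open>The square relations\<close>

text \<open>The variables ending in \<open>b\<close> stand for conjugates. With $e = A/B$ of norm one, the formulas of the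
  condition $(\star)$ give $\eta = -i z^{-1} \wp(u) e$ and $\xi' = -i z^{-1} \bar z \wp(v) e$.\<close>

lemma square_relation_identity:
  fixes u ub v vb z zb i :: "'f::field"
  assumes nz: "u \<noteq> 0" "ub \<noteq> 0" "v \<noteq> 0" "vb \<noteq> 0" "z \<noteq> 0" "zb \<noteq> 0"
    and A: "A = v * ub - z * u * vb" "A \<noteq> 0" and B: "B = vb * u - zb * ub * v" "B \<noteq> 0"
  shows "(i * u / ub) * (i / zb * (ub / u) * (B / A)) = (i / z * (v / vb)) * (i * (z / zb) * (vb / v) * (B / A))"
    and "- (i / z * (u / ub) * (A / B)) - i * u / ub = - (i * (zb / z) * (v / vb) * (A / B)) - i / z * (v / vb)"
proof -
  show "(i * u / ub) * (i / zb * (ub / u) * (B / A)) = (i / z * (v / vb)) * (i * (z / zb) * (vb / v) * (B / A))"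
    using nz A(2) by (simp add: field_simps)
  \<comment> \<open>Up to sign, both sides of the second identity are i / (z B) times the common
    value u v (1 - z zb).\<close>
  have 1: "u / ub * (A + z * B) = u * v * (1 - z * zb)" and 2: "v / vb * (zb * A + B) = u * v * (1 - z * zb)"
    using nz unfolding A B by (simp_all add: field_simps)
  have "i / z * (u / ub) * (A / B) + i * u / ub = i / (z * B) * (u / ub * (A + z * B))"
    using nz B(2) by (simp add: field_simps)
  also have "\<dots> = i / (z * B) * (v / vb * (zb * A + B))" unfolding 1 2 ..
  also have "\<dots> = i * (zb / z) * (v / vb) * (A / B) + i / z * (v / vb)"
    using nz B(2) by (simp add: field_simps)
  finally show "- (i / z * (u / ub) * (A / B)) - i * u / ub = - (i * (zb / z) * (v / vb) * (A / B)) - i / z * (v / vb)"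
    by (metis minus_add_distrib diff_conv_add_uminus)
qed

locale lattice_generators = finite_params c \<tau> p n
  for c \<tau> :: "'a::{field,finite}" and p n +
  fixes dl ze :: "'a alg_closure"
  assumes dl: "dl \<in> F2" "dl \<noteq> 0" and dl_generates: "\<And>w. w \<in> F2 \<Longrightarrow> w \<noteq> 0 \<Longrightarrow> \<exists>k::nat. w = dl ^ k"
    and ze: "ze \<in> F2" "ze \<noteq> 0" and ze_norm: "ze * ze ^ q = to_ac ((\<tau> - 1) / \<tau>)"
begin

interpretation G: group "GK c"
  by (rule group_GK)

lemma dl_pow [simp]: "dl ^ k \<in> F2" "dl ^ k \<noteq> 0"
  using dl by simp_all

lemma dl_pow_Suc_q: "dl ^ (q + 1) = to_ac (nrm2 c (co dl))" "nrm2 c (co dl) \<noteq> 0"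
  using mult_pow_q[OF dl(1)] dl by (simp_all add: nrm2_co_eq_0_iff)

lemma dl_pow_mod: "dl ^ i = to_ac (nrm2 c (co dl) ^ (i div (q + 1))) * dl ^ (i mod (q + 1))"
proof -
  have "dl ^ i = dl ^ ((q + 1) * (i div (q + 1)) + i mod (q + 1))" by (simp only: mult_div_mod_eq)
  also have "\<dots> = (dl ^ (q + 1)) ^ (i div (q + 1)) * dl ^ (i mod (q + 1))"
    unfolding power_add power_mult ..
  finally show ?thesis unfolding dl_pow_Suc_q(1) to_ac_power[symmetric] .
qed

lemma card_F2: "card F2 = q * q"
proof -
  have "card F2 = CARD('a \<times> 'a)" unfolding F2_def by (rule card_image[OF inj_quad])
  then show ?thesis by (simp add: card_cartesian_product flip: UNIV_Times_UNIV)
qed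

text \<open>Modulo scalars \<delta> has order exactly q + 1. If \<delta>^r were scalar for some 0 <
  r \<le> q, division with remainder by r would present each nonzero element of \<open>F2\<close> as
  a scalar times \<delta>^m with m < r. These are at most (q - 1) q elements, fewer than q^2 -
  1.\<close>

lemma dl_pow_scalar:
  assumes "dl ^ i = to_ac x"
  shows "(q + 1) dvd i"
proof (rule ccontr)
  define r where "r = i mod (q + 1)"
  assume "\<not> (q + 1) dvd i"
  then have r: "0 < r" "r \<le> q" by (auto simp: r_def dvd_eq_mod_eq_0 simp flip: less_Suc_eq_le)
  define y where "y = x / nrm2 c (co dl) ^ (i div (q + 1))"
  have y: "dl ^ r = to_ac y"
    using dl_pow_mod[of i] dl_pow_Suc_q(2) assms by (simp add: y_def r_def field_simps)
  then have y0: "y \<noteq> 0" using dl_pow(2)[of r] by auto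
  have "F2 - {0} \<subseteq> (\<lambda>(x, m). to_ac x * dl ^ m) ` ((UNIV - {0}) \<times> {..<r})"
  proof
    fix w assume "w \<in> F2 - {0}"
    then obtain k where k: "w = dl ^ k" using dl_generates by blast
    have "w = dl ^ (r * (k div r) + k mod r)" by (simp add: k)
    also have "\<dots> = to_ac (y ^ (k div r)) * dl ^ (k mod r)"
      unfolding power_add power_mult y to_ac_power ..
    finally have "w = (\<lambda>(x, m). to_ac x * dl ^ m) (y ^ (k div r), k mod r)" by simp
    moreover have "(y ^ (k div r), k mod r) \<in> (UNIV - {0}) \<times> {..<r}" using y0 r by simp
    ultimately show "w \<in> (\<lambda>(x, m). to_ac x * dl ^ m) ` ((UNIV - {0}) \<times> {..<r})" by (rule image_eqI)
  qed
  then have "card (F2 - {0}) \<le> card ((\<lambda>(x, m). to_ac x * dl ^ m) ` ((UNIV - {0 :: 'a}) \<times> {..<r}))"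
    by (intro card_mono) auto
  also have "\<dots> \<le> card ((UNIV - {0 :: 'a}) \<times> {..<r})" by (rule card_image_le) simp
  also have "\<dots> = (q - 1) * r" by (simp add: card_cartesian_product card_Diff_singleton)
  also have "\<dots> \<le> (q - 1) * q" using r by simp
  finally have "q * q - 1 \<le> (q - 1) * q" by (simp add: card_Diff_singleton card_F2)
  moreover have "card {0, 1 :: 'a} \<le> CARD('a)" by (intro card_mono) auto
  then have "q \<ge> 2" by simp
  then obtain m where "q = Suc (Suc m)" by (metis add_2_eq_Suc le_Suc_ex)
  ultimately show False by simp
qed

lemma pow_q_eq_self: "v \<in> F2 \<Longrightarrow> v ^ q = v \<Longrightarrow> \<exists>x. v = to_ac x"
proof -
  assume "v \<in> F2" "v ^ q = v"
  then obtain x y where v: "v = quad (x, y)" "quad (x, - y) = quad (x, y)" by (elim F2_cases) (simp add: quad_pow_q)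
  then have "to_ac y * (- \<iota>) = to_ac y * \<iota>" by (simp add: quad_def)
  then have "y = 0" using uminus_\<iota>_neq unfolding mult_cancel_left by simp
  then show ?thesis using v by (auto simp: quad_to_ac)
qed

lemma reduce_mod_scalars:
  assumes "w \<in> F2" "w \<noteq> 0"
  shows "\<exists>j\<le>q. \<exists>x. dl ^ j = to_ac x * w"
proof -
  obtain k where k: "w = dl ^ k" using assms dl_generates by blast
  have "dl ^ (k mod (q + 1)) = to_ac (inverse (nrm2 c (co dl) ^ (k div (q + 1)))) * w"
    unfolding k using dl_pow_mod[of k] dl_pow_Suc_q(2) by (simp add: field_simps)
  moreover have "k mod (q + 1) \<le> q" by (simp flip: less_Suc_eq_le)
  ultimately show ?thesis by blast
qed

text \<open>An explicit solution: w = (\<xi> + \<xi>0) \<xi>0^q satisfies \<xi> w^q = \<xi>0 w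
  because the norms agree. For \<xi> = -\<xi>0 this w is 0, and w = \<iota> takes its place, as
  \<iota>^q = -\<iota>.\<close>

lemma hilbert90:
  assumes \<xi>: "\<xi> \<in> F2" "\<xi>0 \<in> F2" "\<xi>0 \<noteq> 0" and norm: "\<xi> * \<xi> ^ q = \<xi>0 * \<xi>0 ^ q"
  shows "\<exists>k. \<xi> = \<xi>0 * dl ^ k / (dl ^ k) ^ q"
proof -
  have "\<exists>w\<in>F2. w \<noteq> 0 \<and> \<xi> * w ^ q = \<xi>0 * w"
  proof (cases "\<xi> + \<xi>0 = 0")
    case True
    then have "\<xi> * \<iota> ^ q = \<xi>0 * \<iota>" by (simp add: frobenius_\<iota> add_eq_0_iff)
    then show ?thesis by (intro bexI[of _ \<iota>]) simp_all
  next
    case False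
    let ?w = "(\<xi> + \<xi>0) * \<xi>0 ^ q"
    have "?w ^ q = (\<xi> ^ q + \<xi>0 ^ q) * \<xi>0" using \<xi> by (simp add: power_mult_distrib frobenius_add)
    then have "\<xi> * ?w ^ q = (\<xi> * \<xi> ^ q + \<xi> * \<xi>0 ^ q) * \<xi>0" by (simp add: algebra_simps)
    also have "\<dots> = \<xi>0 * ?w" unfolding norm by (simp add: algebra_simps)
    finally show ?thesis using False \<xi> by (intro bexI[of _ ?w]) simp_all
  qed
  then obtain w where w: "w \<in> F2" "w \<noteq> 0" "\<xi> * w ^ q = \<xi>0 * w" by blast
  then have "\<xi> = \<xi>0 * w / w ^ q" by (simp add: eq_divide_eq)
  then show ?thesis using dl_generates w by blast
qed

text \<open>The parameters of d^i a d^(-i) and, in the next definition, of d^j b d^(-j): conjugation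
  by w multiplies \<xi> by w / w^q, starting from Z for a and from Z/\<zeta> for b.\<close>

definition xiA :: "nat \<Rightarrow> 'a alg_closure" where
  "xiA i = \<iota> * dl ^ i / (dl ^ i) ^ q"

definition xiB :: "nat \<Rightarrow> 'a alg_closure" where
  "xiB j = \<iota> / ze * dl ^ j / (dl ^ j) ^ q"

text \<open>The prescribed N(\<zeta>) = (\<tau> - 1)/\<tau> is exactly the quotient by which N(Z) =
  -c must be divided to reach the norm of the second kind.\<close>

lemma base_norms:
  "\<iota> * \<iota> ^ q = to_ac (- c)" "(\<iota> / ze) * (\<iota> / ze) ^ q = to_ac (c * \<tau> / (1 - \<tau>))"
proof -
  show 1: "\<iota> * \<iota> ^ q = to_ac (- c)" by (simp add: frobenius_\<iota> \<iota>_square)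
  have "(\<iota> / ze) * (\<iota> / ze) ^ q = (\<iota> * \<iota> ^ q) / (ze * ze ^ q)" by (simp add: power_divide)
  also have "\<dots> = to_ac (- c / ((\<tau> - 1) / \<tau>))" unfolding 1 ze_norm by (simp only: to_ac_divide)
  also have "- c / ((\<tau> - 1) / \<tau>) = c * \<tau> / (1 - \<tau>)" using \<tau> by (simp add: field_simps)
  finally show "(\<iota> / ze) * (\<iota> / ze) ^ q = to_ac (c * \<tau> / (1 - \<tau>))" .
qed

lemma xi_F2 [simp]: "xiA i \<in> F2" "xiB j \<in> F2"
  using ze by (simp_all add: xiA_def xiB_def)

lemma xiA_vertsA: "co (xiA i) \<in> vertsA"
  using norm_twist[of "dl ^ i" \<iota>] base_norms(1) by (simp only: vertsA_iff xi_F2 xiA_def[symmetric] dl_pow F2_\<iota>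
      simp_thms not_False_eq_True)

lemma xiB_vertsB: "co (xiB j) \<in> vertsB"
proof -
  have "\<iota> / ze \<in> F2" using ze by simp
  then show ?thesis
    using norm_twist[of "dl ^ j" "\<iota> / ze"] base_norms(2) by (simp only: vertsB_iff xi_F2 xiB_def[symmetric] dl_pow
        simp_thms not_False_eq_True)
qed

text \<open>By Hilbert 90 two parameters of equal norm differ by some w / w^q, so conjugating a and
  b by powers of d reaches every involution of the two kinds.\<close>

lemma verts_cases:
  assumes "\<xi> \<in> verts"
  shows "(\<exists>i. \<xi> = xiA i) \<or> (\<exists>j. \<xi> = xiB j)"
proof -
  have F: "\<xi> \<in> F2" using assms by (rule verts_F2)
  have ze': "\<iota> / ze \<in> F2" "\<iota> / ze \<noteq> 0" using ze by simp_all
  from assms consider "co \<xi> \<in> vertsA" | "co \<xi> \<in> vertsB" by (auto simp: verts_def)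
  then show ?thesis
  proof cases
    case 1
    then have "\<xi> * \<xi> ^ q = \<iota> * \<iota> ^ q" unfolding vertsA_iff[OF F] base_norms .
    then show ?thesis using hilbert90[OF F] unfolding xiA_def by simp
  next
    case 2
    then have "\<xi> * \<xi> ^ q = (\<iota> / ze) * (\<iota> / ze) ^ q" unfolding vertsB_iff[OF F] base_norms .
    then show ?thesis using hilbert90[OF F ze'] unfolding xiB_def by blast
  qed
qed

abbreviation star_j :: "nat \<Rightarrow> nat \<Rightarrow> 'a alg_closure" where
  "star_j i l \<equiv> (dl ^ l - ze * (dl ^ i / (dl ^ i) ^ q) * (dl ^ l) ^ q) * \<iota>"

abbreviation star_k :: "nat \<Rightarrow> nat \<Rightarrow> 'a alg_closure" where
  "star_k i l \<equiv> (dl ^ i - inverse ze * (dl ^ l / (dl ^ l) ^ q) * (dl ^ i) ^ q) * \<iota>"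

lemma star_cond_iff:
  "star_cond c (zq dl) (zq ze) i j k l \<longleftrightarrow>
     (star_j i l \<noteq> 0 \<and> (\<exists>x. dl ^ j = to_ac x * star_j i l)) \<and>
     (star_k i l \<noteq> 0 \<and> (\<exists>x. dl ^ k = to_ac x * star_k i l))"
proof -
  have pow: "dl ^ (CARD('a) * m) = (dl ^ m) ^ q" for m
    by (simp add: power_mult mult.commute)
  have F: "star_j i l \<in> F2" "star_k i l \<in> F2" using ze by simp_all
  have "(zq dl [^]\<^bsub>DK c\<^esub> l \<ominus>\<^bsub>DK c\<^esub>
          zq ze \<otimes>\<^bsub>DK c\<^esub> wp c (zq dl [^]\<^bsub>DK c\<^esub> i) \<otimes>\<^bsub>DK c\<^esub> zq dl [^]\<^bsub>DK c\<^esub> (CARD('a) * l)) \<otimes>\<^bsub>DK c\<^esub> elZ = zq (star_j i l)"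
    using ze dl by (simp add: zq_pow zq_wp zq_mult zq_diff zq_\<iota> pow[unfolded CARD_q])
  moreover have "(zq dl [^]\<^bsub>DK c\<^esub> i \<ominus>\<^bsub>DK c\<^esub>
          inv\<^bsub>DK c\<^esub> zq ze \<otimes>\<^bsub>DK c\<^esub> wp c (zq dl [^]\<^bsub>DK c\<^esub> l) \<otimes>\<^bsub>DK c\<^esub> zq dl [^]\<^bsub>DK c\<^esub> (CARD('a) * i)) \<otimes>\<^bsub>DK c\<^esub> elZ = zq (star_k i l)"
    using ze dl by (simp add: zq_inv zq_pow zq_wp zq_mult zq_diff zq_\<iota> pow[unfolded CARD_q])
  ultimately show ?thesis
    unfolding star_cond_def zq_pow[OF dl(1)]
    by (simp only: eq_mod_Fq_zq[OF dl_pow(1) F(1)] eq_mod_Fq_zq[OF dl_pow(1) F(2)] dl_pow(2) simp_thms)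
qed

context
  fixes i l :: nat
begin

text \<open>The right-hand sides of (\<star>) have a common numerator. With u = \<delta>^i and v =
  \<delta>^l they are \<open>numA\<close> Z / u^q and -\<open>numA\<close> Z / (\<zeta> v^q).
  \<open>numA\<close> and its conjugate \<open>numB\<close> are the A and B of
  \<open>square_relation_identity\<close>.\<close>

definition numA where "numA = dl ^ l * (dl ^ i) ^ q - ze * dl ^ i * (dl ^ l) ^ q"
definition numB where "numB = (dl ^ l) ^ q * dl ^ i - ze ^ q * (dl ^ i) ^ q * dl ^ l"

lemma num_F2 [simp]: "numA \<in> F2" "numB \<in> F2"
  using ze by (simp_all add: numA_def numB_def)

lemma numA_pow_q: "numA ^ q = numB" "numB ^ q = numA"
  using ze by (simp_all add: numA_def numB_def frobenius_diff power_mult_distrib)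

text \<open>If it vanished, taking norms would give N(\<zeta>) = 1, that is \<tau> - 1 =
  \<tau>.\<close>

lemma numA_nonzero: "numA \<noteq> 0"
proof
  let ?X = "dl ^ i" and ?W = "dl ^ l"
  assume "numA = 0"
  then have eq: "?W * ?X ^ q = ze * ?X * ?W ^ q" by (simp add: numA_def)
  then have "(?W * ?X ^ q) ^ q = (ze * ?X * ?W ^ q) ^ q" by simp
  then have eq': "?W ^ q * ?X = ze ^ q * ?X ^ q * ?W" by (simp add: power_mult_distrib)
  have "?W * ?X ^ q * (?W ^ q * ?X) = (ze * ze ^ q) * (?W * ?X ^ q * (?W ^ q * ?X))"
    using arg_cong2[OF eq eq', of "(*)"] by (simp add: mult.assoc mult.left_commute mult.commute)
  moreover have "?W * ?X ^ q * (?W ^ q * ?X) \<noteq> 0" using dl by simp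
  ultimately have "ze * ze ^ q = 1" unfolding mult_cancel_right1 by blast
  then have "ze * ze ^ q = to_ac 1" by simp
  then have "(\<tau> - 1) / \<tau> = 1" unfolding ze_norm to_ac_eq_iff .
  then show False using \<tau> by (simp add: field_simps)
qed

lemma numB_nonzero: "numB \<noteq> 0"
  using numA_pow_q numA_nonzero by auto

lemma star_j_eq: "star_j i l = numA / (dl ^ i) ^ q * \<iota>"
  using dl by (simp add: numA_def field_simps)

lemma star_k_eq: "star_k i l = - numA / (ze * (dl ^ l) ^ q) * \<iota>"
  using dl ze by (simp add: numA_def field_simps)

text \<open>Both right-hand sides of (\<star>) are nonzero for all i and l, so j and k can be found.
  Hence every product of an involution of the second kind with one of the first can be
  swapped.\<close>

lemma star_exists: "\<exists>j\<le>q. \<exists>k\<le>q. star_cond c (zq dl) (zq ze) i j k l"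
proof -
  have F: "star_j i l \<in> F2" "star_k i l \<in> F2" using ze by simp_all
  have nz: "star_j i l \<noteq> 0" "star_k i l \<noteq> 0"
    unfolding star_j_eq star_k_eq using numA_nonzero dl ze by simp_all
  show ?thesis
    unfolding star_cond_iff using reduce_mod_scalars[OF F(1) nz(1)] reduce_mod_scalars[OF F(2) nz(2)] nz by blast
qed

text \<open>(\<star>) determines \<delta>^j and \<delta>^k only up to scalars x and y; these cancel
  in the quotients w / w^q that enter the parameters.\<close>

lemma star_relation:
  assumes "star_cond c (zq dl) (zq ze) i j k l"
  shows "GG (xiA i) \<cdot> GG (xiB j) = GG (xiB l) \<cdot> GG (xiA k)"
proof -
  let ?X = "dl ^ i" and ?W = "dl ^ l"
  obtain x y where j: "dl ^ j = to_ac x * (numA / ?X ^ q * \<iota>)"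
    and k: "dl ^ k = to_ac y * (- numA / (ze * ?W ^ q) * \<iota>)"
    using assms unfolding star_cond_iff star_j_eq star_k_eq by blast
  have x: "to_ac x \<noteq> 0" and y: "to_ac y \<noteq> 0" using j k dl_pow(2) by (metis mult_zero_left)+
  have nz: "?X ^ q \<noteq> 0" "?W ^ q \<noteq> 0" "ze ^ q \<noteq> 0" using dl ze by simp_all
  have jb: "(dl ^ j) ^ q = to_ac x * (numB / ?X * (- \<iota>))"
    unfolding j by (simp add: power_mult_distrib power_divide numA_pow_q frobenius_\<iota>)
  have kb: "(dl ^ k) ^ q = to_ac y * (- numB / (ze ^ q * ?W) * (- \<iota>))"
    unfolding k using ze by (simp add: power_mult_distrib power_divide uminus_pow_q numA_pow_q frobenius_\<iota>)
  have B: "xiB j = - (\<iota> / ze * (?X / ?X ^ q) * (numA / numB))"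
    unfolding xiB_def jb unfolding j using x nz numA_nonzero numB_nonzero dl ze by (simp add: field_simps)
  have K: "xiA k = - (\<iota> * (ze ^ q / ze) * (?W / ?W ^ q) * (numA / numB))"
    unfolding xiA_def kb unfolding k using y nz numA_nonzero numB_nonzero dl ze by (simp add: field_simps)
  have Bq: "xiB j ^ q = \<iota> / ze ^ q * (?X ^ q / ?X) * (numB / numA)"
    unfolding B using ze by (simp add: uminus_pow_q power_mult_distrib power_divide numA_pow_q frobenius_\<iota>)
  have Kq: "xiA k ^ q = \<iota> * (ze / ze ^ q) * (?W ^ q / ?W) * (numB / numA)"
    unfolding K using ze by (simp add: uminus_pow_q power_mult_distrib power_divide numA_pow_q frobenius_\<iota>)
  note id = square_relation_identity[OF dl_pow(2)[of i] nz(1) dl_pow(2)[of l] nz(2) ze(2) nz(3) numA_def numA_nonzero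
      numB_def numB_nonzero, of \<iota>]
  show ?thesis
  proof (rule GG_commute)
    show "xiA i * xiB j ^ q = xiB l * xiA k ^ q"
      using id(1) unfolding Bq Kq xiA_def[of i] xiB_def[of l] by (simp only: times_divide_eq_right)
    show "xiB j - xiA i = xiA k - xiB l"
      using id(2) unfolding B K xiA_def[of i] xiB_def[of l] by (simp only: times_divide_eq_right)
  qed simp_all
qed

end

end

section \<open>Relations as equations in a group, and computations with dihedral relations\<close>

section \<open>The relations in terms of group elements\<close>

lemma satisfies_Un: "satisfies P f (E \<union> E') \<longleftrightarrow> satisfies P f E \<and> satisfies P f E'"
  by (auto simp: satisfies_def)

lemma satisfies_insert:
  "satisfies P f (insert (u, v) E) \<longleftrightarrow> word_eval P f u = word_eval P f v \<and> satisfies P f E"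
  by (auto simp: satisfies_def)

lemma satisfies_empty: "satisfies P f {} \<longleftrightarrow> True"
  by (simp add: satisfies_def)

context group
begin

abbreviation conj_pow :: "'a \<Rightarrow> nat \<Rightarrow> 'a \<Rightarrow> 'a" where
  "conj_pow d i x \<equiv> d [^] i \<otimes> x \<otimes> inv (d [^] i)"

lemma word_eval_conj_d:
  assumes f: "f ` S \<subseteq> carrier G" and S: "Gd \<in> S" "x \<in> S"
  shows "word_eval G f (conj_d i x) = conj_pow (f Gd) i (f x)"
proof -
  have c: "f Gd \<in> carrier G" "f x \<in> carrier G" using f S by auto
  have w: "[(Gd, e)] \<in> words S" "letter x \<in> words S" for e using S by auto
  have "word_eval G f (conj_d i x) =
      word_eval G f [(Gd, True)] [^] i \<otimes> (f x \<otimes> word_eval G f [(Gd, False)] [^] i)"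
    using c w unfolding conj_d_def
    by (simp only: word_eval_append[OF f] words_append_iff words_pow word_eval_pow[OF f] word_eval_letter simp_thms)
  then show ?thesis using c by (simp add: nat_pow_inv m_assoc)
qed

lemma satisfies_square_rels_iff:
  assumes f: "f ` S \<subseteq> carrier G" and S: "{Gd, Ga, Gb} \<subseteq> S"
  shows "satisfies G f (square_rels c \<delta> \<zeta>) \<longleftrightarrow>
    (\<forall>i j k l. i \<le> CARD('k) \<and> j \<le> CARD('k) \<and> k \<le> CARD('k) \<and> l \<le> CARD('k) \<and>
      star_cond (c :: 'k::{field,finite}) \<delta> \<zeta> i j k l \<longrightarrow>
      conj_pow (f Gd) i (f Ga) \<otimes> conj_pow (f Gd) j (f Gb) = conj_pow (f Gd) l (f Gb) \<otimes> conj_pow (f Gd) k (f Ga))"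
proof -
  have GdS: "Gd \<in> S" using S by blast
  have w: "conj_d i x \<in> words S" if "x \<in> S" for i x
    using GdS that by (simp add: conj_d_def)
  have "word_eval G f (conj_d i x @ conj_d j y) = conj_pow (f Gd) i (f x) \<otimes> conj_pow (f Gd) j (f y)"
    if "x \<in> S" "y \<in> S" for i j x y
    unfolding word_eval_append[OF f w[OF that(1)] w[OF that(2)]]
      word_eval_conj_d[OF f GdS that(1)] word_eval_conj_d[OF f GdS that(2)] ..
  moreover have "Ga \<in> S" "Gb \<in> S" using S by blast+
  ultimately have ev: "word_eval G f (conj_d i Ga @ conj_d j Gb) = conj_pow (f Gd) i (f Ga) \<otimes> conj_pow (f Gd) j (f Gb)"
    "word_eval G f (conj_d i Gb @ conj_d j Ga) = conj_pow (f Gd) i (f Gb) \<otimes> conj_pow (f Gd) j (f Ga)" for i j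
    by (simp_all only:)
  show ?thesis
  proof
    assume sat: "satisfies G f (square_rels c \<delta> \<zeta>)"
    show "\<forall>i j k l. i \<le> CARD('k) \<and> j \<le> CARD('k) \<and> k \<le> CARD('k) \<and> l \<le> CARD('k) \<and> star_cond c \<delta> \<zeta> i j k l \<longrightarrow>
      conj_pow (f Gd) i (f Ga) \<otimes> conj_pow (f Gd) j (f Gb) = conj_pow (f Gd) l (f Gb) \<otimes> conj_pow (f Gd) k (f Ga)"
    proof (intro allI impI)
      fix i j k l assume "i \<le> CARD('k) \<and> j \<le> CARD('k) \<and> k \<le> CARD('k) \<and> l \<le> CARD('k) \<and> star_cond c \<delta> \<zeta> i j k l"
      then have "(conj_d i Ga @ conj_d j Gb, conj_d l Gb @ conj_d k Ga) \<in> square_rels c \<delta> \<zeta>"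
        unfolding square_rels_def by blast
      then show "conj_pow (f Gd) i (f Ga) \<otimes> conj_pow (f Gd) j (f Gb) = conj_pow (f Gd) l (f Gb) \<otimes> conj_pow (f Gd) k (f Ga)"
        using sat unfolding satisfies_def ev[symmetric] by blast
    qed
  next
    assume *: "\<forall>i j k l. i \<le> CARD('k) \<and> j \<le> CARD('k) \<and> k \<le> CARD('k) \<and> l \<le> CARD('k) \<and> star_cond c \<delta> \<zeta> i j k l \<longrightarrow>
      conj_pow (f Gd) i (f Ga) \<otimes> conj_pow (f Gd) j (f Gb) = conj_pow (f Gd) l (f Gb) \<otimes> conj_pow (f Gd) k (f Ga)"
    show "satisfies G f (square_rels c \<delta> \<zeta>)"
      unfolding satisfies_def
    proof (intro ballI, clarify)
      fix u v assume "(u, v) \<in> square_rels c \<delta> \<zeta>"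
      then obtain i j k l where "u = conj_d i Ga @ conj_d j Gb" "v = conj_d l Gb @ conj_d k Ga"
        "i \<le> CARD('k) \<and> j \<le> CARD('k) \<and> k \<le> CARD('k) \<and> l \<le> CARD('k) \<and> star_cond c \<delta> \<zeta> i j k l"
        unfolding square_rels_def by blast
      then show "word_eval G f u = word_eval G f v" using * by (simp only: ev)
    qed
  qed
qed

lemma satisfies_relsR'_iff:
  assumes f: "f ` S \<subseteq> carrier G" and S: "{Gd, Ga, Gb} \<subseteq> S"
  shows "satisfies G f (relsR' c \<delta> \<zeta>) \<longleftrightarrow>
    f Gd [^] (CARD('k::{field,finite}) + 1) = \<one> \<and> f Ga \<otimes> f Ga = \<one> \<and> f Gb \<otimes> f Gb = \<one> \<and>
    satisfies G f (square_rels (c :: 'k) \<delta> \<zeta>)"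
proof -
  have x: "f x \<in> carrier G" "letter x \<in> words S" if "x \<in> {Gd, Ga, Gb}" for x
    using that f S by auto
  have pow: "word_eval G f (word_pow (letter x) m) = f x [^] m" if "x \<in> {Gd, Ga, Gb}" for x and m :: nat
    unfolding word_eval_pow[OF f x(2)[OF that]] word_eval_letter[of f x, OF x(1)[OF that]] ..
  have sq: "f x [^] (2 :: nat) = f x \<otimes> f x" if "x \<in> {Gd, Ga, Gb}" for x
    using x(1)[OF that] by (simp add: numeral_2_eq_2)
  have ev: "word_eval G f (word_pow (letter Gd) m) = f Gd [^] m"
    "word_eval G f (word_pow (letter Ga) 2) = f Ga \<otimes> f Ga"
    "word_eval G f (word_pow (letter Gb) 2) = f Gb \<otimes> f Gb" for m
    by (simp_all only: pow sq insert_iff simp_thms)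
  show ?thesis
    unfolding relsR'_def satisfies_Un satisfies_insert satisfies_empty ev word_eval.simps(1) by blast
qed

lemma satisfies_relsR_iff:
  assumes f: "f ` S \<subseteq> carrier G" and S: "{Gd, Gs, Ga, Gb} \<subseteq> S"
  shows "satisfies G f (relsR c \<delta> \<zeta>) \<longleftrightarrow> satisfies G f (relsR' (c :: 'k::{field,finite}) \<delta> \<zeta>) \<and>
    f Gs \<otimes> f Gs = \<one> \<and> (f Gd \<otimes> f Gs) \<otimes> (f Gd \<otimes> f Gs) = \<one> \<and> (f Gs \<otimes> f Ga) \<otimes> (f Gs \<otimes> f Ga) = \<one> \<and>
    (\<forall>m\<le>CARD('k). eq_mod_Fq c (\<delta> [^]\<^bsub>DK c\<^esub> m) \<zeta> \<longrightarrow>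
      (f Gs \<otimes> (f Gd [^] m \<otimes> f Gb)) \<otimes> (f Gs \<otimes> (f Gd [^] m \<otimes> f Gb)) = \<one>)"
proof -
  have c: "f Gd \<in> carrier G" "f Gs \<in> carrier G" "f Ga \<in> carrier G" "f Gb \<in> carrier G"
    and w: "letter Gd \<in> words S" "letter Gs \<in> words S" "letter Ga \<in> words S" "letter Gb \<in> words S"
    using f S by auto
  have sq: "word_eval G f (word_pow u 2) = word_eval G f u \<otimes> word_eval G f u" if "u \<in> words S" for u
    using that f by (simp add: word_eval_pow[OF f] numeral_2_eq_2 word_eval_closed[OF f])
  note ev = word_eval_append[OF f] word_eval_pow[OF f] word_eval_letter words_append_iff words_pow c w simp_thms
  have e: "word_eval G f (letter Gd @ letter Gs) = f Gd \<otimes> f Gs"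
    "word_eval G f (letter Gs @ letter Ga) = f Gs \<otimes> f Ga"
    "word_eval G f (letter Gs @ word_pow (letter Gd) m @ letter Gb) = f Gs \<otimes> (f Gd [^] m \<otimes> f Gb)" for m
    by (simp_all only: ev)
  have sqs: "word_eval G f (word_pow (letter Gs) 2) = f Gs \<otimes> f Gs"
    "word_eval G f (word_pow (letter Gd @ letter Gs) 2) = (f Gd \<otimes> f Gs) \<otimes> (f Gd \<otimes> f Gs)"
    "word_eval G f (word_pow (letter Gs @ letter Ga) 2) = (f Gs \<otimes> f Ga) \<otimes> (f Gs \<otimes> f Ga)"
    "word_eval G f (word_pow (letter Gs @ word_pow (letter Gd) m @ letter Gb) 2) =
      (f Gs \<otimes> (f Gd [^] m \<otimes> f Gb)) \<otimes> (f Gs \<otimes> (f Gd [^] m \<otimes> f Gb))" for m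
    using w by (simp_all only: sq e words_append_iff words_pow simp_thms word_eval_letter c)
  have m: "satisfies G f {(word_pow (letter Gs @ word_pow (letter Gd) m @ letter Gb) 2, []) | m.
        m \<le> CARD('k) \<and> eq_mod_Fq c (\<delta> [^]\<^bsub>DK c\<^esub> m) \<zeta>} \<longleftrightarrow>
      (\<forall>m\<le>CARD('k). eq_mod_Fq c (\<delta> [^]\<^bsub>DK c\<^esub> m) \<zeta> \<longrightarrow>
        (f Gs \<otimes> (f Gd [^] m \<otimes> f Gb)) \<otimes> (f Gs \<otimes> (f Gd [^] m \<otimes> f Gb)) = \<one>)"
    unfolding satisfies_def sqs(4)[symmetric] word_eval.simps(1)[of G f, symmetric] by blast
  show ?thesis
    unfolding relsR_def relsR'_def satisfies_Un satisfies_insert satisfies_empty m sqs(1-3) word_eval.simps(1)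
    by blast
qed

end

lemma finite_square_rels: "finite (square_rels (c :: 'a::{field,finite}) \<delta> \<zeta>)"
proof -
  let ?I = "{..CARD('a)}"
  have "square_rels c \<delta> \<zeta> \<subseteq>
      (\<lambda>(i, j, k, l). (conj_d i Ga @ conj_d j Gb, conj_d l Gb @ conj_d k Ga)) ` (?I \<times> ?I \<times> ?I \<times> ?I)"
    unfolding square_rels_def by force
  then show ?thesis by (rule finite_subset) (intro finite_imageI finite_cartesian_product finite_atMost)
qed

lemma finite_relsR: "finite (relsR (c :: 'a::{field,finite}) \<delta> \<zeta>)" "finite (relsR' c \<delta> \<zeta>)"
proof -
  have "finite {(word_pow (letter Gs @ word_pow (letter Gd) m @ letter Gb) 2, [] :: gens word) | m.
        m \<le> CARD('a) \<and> eq_mod_Fq c (\<delta> [^]\<^bsub>DK c\<^esub> m) \<zeta>}"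
    by (rule finite_subset[of _ "(\<lambda>m. (word_pow (letter Gs @ word_pow (letter Gd) m @ letter Gb) 2, [])) ` {..CARD('a)}"]) auto
  then show "finite (relsR c \<delta> \<zeta>)" "finite (relsR' c \<delta> \<zeta>)"
    unfolding relsR_def relsR'_def by (simp_all add: finite_square_rels)
qed

lemma square_rels_words:
  assumes "{Gd, Ga, Gb} \<subseteq> S"
  shows "square_rels (c :: 'a::{field,finite}) \<delta> \<zeta> \<subseteq> words S \<times> words S"
  using assms unfolding square_rels_def conj_d_def by auto

lemma relsR_words:
  "relsR (c :: 'a::{field,finite}) \<delta> \<zeta> \<subseteq> words {Gd, Gs, Ga, Gb} \<times> words {Gd, Gs, Ga, Gb}"
  "relsR' c \<delta> \<zeta> \<subseteq> words {Gd, Ga, Gb} \<times> words {Gd, Ga, Gb}"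
  using square_rels_words[of "{Gd, Gs, Ga, Gb}" c \<delta> \<zeta>] square_rels_words[of "{Gd, Ga, Gb}" c \<delta> \<zeta>]
  unfolding relsR_def relsR'_def by auto

context group
begin

context
  fixes d :: 'a and N :: nat
  assumes d: "d \<in> carrier G" and N: "d [^] (Suc N) = \<one>"
begin

lemma pow_mult_Suc: "d [^] (Suc N * k) = \<one>"
  using d N by (simp only: nat_pow_pow[symmetric] nat_pow_one)

text \<open>Modulo N + 1 the exponent -i is N i, so negative exponents are avoided.\<close>

lemma inv_pow: "inv (d [^] i) = d [^] (N * i)"
proof (rule inv_equality)
  have "d [^] (N * i) \<otimes> d [^] i = d [^] (N * i + i)" using d by (simp only: nat_pow_mult)
  also have "N * i + i = Suc N * i" by simp
  finally show "d [^] (N * i) \<otimes> d [^] i = \<one>" unfolding pow_mult_Suc .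
qed (use d in simp_all)

lemma pow_mod: "d [^] (i mod Suc N) = d [^] i"
proof -
  have "d [^] i = d [^] (Suc N * (i div Suc N) + i mod Suc N)" by (simp only: mult_div_mod_eq)
  also have "\<dots> = d [^] (Suc N * (i div Suc N)) \<otimes> d [^] (i mod Suc N)" using d by (simp only: nat_pow_mult)
  finally show ?thesis unfolding pow_mult_Suc using d by simp
qed

lemma conj_pow_push: "x \<in> carrier G \<Longrightarrow> d \<otimes> conj_pow d i x = conj_pow d (Suc i) x \<otimes> d"
proof -
  assume x: "x \<in> carrier G"
  have "d [^] Suc i = d \<otimes> d [^] i" using d by (rule nat_pow_Suc2)
  then show ?thesis using x d by (simp add: inv_mult_group m_assoc)
qed

lemma conj_pow_square:
  assumes "x \<in> carrier G" "x \<otimes> x = \<one>"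
  shows "conj_pow d i x \<otimes> conj_pow d i x = \<one>"
proof -
  have "conj_pow d i x \<otimes> conj_pow d i x = d [^] i \<otimes> (x \<otimes> x) \<otimes> inv (d [^] i)"
    using assms(1) d by (simp add: m_assoc inv_solve_left')
  then show ?thesis using assms d by simp
qed

context
  fixes s :: 'a
  assumes s: "s \<in> carrier G" "s \<otimes> s = \<one>" and ds: "(d \<otimes> s) \<otimes> (d \<otimes> s) = \<one>"
begin

lemma inv_s: "inv s = s"
  using s by (intro inv_equality)

lemma s_d: "s \<otimes> d = inv d \<otimes> s"
proof -
  have "d \<otimes> (s \<otimes> d \<otimes> s) = \<one>" using s d ds by (simp add: m_assoc)
  then have "s \<otimes> d \<otimes> s \<otimes> d = \<one>" using s d by (intro inv_comm[of d]) simp_all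
  then have "inv d = s \<otimes> d \<otimes> s" using s d by (intro inv_equality) simp_all
  then have "inv d \<otimes> s = s \<otimes> d \<otimes> (s \<otimes> s)" using s(1) d by (simp add: m_assoc)
  then show ?thesis using s d by simp
qed

lemma s_pow: "s \<otimes> d [^] (i :: nat) = inv (d [^] i) \<otimes> s"
proof (induction i)
  case (Suc i)
  have "s \<otimes> d [^] Suc i = (s \<otimes> d [^] i) \<otimes> d" using s d by (simp add: m_assoc)
  also have "\<dots> = inv (d [^] i) \<otimes> (s \<otimes> d)" unfolding Suc using s d by (simp add: m_assoc)
  also have "\<dots> = (inv (d [^] i) \<otimes> inv d) \<otimes> s" unfolding s_d using s d by (simp add: m_assoc)
  also have "inv (d [^] i) \<otimes> inv d = inv (d [^] Suc i)"
    using d nat_pow_Suc2[OF d, of i] by (simp add: inv_mult_group)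
  finally show ?case .
qed (use s in simp)

text \<open>s inverts d, which turns the exponent i into m - i; \<open>N * i + m\<close> represents
  it modulo N + 1.\<close>

lemma s_conj_pow:
  assumes x: "x \<in> carrier G" and sx: "s \<otimes> x = conj_pow d m x \<otimes> s"
  shows "s \<otimes> conj_pow d i x = conj_pow d (N * i + m) x \<otimes> s"
proof -
  let ?y = "d [^] i" and ?z = "d [^] (N * i)" and ?w = "d [^] m"
  have c: "?y \<in> carrier G" "?z \<in> carrier G" "?w \<in> carrier G" using d by simp_all
  have "s \<otimes> conj_pow d i x = (s \<otimes> ?y) \<otimes> (x \<otimes> inv ?y)" using s x c by (simp add: m_assoc)
  also have "\<dots> = ?z \<otimes> ((s \<otimes> x) \<otimes> ?z)" unfolding s_pow inv_pow using s x c by (simp add: m_assoc)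
  also have "\<dots> = ?z \<otimes> (conj_pow d m x \<otimes> (s \<otimes> ?z))" unfolding sx using s x c by (simp add: m_assoc)
  also have "\<dots> = (?z \<otimes> ?w) \<otimes> x \<otimes> (inv ?w \<otimes> inv ?z) \<otimes> s" unfolding s_pow using s x c by (simp add: m_assoc)
  also have "inv ?w \<otimes> inv ?z = inv (?z \<otimes> ?w)" using c by (simp add: inv_mult_group)
  also have "?z \<otimes> ?w = d [^] (N * i + m)" using d by (rule nat_pow_mult)
  finally show ?thesis .
qed

text \<open>A common form of the relations (sa)^2 = 1, with m = 0, and (s\<zeta>b)^2 = 1, suited to
  moving s through a word.\<close>

lemma s_commutes:
  assumes x: "x \<in> carrier G" "x \<otimes> x = \<one>"
    and sx: "(s \<otimes> (d [^] m \<otimes> x)) \<otimes> (s \<otimes> (d [^] m \<otimes> x)) = \<one>"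
  shows "s \<otimes> x = conj_pow d m x \<otimes> s"
proof -
  let ?y = "d [^] m"
  have y: "?y \<in> carrier G" using d by simp
  have "inv (s \<otimes> (?y \<otimes> x)) = s \<otimes> (?y \<otimes> x)" using s x sx y by (intro inv_equality) simp_all
  moreover have "inv x = x" using x by (intro inv_equality)
  ultimately have "x \<otimes> inv ?y \<otimes> s = s \<otimes> ?y \<otimes> x"
    using s x y by (simp add: inv_mult_group inv_s m_assoc)
  also have "\<dots> = inv ?y \<otimes> (s \<otimes> x)" unfolding s_pow using s x y by (simp add: m_assoc)
  finally have "?y \<otimes> (x \<otimes> inv ?y \<otimes> s) = ?y \<otimes> (inv ?y \<otimes> (s \<otimes> x))" by simp
  then show ?thesis using s x y by (simp add: m_assoc[symmetric])
qed

end

end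

end

context lattice_generators
begin

interpretation G: group "GK c"
  by (rule group_GK)

section \<open>Triviality of the kernel for every group satisfying the relations\<close>

section \<open>Injectivity\<close>

text \<open>Both representatives have t as coefficient of Z, so the two factors of proportionality
  are equal.\<close>

lemma GG_inject:
  assumes "GG \<xi> = GG \<eta>" "\<xi> \<in> F2" "\<eta> \<in> F2"
  shows "\<xi> = \<eta>"
proof -
  obtain p r p' r' where co: "co \<xi> = (p, r)" "co \<eta> = (p', r')" by fastforce
  obtain h k where hk: "h \<noteq> 0" "k \<noteq> 0" "pscale h (gpoly (co \<xi>)) = pscale k (gpoly (co \<eta>))"
    by (rule cl_eqE[OF assms(1)[unfolded GG_def] pnorm_gpoly_nonzero pnorm_gpoly_nonzero])
  have e: "h * [:0, 1:] = k * [:0, 1:]" "h * [:p:] = k * [:p':]" "h * [:r:] = k * [:r':]"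
    using hk(3) unfolding co gpoly_def fst_conv snd_conv vert.simps quat.map by (simp_all only: quat.inject)
  have "h = k" using e(1) unfolding mult_cancel_right by simp
  then have "k * [:p:] = k * [:p':]" "k * [:r:] = k * [:r':]" using e(2,3) by (simp_all only:)
  then have "p = p'" "r = r'" using hk(2) unfolding mult_cancel_left by simp_all
  then have "co \<xi> = co \<eta>" by (simp add: co)
  then show ?thesis using assms(2,3) by (simp add: co_inject)
qed

lemma CC_pow: "CC dl [^]\<^bsub>GK c\<^esub> (k :: nat) = CC (dl ^ k)"
proof (induction k)
  case 0
  then show ?case using CC_to_ac[of 1] by simp
next
  case (Suc k)
  then show ?case using dl by (simp add: CC_mult mult.commute)
qed

lemma CC_conj:
  assumes "\<xi> \<in> F2"
  shows "CC (dl ^ i) \<cdot> GG \<xi> \<cdot> inv\<^bsub>GK c\<^esub> CC (dl ^ i) = GG (\<xi> * dl ^ i / (dl ^ i) ^ q)"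
  unfolding CC_GG[OF dl_pow assms] using dl by (simp add: G.m_assoc)

lemma conj_a: "G.conj_pow (CC dl) i (GG \<iota>) = GG (xiA i)"
  unfolding CC_pow xiA_def by (rule CC_conj) simp

lemma conj_b: "G.conj_pow (CC dl) j (GG (\<iota> / ze)) = GG (xiB j)"
  unfolding CC_pow xiB_def by (rule CC_conj) (use ze in simp)

text \<open>The exponent i + q i' represents i - i' modulo q + 1.\<close>

lemma dl_eq_mod:
  assumes "dl ^ i = to_ac x * dl ^ i'"
  shows "(q + 1) dvd (i + q * i')"
proof -
  have "dl ^ (i + q * i') = to_ac x * (dl ^ i' * dl ^ (q * i'))"
    unfolding power_add assms by (simp only: mult.assoc)
  also have "dl ^ i' * dl ^ (q * i') = dl ^ ((q + 1) * i')"
    unfolding power_add[symmetric] by (simp add: algebra_simps)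
  also have "\<dots> = to_ac (nrm2 c (co dl) ^ i')"
    unfolding power_mult dl_pow_Suc_q(1) to_ac_power ..
  also have "to_ac x * \<dots> = to_ac (x * nrm2 c (co dl) ^ i')" by (simp only: to_ac_mult)
  finally show ?thesis by (rule dl_pow_scalar)
qed

text \<open>w / w^q determines w up to a factor fixed by the q-th power map, that is up to a
  scalar.\<close>

lemma xiA_eq_imp: "xiA i = xiA i' \<Longrightarrow> \<exists>x. dl ^ i = to_ac x * dl ^ i'"
  and xiB_eq_imp: "xiB i = xiB i' \<Longrightarrow> \<exists>x. dl ^ i = to_ac x * dl ^ i'"
proof -
  have *: "\<exists>x. dl ^ i = to_ac x * dl ^ i'" if "dl ^ i / (dl ^ i) ^ q = dl ^ i' / (dl ^ i') ^ q"
  proof -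
    have nz: "(dl ^ i) ^ q \<noteq> 0" "(dl ^ i') ^ q \<noteq> 0" using dl by simp_all
    have "dl ^ i * (dl ^ i') ^ q = dl ^ i' * (dl ^ i) ^ q"
      using that unfolding frac_eq_eq[OF nz] .
    then have "(dl ^ i / dl ^ i') ^ q = dl ^ i / dl ^ i'"
      unfolding power_divide frac_eq_eq[OF nz(2) dl_pow(2)] by (simp only: mult.commute)
    then obtain x where "dl ^ i / dl ^ i' = to_ac x" using pow_q_eq_self[of "dl ^ i / dl ^ i'"] by auto
    then have "dl ^ i = to_ac x * dl ^ i'" unfolding divide_eq_eq using dl_pow(2)[of i'] by simp
    then show ?thesis by blast
  qed
  show "xiA i = xiA i' \<Longrightarrow> \<exists>x. dl ^ i = to_ac x * dl ^ i'"
    unfolding xiA_def times_divide_eq_right[symmetric] mult_cancel_left using * \<iota>_nonzero by blast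
  have "\<iota> / ze \<noteq> 0" using ze by simp
  then show "xiB i = xiB i' \<Longrightarrow> \<exists>x. dl ^ i = to_ac x * dl ^ i'"
    unfolding xiB_def times_divide_eq_right[symmetric] mult_cancel_left using * by blast
qed

text \<open>A nonzero norm is carried along because \<open>cl\<close> is multiplicative on
  invertible quaternions.\<close>

lemma foldr_cl:
  assumes P: "group P" and \<phi>: "\<phi> \<in> hom P (GK c)" and us: "set us \<subseteq> carrier P" and t: "t \<in> carrier P"
    and f: "\<And>u. u \<in> set us \<Longrightarrow> \<phi> u = cl (gpoly (f u))"
    and W: "\<phi> t = cl W" "pnorm c W \<noteq> 0"
  shows "\<phi> (foldr (\<otimes>\<^bsub>P\<^esub>) us t) = cl (word_poly (map f us) W) \<and> pnorm c (word_poly (map f us) W) \<noteq> 0"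
  using us f
proof (induction us)
  case (Cons u us)
  interpret P: group P by (rule P)
  let ?t = "foldr (\<otimes>\<^bsub>P\<^esub>) us t"
  have IH: "\<phi> ?t = cl (word_poly (map f us) W)" "pnorm c (word_poly (map f us) W) \<noteq> 0"
    using Cons by auto
  have "?t \<in> carrier P" using Cons.prems t by (intro P.foldr_mult_closed) auto
  then have "\<phi> (u \<otimes>\<^bsub>P\<^esub> ?t) = cl (gpoly (f u)) \<cdot> cl (word_poly (map f us) W)"
    using Cons.prems by (simp add: hom_mult[OF \<phi>] IH)
  then have "\<phi> (u \<otimes>\<^bsub>P\<^esub> ?t) = cl (word_poly (map f (u # us)) W)"
    using IH(2) by (simp add: cl_mult)
  moreover have "pnorm c (word_poly (map f (u # us)) W) \<noteq> 0"
    using IH(2) by (simp add: qnorm_mult)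
  ultimately show ?case by simp
qed (use W in simp)

text \<open>\<open>D\<close> contains d and, for G(R), also s; \<open>H\<close> stands for the
  stabilizer. An element of the kernel is put into normal form in \<open>P\<close> and mapped to a
  product of polynomial quaternions. Different conjugates of a, and likewise of b, have different
  parameters, so the product is still reduced; being scalar, it has no letters. What remains lies in
  \<open>H\<close>. Its image has no factor F, and a power of \<delta> is scalar only if q + 1
  divides the exponent, so it is trivial in \<open>P\<close> as well.\<close>

lemma hom_injective:
  fixes P :: "('g, 'm) monoid_scheme"
  assumes P: "group P" and \<phi>: "\<phi> \<in> hom P (GK c)"
    and mem: "d \<in> carrier P" "a \<in> carrier P" "b \<in> carrier P"
    and vals: "\<phi> d = CC dl" "\<phi> a = GG \<iota>" "\<phi> b = GG (\<iota> / ze)"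
    and gen: "generate P (insert a (insert b D)) = carrier P"
    and d: "d [^]\<^bsub>P\<^esub> (q + 1) = \<one>\<^bsub>P\<^esub>" and a: "a \<otimes>\<^bsub>P\<^esub> a = \<one>\<^bsub>P\<^esub>" and b: "b \<otimes>\<^bsub>P\<^esub> b = \<one>\<^bsub>P\<^esub>"
    and squares: "\<And>i j k l. i \<le> q \<Longrightarrow> j \<le> q \<Longrightarrow> k \<le> q \<Longrightarrow> l \<le> q \<Longrightarrow> star_cond c (zq dl) (zq ze) i j k l \<Longrightarrow>
       group.conj_pow P d i a \<otimes>\<^bsub>P\<^esub> group.conj_pow P d j b = group.conj_pow P d l b \<otimes>\<^bsub>P\<^esub> group.conj_pow P d k a"
    and D: "\<And>s. s \<in> D \<Longrightarrow> \<exists>n::nat>0. s [^]\<^bsub>P\<^esub> n = \<one>\<^bsub>P\<^esub>"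
    and Dconj: "\<And>s x i. s \<in> D \<Longrightarrow> x = a \<or> x = b \<Longrightarrow>
       \<exists>i'. s \<otimes>\<^bsub>P\<^esub> group.conj_pow P d i x = group.conj_pow P d i' x \<otimes>\<^bsub>P\<^esub> s"
    and H: "H \<subseteq> carrier P" "\<one>\<^bsub>P\<^esub> \<in> H" and DH: "\<And>s h. s \<in> D \<Longrightarrow> h \<in> H \<Longrightarrow> s \<otimes>\<^bsub>P\<^esub> h \<in> H"
    and H\<phi>: "\<And>h. h \<in> H \<Longrightarrow> \<exists>i::nat. h = d [^]\<^bsub>P\<^esub> i \<or> \<phi> h = CC (dl ^ i) \<cdot> SS"
  shows "inj_on \<phi> (carrier P)"
proof -
  interpret P: group P by (rule P)
  interpret \<phi>: group_hom P "GK c" \<phi> using \<phi> by unfold_locales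
  define U where "U = range (\<lambda>i. P.conj_pow d i a)"
  define V where "V = range (\<lambda>j. P.conj_pow d j b)"
  have d': "d [^]\<^bsub>P\<^esub> Suc q = \<one>\<^bsub>P\<^esub>" using d by simp
  note mod = P.pow_mod[OF mem(1) d']
  have UV: "U \<subseteq> carrier P" "V \<subseteq> carrier P" using mem by (auto simp: U_def V_def)
  have invU: "u \<otimes>\<^bsub>P\<^esub> u = \<one>\<^bsub>P\<^esub>" if "u \<in> U" for u
    using that P.conj_pow_square[OF mem(1) d' mem(2) a] unfolding U_def by blast
  have invV: "u \<otimes>\<^bsub>P\<^esub> u = \<one>\<^bsub>P\<^esub>" if "u \<in> V" for u
    using that P.conj_pow_square[OF mem(1) d' mem(3) b] unfolding V_def by blast
  have swap: "\<exists>u'\<in>U. \<exists>v'\<in>V. v \<otimes>\<^bsub>P\<^esub> u = u' \<otimes>\<^bsub>P\<^esub> v'" if uv: "u \<in> U" "v \<in> V" for u v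
  proof -
    obtain i0 l0 where "u = P.conj_pow d i0 a" "v = P.conj_pow d l0 b" using uv unfolding U_def V_def by blast
    then obtain i l where il: "i \<le> q" "l \<le> q" "u = P.conj_pow d i a" "v = P.conj_pow d l b"
      using that mod[of i0] mod[of l0] mod_less_divisor[of "Suc q" i0] mod_less_divisor[of "Suc q" l0]
      by (metis less_Suc_eq_le zero_less_Suc)
    obtain j k where jk: "j \<le> q" "k \<le> q" "star_cond c (zq dl) (zq ze) i j k l" using star_exists[of i l] by blast
    let ?u = "P.conj_pow d k a" and ?v = "P.conj_pow d j b"
    \<comment> \<open>Multiplying this relation by the involution v on the left and by ?v on the
      right turns it into the swap v u = ?u ?v.\<close>
    have rel: "u \<otimes>\<^bsub>P\<^esub> ?v = v \<otimes>\<^bsub>P\<^esub> ?u" using squares[OF il(1) jk(1,2) il(2) jk(3)] unfolding il(3,4) .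
    have m: "?u \<in> U" "?v \<in> V" unfolding U_def V_def by blast+
    have c: "u \<in> carrier P" "v \<in> carrier P" "?u \<in> carrier P" "?v \<in> carrier P" using uv m UV by blast+
    have "v \<otimes>\<^bsub>P\<^esub> u = v \<otimes>\<^bsub>P\<^esub> (u \<otimes>\<^bsub>P\<^esub> ?v) \<otimes>\<^bsub>P\<^esub> ?v"
      using c invV[OF m(2)] P.m_assoc[of u ?v ?v] P.m_assoc[of v "u \<otimes>\<^bsub>P\<^esub> ?v" ?v] by (simp del: P.m_assoc)
    also have "\<dots> = (v \<otimes>\<^bsub>P\<^esub> v) \<otimes>\<^bsub>P\<^esub> ?u \<otimes>\<^bsub>P\<^esub> ?v" unfolding rel using c P.m_assoc[of v v ?u] by simp
    also have "\<dots> = ?u \<otimes>\<^bsub>P\<^esub> ?v" unfolding invV[OF uv(2)] using c by simp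
    finally show ?thesis using m by blast
  qed
  have DU: "\<exists>u'\<in>U. s \<otimes>\<^bsub>P\<^esub> u = u' \<otimes>\<^bsub>P\<^esub> s" if "s \<in> D" "u \<in> U" for s u
    using that Dconj[of s a] unfolding U_def by blast
  have DV: "\<exists>v'\<in>V. s \<otimes>\<^bsub>P\<^esub> v = v' \<otimes>\<^bsub>P\<^esub> s" if "s \<in> D" "v \<in> V" for s v
    using that Dconj[of s b] unfolding V_def by blast
  have aU: "a \<in> U" and bV: "b \<in> V"
    unfolding U_def V_def using mem by (auto intro!: image_eqI[of _ _ "0 :: nat"])
  have \<phi>pow: "\<phi> (d [^]\<^bsub>P\<^esub> i) = CC (dl ^ i)" for i :: nat
    using mem by (simp add: \<phi>.hom_nat_pow vals CC_pow)
  have \<phi>A: "\<phi> (P.conj_pow d i a) = GG (xiA i)" and \<phi>B: "\<phi> (P.conj_pow d i b) = GG (xiB i)" for i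
    using mem by (simp_all add: \<phi>pow vals conj_a[unfolded CC_pow] conj_b[unfolded CC_pow])
  \<comment> \<open>Proportional powers of \<delta> have exponents congruent modulo q + 1, and
    d^(q+1) = 1 is a relation in \<open>P\<close>.\<close>
  have pow_eq: "d [^]\<^bsub>P\<^esub> i = d [^]\<^bsub>P\<^esub> i'" if x: "dl ^ i = to_ac x * dl ^ i'" for i i' x
  proof -
    obtain m where m: "i + q * i' = Suc q * m" using dl_eq_mod[OF x] by (auto elim: dvdE)
    have "d [^]\<^bsub>P\<^esub> i = d [^]\<^bsub>P\<^esub> i \<otimes>\<^bsub>P\<^esub> d [^]\<^bsub>P\<^esub> (Suc q * i')"
      unfolding P.pow_mult_Suc[OF mem(1) d'] using mem by simp
    also have "\<dots> = d [^]\<^bsub>P\<^esub> (i + Suc q * i')" using mem(1) by (simp only: P.nat_pow_mult)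
    also have "i + Suc q * i' = Suc q * m + i'" using m by simp
    also have "d [^]\<^bsub>P\<^esub> (Suc q * m + i') = d [^]\<^bsub>P\<^esub> (Suc q * m) \<otimes>\<^bsub>P\<^esub> d [^]\<^bsub>P\<^esub> i'"
      using mem(1) by (simp only: P.nat_pow_mult)
    finally show ?thesis unfolding P.pow_mult_Suc[OF mem(1) d'] using mem by simp
  qed
  have injU: "inj_on \<phi> U"
  proof (rule inj_onI)
    fix u u' assume u: "u \<in> U" "u' \<in> U" and eq: "\<phi> u = \<phi> u'"
    obtain i i' where ii: "u = P.conj_pow d i a" "u' = P.conj_pow d i' a" using u unfolding U_def by blast
    have "xiA i = xiA i'" using eq unfolding ii \<phi>A by (rule GG_inject) simp_all
    then obtain x where "dl ^ i = to_ac x * dl ^ i'" using xiA_eq_imp by blast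
    then show "u = u'" unfolding ii using pow_eq by simp
  qed
  have injV: "inj_on \<phi> V"
  proof (rule inj_onI)
    fix u u' assume u: "u \<in> V" "u' \<in> V" and eq: "\<phi> u = \<phi> u'"
    obtain i i' where ii: "u = P.conj_pow d i b" "u' = P.conj_pow d i' b" using u unfolding V_def by blast
    have "xiB i = xiB i'" using eq unfolding ii \<phi>B by (rule GG_inject) simp_all
    then obtain x where "dl ^ i = to_ac x * dl ^ i'" using xiB_eq_imp by blast
    then show "u = u'" unfolding ii using pow_eq by simp
  qed
  have "\<forall>u\<in>U. \<exists>\<xi>. \<xi> \<in> vertsA \<and> \<phi> u = cl (gpoly \<xi>)"
    unfolding U_def using \<phi>A xiA_vertsA unfolding GG_def by blast
  then obtain f where f: "\<And>u. u \<in> U \<Longrightarrow> f u \<in> vertsA \<and> \<phi> u = cl (gpoly (f u))" by metis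
  have "\<forall>v\<in>V. \<exists>\<eta>. \<eta> \<in> vertsB \<and> \<phi> v = cl (gpoly \<eta>)"
    unfolding V_def using \<phi>B xiB_vertsB unfolding GG_def by blast
  then obtain g where g: "\<And>v. v \<in> V \<Longrightarrow> g v \<in> vertsB \<and> \<phi> v = cl (gpoly (g v))" by metis
  have fU: "inj_on f U"
  proof (rule inj_onI)
    fix u u' assume u: "u \<in> U" "u' \<in> U" "f u = f u'"
    then have "\<phi> u = \<phi> u'" using f[of u] f[of u'] by simp
    then show "u = u'" using injU u(1,2) by (auto dest: inj_onD)
  qed
  have gV: "inj_on g V"
  proof (rule inj_onI)
    fix u u' assume u: "u \<in> V" "u' \<in> V" "g u = g u'"
    then have "\<phi> u = \<phi> u'" using g[of u] g[of u'] by simp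
    then show "u = u'" using injV u(1,2) by (auto dest: inj_onD)
  qed
  have "x = \<one>\<^bsub>P\<^esub>" if x: "x \<in> carrier P" and \<phi>x: "\<phi> x = \<one>\<^bsub>GK c\<^esub>" for x
  proof -
    obtain us vs h where nf: "set us \<subseteq> U" "set vs \<subseteq> V" "h \<in> H" "distinct_adj us" "distinct_adj vs"
      "x = foldr (\<otimes>\<^bsub>P\<^esub>) us (foldr (\<otimes>\<^bsub>P\<^esub>) vs h)"
      by (rule P.normal_form[OF gen D aU bV UV invU invV swap DU DV H DH x])
    obtain i where i: "h = d [^]\<^bsub>P\<^esub> i \<or> \<phi> h = CC (dl ^ i) \<cdot> SS" using H\<phi>[OF nf(3)] by blast
    let ?x = "fst (co (dl ^ i))" and ?y = "snd (co (dl ^ i))"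
    have xy: "(?x, ?y) \<noteq> (0, 0)"
    proof
      assume "(?x, ?y) = (0, 0)"
      then have "quad (co (dl ^ i)) = 0" unfolding quad_eq_0_iff by (simp add: prod_eq_iff)
      then show False using dl_pow[of i] by simp
    qed
    then have nz: "nrm2 c (?x, ?y) \<noteq> 0" unfolding nrm2_eq_0_iff .
    \<comment> \<open>The last clause records that in the case of F_q[Z] the element h itself, not
      only its image, is the power of d.\<close>
    obtain W where W: "\<phi> h = cl W" "W = cquat ?x ?y \<or> W = cquatF ?x ?y" "pnorm c W \<noteq> 0"
      "W = cquat ?x ?y \<longrightarrow> h = d [^]\<^bsub>P\<^esub> i"
    proof (cases "h = d [^]\<^bsub>P\<^esub> i")
      case True
      then have "\<phi> h = cl (cquat ?x ?y)" by (simp add: \<phi>pow CC_def)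
      moreover have "pnorm c (cquat ?x ?y) \<noteq> 0" using nz by (simp add: pnorm_cquat)
      ultimately show thesis using that True by blast
    next
      case False
      then have "\<phi> h = cl (cquatF ?x ?y)" using i CC_SS_cl[OF dl_pow] by simp
      moreover have "pnorm c (cquatF ?x ?y) \<noteq> 0" using nz by (simp add: pnorm_cquatF)
      moreover have "cquatF ?x ?y \<noteq> cquat ?x ?y"
      proof
        assume "cquatF ?x ?y = cquat ?x ?y"
        then have "?x = 0" "?y = 0" by (simp_all add: cquat_def cquatF_def)
        from arg_cong2[OF this, of Pair] show False using xy by contradiction
      qed
      ultimately show thesis using that by metis
    qed
    have hc: "h \<in> carrier P" using nf(3) H(1) by blast
    have vsc: "set vs \<subseteq> carrier P" and usc: "set us \<subseteq> carrier P" using nf UV by blast+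
    have fv: "\<And>u. u \<in> set vs \<Longrightarrow> \<phi> u = cl (gpoly (g u))" and fu: "\<And>u. u \<in> set us \<Longrightarrow> \<phi> u = cl (gpoly (f u))"
      using f g nf(1,2) by blast+
    note 1 = foldr_cl[OF P \<phi> vsc hc fv W(1,3)]
    note 2 = foldr_cl[OF P \<phi> usc P.foldr_mult_closed[OF vsc hc] fu conjunct1[OF 1] conjunct2[OF 1]]
    have "cl (word_poly (map f us) (word_poly (map g vs) W)) = \<one>\<^bsub>GK c\<^esub>"
      using 2 \<phi>x unfolding nf(6) by simp
    then obtain e where e: "word_poly (map f us) (word_poly (map g vs) W) = Quat e 0 0 0"
      using cl_eq_one conjunct2[OF 2] by blast
    have "map f us = [] \<and> map g vs = []"
    proof (rule word_poly_not_scalar[OF _ _ _ _ W(2) xy e])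
      show "set (map f us) \<subseteq> vertsA" "set (map g vs) \<subseteq> vertsB" using f g nf(1,2) by auto
      show "distinct_adj (map f us)" "distinct_adj (map g vs)"
        using nf fU gV by (auto intro!: distinct_adj_mapI intro: inj_on_subset)
    qed
    then have [simp]: "us = []" "vs = []" by simp_all
    have We: "W = Quat e 0 0 0" using e by simp
    have "W = cquat ?x ?y"
    proof (rule ccontr)
      assume "W \<noteq> cquat ?x ?y"
      then have "W = cquatF ?x ?y" using W(2) by blast
      then have x0: "?x = 0" and y0: "?y = 0" using We by (simp_all add: cquatF_def)
      show False using arg_cong2[OF x0 y0, of Pair] xy by contradiction
    qed
    then have "?y = 0" and h: "h = d [^]\<^bsub>P\<^esub> i" using We W(4) by (simp_all add: cquat_def)
    then have "dl ^ i = to_ac ?x * dl ^ 0"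
      using quad_co[OF dl_pow(1)[of i]] by (simp add: quad_def)
    then have "h = d [^]\<^bsub>P\<^esub> (0 :: nat)" unfolding h by (rule pow_eq)
    then show ?thesis using nf(6) by simp
  qed
  then show ?thesis unfolding \<phi>.inj_on_one_iff by blast
qed

section \<open>Verification of the relations, generation, and the final assembly\<close>

section \<open>The presentations\<close>

abbreviation gv :: "gens \<Rightarrow> 'a poly fract quat set" where
  "gv \<equiv> gen_val c (zq dl) (zq ze)"

lemma gv_simps: "gv Gd = CC dl" "gv Gs = SS" "gv Ga = GG \<iota>" "gv Gb = GG (\<iota> / ze)"
proof -
  have "elZ \<otimes>\<^bsub>DK c\<^esub> inv\<^bsub>DK c\<^esub> zq ze = zq (\<iota> / ze)"
    unfolding zq_\<iota> zq_inv(2)[OF ze] using ze by (simp add: zq_mult divide_inverse)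
  then show "gv Gb = GG (\<iota> / ze)" by (simp add: GG_eq)
  show "gv Ga = GG \<iota>" by (simp add: GG_eq zq_\<iota>)
qed (simp_all add: CC_eq SS_eq)

lemma gv_closed: "gv ` S \<subseteq> carrier (GK c)"
proof (rule image_subsetI)
  fix x :: gens
  show "gv x \<in> carrier (GK c)" using dl by (cases x) (simp_all only: gv_simps CC_closed GG_closed SS_closed not_False_eq_True)
qed

lemma CC_dl_order: "CC dl [^]\<^bsub>GK c\<^esub> (q + 1) = \<one>\<^bsub>GK c\<^esub>"
  unfolding CC_pow dl_pow_Suc_q(1) using dl_pow_Suc_q(2) by (rule CC_to_ac)

lemma CC_dl_SS: "(CC dl \<cdot> SS) \<cdot> (CC dl \<cdot> SS) = \<one>\<^bsub>GK c\<^esub>"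
proof -
  have q: "dl ^ q \<in> F2" "dl ^ q \<noteq> 0" using dl by simp_all
  have "(CC dl \<cdot> SS) \<cdot> (CC dl \<cdot> SS) = CC dl \<cdot> (SS \<cdot> CC dl) \<cdot> SS"
    using dl by (simp add: G.m_assoc)
  also have "\<dots> = CC dl \<cdot> CC (dl ^ q) \<cdot> (SS \<cdot> SS)"
    unfolding SS_CC[OF dl] using dl by (simp add: G.m_assoc)
  also have "\<dots> = CC (dl ^ (q + 1))" unfolding CC_mult[OF dl q] SS_square using dl by simp
  also have "\<dots> = \<one>\<^bsub>GK c\<^esub>" using CC_dl_order unfolding CC_pow .
  finally show ?thesis .
qed

lemma SS_GG_iota: "(SS \<cdot> GG \<iota>) \<cdot> (SS \<cdot> GG \<iota>) = \<one>\<^bsub>GK c\<^esub>"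
proof -
  have "SS \<cdot> GG \<iota> = GG \<iota> \<cdot> SS" using SS_GG[of \<iota>] by (simp add: frobenius_\<iota>)
  then have "(SS \<cdot> GG \<iota>) \<cdot> (SS \<cdot> GG \<iota>) = (GG \<iota> \<cdot> SS) \<cdot> (SS \<cdot> GG \<iota>)" by simp
  also have "\<dots> = GG \<iota> \<cdot> (SS \<cdot> SS) \<cdot> GG \<iota>" by (simp add: G.m_assoc)
  finally show ?thesis by (simp add: SS_square GG_square)
qed

text \<open>Let t be the class of F\<zeta>. It commutes with b, since \<zeta> takes the parameter
  Z/\<zeta> to Z/\<zeta>^q and F takes it back; and t^2 is the class of the scalar N(\<zeta>), hence
  trivial.\<close>

lemma SS_CC_GG:
  "(SS \<cdot> (CC ze \<cdot> GG (\<iota> / ze))) \<cdot> (SS \<cdot> (CC ze \<cdot> GG (\<iota> / ze))) = \<one>\<^bsub>GK c\<^esub>"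
proof -
  let ?b = "GG (\<iota> / ze)" and ?t = "SS \<cdot> CC ze"
  have q: "ze ^ q \<in> F2" "ze ^ q \<noteq> 0" using ze by simp_all
  have cl: "?t \<in> carrier (GK c)" "?b \<in> carrier (GK c)" using ze by simp_all
  have \<iota>q: "\<iota> / ze ^ q \<in> F2" "\<iota> / ze \<in> F2" using ze q by simp_all
  have "CC ze \<cdot> ?b = GG (\<iota> / ze ^ q) \<cdot> CC ze"
    using CC_GG[OF ze \<iota>q(2)] ze by simp
  then have "SS \<cdot> (CC ze \<cdot> ?b) = (SS \<cdot> GG (\<iota> / ze ^ q)) \<cdot> CC ze"
    using ze by (simp add: G.m_assoc)
  also have "SS \<cdot> GG (\<iota> / ze ^ q) = ?b \<cdot> SS"
    unfolding SS_GG[OF \<iota>q(1)] using ze by (simp add: power_divide frobenius_\<iota>)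
  finally have 1: "SS \<cdot> (CC ze \<cdot> ?b) = ?b \<cdot> ?t"
    using ze by (simp add: G.m_assoc)
  have 2: "SS \<cdot> (CC ze \<cdot> ?b) = ?t \<cdot> ?b"
    using ze by (simp add: G.m_assoc)
  have "?t \<cdot> ?t = CC (ze ^ q) \<cdot> (SS \<cdot> SS) \<cdot> CC ze"
    using G.m_assoc[of "CC (ze ^ q)" SS] ze q unfolding SS_CC[OF ze]
    by (simp add: G.m_assoc SS_CC[OF ze, symmetric])
  also have "\<dots> = CC (ze * ze ^ q)" unfolding SS_square using ze q by (simp add: CC_mult mult.commute)
  also have "\<dots> = \<one>\<^bsub>GK c\<^esub>" unfolding ze_norm using \<tau> by (intro CC_to_ac) simp
  finally have t: "?t \<cdot> ?t = \<one>\<^bsub>GK c\<^esub>" .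
  have "(?b \<cdot> ?t) \<cdot> (?t \<cdot> ?b) = ?b \<cdot> (?t \<cdot> ?t) \<cdot> ?b"
    using cl by (simp only: G.m_assoc G.m_closed)
  also have "\<dots> = \<one>\<^bsub>GK c\<^esub>" unfolding t using cl by (simp add: GG_square)
  finally show ?thesis using 1 2 by simp
qed

lemma ze_eq_mod_iff: "eq_mod_Fq c (zq dl [^]\<^bsub>DK c\<^esub> (m :: nat)) (zq ze) \<longleftrightarrow> (\<exists>x. dl ^ m = to_ac x * ze)"
  unfolding zq_pow[OF dl(1)] eq_mod_Fq_zq[OF dl_pow(1) ze(1)] using ze dl_pow(2)[of m] by blast

lemma satisfies_GK':
  assumes "{Gd, Ga, Gb} \<subseteq> S"
  shows "satisfies (GK c) gv (relsR' c (zq dl) (zq ze))"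
  unfolding G.satisfies_relsR'_iff[OF gv_closed assms] G.satisfies_square_rels_iff[OF gv_closed assms]
    gv_simps conj_a conj_b CARD_q CC_dl_order GG_square
  using star_relation by blast

lemma satisfies_GK: "satisfies (GK c) gv (relsR c (zq dl) (zq ze))"
proof -
  have "(SS \<cdot> (CC dl [^]\<^bsub>GK c\<^esub> m \<cdot> GG (\<iota> / ze))) \<cdot> (SS \<cdot> (CC dl [^]\<^bsub>GK c\<^esub> m \<cdot> GG (\<iota> / ze))) = \<one>\<^bsub>GK c\<^esub>"
    if "dl ^ m = to_ac x * ze" for m x
  proof -
    have x: "x \<noteq> 0" using that dl_pow(2)[of m] by auto
    then have "CC (dl ^ m) = CC ze"
      unfolding that using ze CC_mult[of "to_ac x" ze] CC_to_ac[OF x] by simp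
    then show ?thesis unfolding CC_pow using SS_CC_GG by simp
  qed
  then show ?thesis
    unfolding G.satisfies_relsR_iff[OF gv_closed order.refl] gv_simps ze_eq_mod_iff
    using SS_square CC_dl_SS SS_GG_iota satisfies_GK'[of "{Gd, Gs, Ga, Gb}"] by blast
qed

lemma Gset_carrier: "g \<in> Gset J \<Longrightarrow> g \<in> carrier (GK c)"
  by (rule subgroup.mem_carrier[OF subgroup_Gset])

lemma hom_Gset:
  assumes "\<phi> \<in> hom P ((GK c)\<lparr>carrier := Gset J\<rparr>)"
  shows "\<phi> \<in> hom P (GK c)"
proof (rule homI)
  fix x assume "x \<in> carrier P"
  then have "\<phi> x \<in> Gset J" using hom_in_carrier[OF assms] by simp
  then show "\<phi> x \<in> carrier (GK c)" by (rule Gset_carrier)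
next
  fix x y assume "x \<in> carrier P" "y \<in> carrier P"
  then show "\<phi> (x \<otimes>\<^bsub>P\<^esub> y) = \<phi> x \<cdot> \<phi> y" using hom_mult[OF assms] by simp
qed

text \<open>The inclusion of the subgroup is a homomorphism, so the inverses taken in the two groups
  agree.\<close>

lemma word_eval_Gset:
  assumes S: "gv ` S \<subseteq> Gset J" and w: "w \<in> words S"
  shows "word_eval ((GK c)\<lparr>carrier := Gset J\<rparr>) gv w = word_eval (GK c) gv w"
proof -
  let ?K = "(GK c)\<lparr>carrier := Gset J\<rparr>"
  have id: "id \<in> hom ?K (GK c)" by (rule hom_Gset[of id ?K J]) (simp add: hom_def)
  have C: "carrier ?K = Gset J" by simp
  have S': "gv ` S \<subseteq> carrier ?K" unfolding C by (rule S)
  have "id (word_eval ?K gv w) = word_eval (GK c) (id \<circ> gv) w"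
    by (rule word_eval_hom[OF group_Gset group_GK id S' w])
  then show ?thesis by (simp only: id_apply id_o)
qed

lemma satisfies_Gset:
  assumes S: "gv ` S \<subseteq> Gset J" and E: "E \<subseteq> words S \<times> words S" and sat: "satisfies (GK c) gv E"
  shows "satisfies ((GK c)\<lparr>carrier := Gset J\<rparr>) gv E"
  unfolding satisfies_def
proof (intro ballI, clarify)
  fix u v assume uv: "(u, v) \<in> E"
  then have "u \<in> words S" "v \<in> words S" using E by auto
  note ev = this[THEN word_eval_Gset[OF S]]
  show "word_eval ((GK c)\<lparr>carrier := Gset J\<rparr>) gv u = word_eval ((GK c)\<lparr>carrier := Gset J\<rparr>) gv v"
    unfolding ev using bspec[OF sat[unfolded satisfies_def] uv] by (simp only: prod.case)
qed

definition gen_letters :: "bool \<Rightarrow> gens set" where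
  "gen_letters J = (if J then {Gd, Gs, Ga, Gb} else {Gd, Ga, Gb})"

lemma gen_letters_sub: "{Gd, Ga, Gb} \<subseteq> gen_letters J"
  by (auto simp: gen_letters_def)

lemma iota_verts: "\<iota> \<in> verts" "\<iota> / ze \<in> verts"
  using base_norms ze by (simp_all only: verts_def mem_Collect_eq Un_iff vertsA_iff vertsB_iff F2_\<iota> F2_divide simp_thms)

lemma gv_Gset: "gv ` gen_letters J \<subseteq> Gset J"
  using dl iota_verts gv_simps by (auto simp: gen_letters_def simp del: gen_val.simps)

lemma generate_pow_closed:
  assumes "x \<in> generate (GK c) S" "S \<subseteq> carrier (GK c)"
  shows "x [^]\<^bsub>GK c\<^esub> (k :: nat) \<in> generate (GK c) S"
proof (induction k)
  case 0
  then show ?case by (simp add: generate.one)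
next
  case (Suc k)
  then show ?case using assms(1) by (simp add: generate.eng)
qed

lemma CC_generate:
  assumes "CC dl \<in> S" "S \<subseteq> carrier (GK c)" "w \<in> F2" "w \<noteq> 0"
  shows "CC w \<in> generate (GK c) S"
proof -
  obtain k where "w = dl ^ k" using dl_generates assms(3,4) by blast
  then show ?thesis
    using generate_pow_closed[OF generate.incl[OF assms(1)] assms(2), of k] by (simp add: CC_pow)
qed

text \<open>\<open>Gset_induct\<close> reduces generation to the classes of F_q[Z], which are powers
  of d, to F when it is permitted, and to the \<gamma>_\<xi>, which are conjugates of a or
  b.\<close>

lemma generate_gv: "generate (GK c) (gv ` gen_letters J) = Gset J"
proof
  let ?S = "gv ` gen_letters J"
  show "generate (GK c) ?S \<subseteq> Gset J" by (rule G.generate_subgroup_incl[OF gv_Gset subgroup_Gset])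
  have S: "?S \<subseteq> carrier (GK c)" by (rule gv_closed)
  have mem: "CC dl \<in> ?S" "GG \<iota> \<in> ?S" "GG (\<iota> / ze) \<in> ?S"
    unfolding gv_simps[symmetric] using gen_letters_sub by blast+
  have SS: "SS \<in> ?S" if J unfolding gv_simps[symmetric] using that by (simp add: gen_letters_def)
  note sg = G.generate_is_subgroup[OF S]
  show "Gset J \<subseteq> generate (GK c) ?S"
  proof
    fix g assume "g \<in> Gset J"
    then show "g \<in> generate (GK c) ?S"
    proof (induction rule: Gset_induct)
      case (CC w)
      then show ?case by (rule CC_generate[OF mem(1) S])
    next
      case (CC_SS w)
      then show ?case using CC_generate[OF mem(1) S] SS by (auto intro: generate.eng generate.incl)
    next
      case (GG \<xi> t)
      have conj: "G.conj_pow (CC dl) i x \<in> generate (GK c) ?S" if "x \<in> ?S" for i x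
        by (intro subgroup.m_closed[OF sg] subgroup.m_inv_closed[OF sg]
            generate_pow_closed[OF generate.incl[OF mem(1)] S] generate.incl that)
      have "GG \<xi> \<in> generate (GK c) ?S"
        using verts_cases[OF GG(1)] conj[OF mem(2)] conj[OF mem(3)] unfolding conj_a conj_b by auto
      then show ?case using GG(3) by (rule generate.eng)
    qed
  qed
qed

lemma generate_Hset: "generate (GK c) (if J then {CC dl, SS} else {CC dl}) = Hset J"
proof
  let ?S = "if J then {CC dl, SS} else {CC dl}"
  have S: "?S \<subseteq> carrier (GK c)" using dl by simp
  have cases: "s = CC dl \<or> J \<and> s = SS" if "s \<in> ?S" for s
    using that by (cases J) auto
  have SSd: "SS [^]\<^bsub>GK c\<^esub> (2 :: nat) = \<one>\<^bsub>GK c\<^esub>" by (simp add: numeral_2_eq_2 SS_square)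
  have pos: "(0 :: nat) < q + 1" "(0 :: nat) < 2" by simp_all
  show "generate (GK c) ?S \<subseteq> Hset J"
  proof
    fix g assume g: "g \<in> generate (GK c) ?S"
    show "g \<in> Hset J"
    proof (rule G.generate_left_induct[OF g])
      fix s assume s: "s \<in> ?S"
      have "\<exists>m::nat>0. s [^]\<^bsub>GK c\<^esub> m = \<one>\<^bsub>GK c\<^esub>"
        using cases[OF s]
      proof
        assume "s = CC dl"
        then show ?thesis
          using CC_dl_order pos(1) by (intro exI[of _ "q + 1"] conjI) (simp_all only:)
      next
        assume "J \<and> s = SS"
        then show ?thesis using SSd pos(2) by (intro exI[of _ 2] conjI) (simp_all only:)
      qed
      then show "s \<in> carrier (GK c) \<and> (\<exists>m::nat>0. s [^]\<^bsub>GK c\<^esub> m = \<one>\<^bsub>GK c\<^esub>)" using S s by blast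
      fix x assume x: "x \<in> Hset J"
      show "s \<cdot> x \<in> Hset J"
        using cases[OF s]
      proof
        assume "s = CC dl"
        then show ?thesis using CC_mult_Hset[OF dl x] by (simp only:)
      next
        assume "J \<and> s = SS"
        moreover from this have "J = True" by blast
        ultimately show ?thesis using SS_mult_Hset[of x] x by (simp only:)
      qed
    next
      have "CC 1 \<in> CC ` (F2 - {0})" by simp
      then have "CC 1 \<in> Hset J" unfolding Hset_def by (rule UnI1)
      then show "\<one>\<^bsub>GK c\<^esub> \<in> Hset J" using CC_to_ac[of 1] by simp
      show "Hset J \<subseteq> carrier (GK c)" using Hset_subset Gset_carrier by blast
    qed
  qed
  have CCd: "CC dl \<in> ?S" by simp
  show "Hset J \<subseteq> generate (GK c) ?S"
  proof
    fix h assume "h \<in> Hset J"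
    then show "h \<in> generate (GK c) ?S"
    proof (cases rule: HsetE)
      case (1 w)
      then show ?thesis using CC_generate[OF CCd S] by blast
    next
      case (2 w)
      then have "SS \<in> ?S" by simp
      show ?thesis
        unfolding 2(4) by (rule generate.eng[OF CC_generate[OF CCd S 2(2,3)] generate.incl[OF \<open>SS \<in> ?S\<close>]])
    qed
  qed
qed

lemma presentation_R':
  "has_finite_presentation ((GK c)\<lparr>carrier := Gset False\<rparr>) gv {Gd, Ga, Gb} (relsR' c (zq dl) (zq ze))"
proof (rule has_finite_presentationI[OF group_Gset])
  let ?K = "(GK c)\<lparr>carrier := Gset False\<rparr>" and ?S = "{Gd, Ga, Gb}"
  have SF: "gen_letters False = ?S" by (simp add: gen_letters_def)
  have GF: "gv ` ?S \<subseteq> Gset False" using gv_Gset[of False] unfolding SF .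
  show "finite ?S" "finite (relsR' c (zq dl) (zq ze))" by (simp_all add: finite_relsR)
  show "relsR' c (zq dl) (zq ze) \<subseteq> words ?S \<times> words ?S" by (rule relsR_words)
  show "satisfies ?K gv (relsR' c (zq dl) (zq ze))"
    by (rule satisfies_Gset[OF GF relsR_words(2) satisfies_GK'[OF order.refl]])
  show "generate ?K (gv ` ?S) = carrier ?K"
    using G.generate_consistent[OF GF subgroup_Gset] generate_gv[of False] unfolding SF by simp
  fix P :: "gens word set monoid" and h \<phi>
  assume P: "group P" and h: "h ` ?S \<subseteq> carrier P" and gen: "generate P (h ` ?S) = carrier P"
    and sat: "satisfies P h (relsR' c (zq dl) (zq ze))" and \<phi>: "\<phi> \<in> hom P ?K"
    and \<phi>h: "\<And>x. x \<in> ?S \<Longrightarrow> \<phi> (h x) = gv x"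
  interpret P: group P by (rule P)
  note sat' = sat[unfolded P.satisfies_relsR'_iff[OF h order.refl] P.satisfies_square_rels_iff[OF h order.refl] CARD_q]
  have mem: "h Gd \<in> carrier P" "h Ga \<in> carrier P" "h Gb \<in> carrier P" using h by auto
  have dq: "h Gd [^]\<^bsub>P\<^esub> (q + 1) = \<one>\<^bsub>P\<^esub>" using sat' by blast
  then have dq': "h Gd [^]\<^bsub>P\<^esub> Suc q = \<one>\<^bsub>P\<^esub>" by simp
  show "inj_on \<phi> (carrier P)"
  \<comment> \<open>For R' the stabilizer is cyclic, so \<open>H\<close> consists of the powers of
    d.\<close>
  proof (rule hom_injective[where D = "{h Gd}" and H = "range (\<lambda>i::nat. h Gd [^]\<^bsub>P\<^esub> i)", OF P _ mem])
    show "\<phi> \<in> hom P (GK c)" using \<phi> by (rule hom_Gset)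
    show "\<phi> (h Gd) = CC dl" "\<phi> (h Ga) = GG \<iota>" "\<phi> (h Gb) = GG (\<iota> / ze)"
      by (simp_all only: \<phi>h gv_simps insert_iff simp_thms)
    show "generate P (insert (h Ga) (insert (h Gb) {h Gd})) = carrier P"
      using gen by (simp add: insert_commute)
    show "h Gd [^]\<^bsub>P\<^esub> (q + 1) = \<one>\<^bsub>P\<^esub>" by (rule dq)
    show "h Ga \<otimes>\<^bsub>P\<^esub> h Ga = \<one>\<^bsub>P\<^esub>" "h Gb \<otimes>\<^bsub>P\<^esub> h Gb = \<one>\<^bsub>P\<^esub>" using sat' by blast+
    show "P.conj_pow (h Gd) i (h Ga) \<otimes>\<^bsub>P\<^esub> P.conj_pow (h Gd) j (h Gb) = P.conj_pow (h Gd) l (h Gb) \<otimes>\<^bsub>P\<^esub> P.conj_pow (h Gd) k (h Ga)"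
      if "i \<le> q" "j \<le> q" "k \<le> q" "l \<le> q" "star_cond c (zq dl) (zq ze) i j k l" for i j k l
      using sat' that by blast
    show "\<exists>m::nat>0. s [^]\<^bsub>P\<^esub> m = \<one>\<^bsub>P\<^esub>" if "s \<in> {h Gd}" for s
      using that dq by (intro exI[of _ "q + 1"]) simp
    show "\<exists>i'. s \<otimes>\<^bsub>P\<^esub> P.conj_pow (h Gd) i x = P.conj_pow (h Gd) i' x \<otimes>\<^bsub>P\<^esub> s"
      if "s \<in> {h Gd}" "x = h Ga \<or> x = h Gb" for s x i
    proof -
      have "x \<in> carrier P" using that(2) mem by blast
      then show ?thesis using P.conj_pow_push[OF mem(1) dq'] that(1) by blast
    qed
    show "range (\<lambda>i::nat. h Gd [^]\<^bsub>P\<^esub> i) \<subseteq> carrier P" using mem by auto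
    show "\<one>\<^bsub>P\<^esub> \<in> range (\<lambda>i::nat. h Gd [^]\<^bsub>P\<^esub> i)" by (rule image_eqI[of _ _ "0 :: nat"]) simp_all
    show "s \<otimes>\<^bsub>P\<^esub> y \<in> range (\<lambda>i::nat. h Gd [^]\<^bsub>P\<^esub> i)" if s: "s \<in> {h Gd}" and y: "y \<in> range (\<lambda>i::nat. h Gd [^]\<^bsub>P\<^esub> i)" for s y
    proof -
      obtain i :: nat where "y = h Gd [^]\<^bsub>P\<^esub> i" using y by blast
      then have "s \<otimes>\<^bsub>P\<^esub> y = h Gd [^]\<^bsub>P\<^esub> Suc i" using s P.nat_pow_Suc2[OF mem(1), of i] by simp
      then show ?thesis by (rule image_eqI) simp
    qed
    show "\<exists>i::nat. y = h Gd [^]\<^bsub>P\<^esub> i \<or> \<phi> y = CC (dl ^ i) \<cdot> SS" if "y \<in> range (\<lambda>i::nat. h Gd [^]\<^bsub>P\<^esub> i)" for y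
      using that by blast
  qed
qed

lemma presentation_R:
  "has_finite_presentation ((GK c)\<lparr>carrier := Gset True\<rparr>) gv {Gd, Gs, Ga, Gb} (relsR c (zq dl) (zq ze))"
proof (rule has_finite_presentationI[OF group_Gset])
  let ?K = "(GK c)\<lparr>carrier := Gset True\<rparr>" and ?S = "{Gd, Gs, Ga, Gb}"
  have SF: "gen_letters True = ?S" by (simp add: gen_letters_def)
  have GF: "gv ` ?S \<subseteq> Gset True" using gv_Gset[of True] unfolding SF .
  show "finite ?S" "finite (relsR c (zq dl) (zq ze))" by (simp_all add: finite_relsR)
  show "relsR c (zq dl) (zq ze) \<subseteq> words ?S \<times> words ?S" by (rule relsR_words)
  show "satisfies ?K gv (relsR c (zq dl) (zq ze))"
    by (rule satisfies_Gset[OF GF relsR_words(1) satisfies_GK])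
  show "generate ?K (gv ` ?S) = carrier ?K"
    using G.generate_consistent[OF GF subgroup_Gset] generate_gv[of True] unfolding SF by simp
  fix P :: "gens word set monoid" and h \<phi>
  assume P: "group P" and h: "h ` ?S \<subseteq> carrier P" and gen: "generate P (h ` ?S) = carrier P"
    and sat: "satisfies P h (relsR c (zq dl) (zq ze))" and \<phi>: "\<phi> \<in> hom P ?K"
    and \<phi>h: "\<And>x. x \<in> ?S \<Longrightarrow> \<phi> (h x) = gv x"
  interpret P: group P by (rule P)
  have sub: "{Gd, Ga, Gb} \<subseteq> ?S" by blast
  note sat' = sat[unfolded P.satisfies_relsR_iff[OF h order.refl] P.satisfies_relsR'_iff[OF h sub]
      P.satisfies_square_rels_iff[OF h sub] CARD_q ze_eq_mod_iff]
  note c1 = conjunct1[OF sat'] and c2 = conjunct2[OF sat']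
  have mem: "h Gd \<in> carrier P" "h Ga \<in> carrier P" "h Gb \<in> carrier P" and s: "h Gs \<in> carrier P" using h by auto
  have dq: "h Gd [^]\<^bsub>P\<^esub> (q + 1) = \<one>\<^bsub>P\<^esub>" by (rule conjunct1[OF conjunct1[OF sat']])
  then have dq': "h Gd [^]\<^bsub>P\<^esub> Suc q = \<one>\<^bsub>P\<^esub>" by simp
  have ss: "h Gs \<otimes>\<^bsub>P\<^esub> h Gs = \<one>\<^bsub>P\<^esub>" and ds: "(h Gd \<otimes>\<^bsub>P\<^esub> h Gs) \<otimes>\<^bsub>P\<^esub> (h Gd \<otimes>\<^bsub>P\<^esub> h Gs) = \<one>\<^bsub>P\<^esub>"
    and aa: "h Ga \<otimes>\<^bsub>P\<^esub> h Ga = \<one>\<^bsub>P\<^esub>" and bb: "h Gb \<otimes>\<^bsub>P\<^esub> h Gb = \<one>\<^bsub>P\<^esub>"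
    and sa: "(h Gs \<otimes>\<^bsub>P\<^esub> h Ga) \<otimes>\<^bsub>P\<^esub> (h Gs \<otimes>\<^bsub>P\<^esub> h Ga) = \<one>\<^bsub>P\<^esub>"
    by (rule conjunct1[OF c2], rule conjunct1[OF conjunct2[OF c2]], rule conjunct1[OF conjunct2[OF c1]],
        rule conjunct1[OF conjunct2[OF conjunct2[OF c1]]], rule conjunct1[OF conjunct2[OF conjunct2[OF c2]]])
  \<comment> \<open>Some \<delta>^m with m \<le> q agrees with \<zeta> modulo scalars, so the
    relation for s\<zeta>b really occurs in the list.\<close>
  obtain m x where m: "m \<le> q" "dl ^ m = to_ac x * ze" using reduce_mod_scalars[OF ze] by blast
  have "\<forall>m\<le>q. (\<exists>x. dl ^ m = to_ac x * ze) \<longrightarrow>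
      (h Gs \<otimes>\<^bsub>P\<^esub> (h Gd [^]\<^bsub>P\<^esub> m \<otimes>\<^bsub>P\<^esub> h Gb)) \<otimes>\<^bsub>P\<^esub> (h Gs \<otimes>\<^bsub>P\<^esub> (h Gd [^]\<^bsub>P\<^esub> m \<otimes>\<^bsub>P\<^esub> h Gb)) = \<one>\<^bsub>P\<^esub>"
    using conjunct2[OF sat'] by (elim conjE)
  from this[rule_format, OF m(1) exI[of _ x], OF m(2)] have sb: "(h Gs \<otimes>\<^bsub>P\<^esub> (h Gd [^]\<^bsub>P\<^esub> m \<otimes>\<^bsub>P\<^esub> h Gb)) \<otimes>\<^bsub>P\<^esub> (h Gs \<otimes>\<^bsub>P\<^esub> (h Gd [^]\<^bsub>P\<^esub> m \<otimes>\<^bsub>P\<^esub> h Gb)) = \<one>\<^bsub>P\<^esub>" .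
  note D = mem(1) dq' s ss ds
  have sa': "h Gs \<otimes>\<^bsub>P\<^esub> h Ga = P.conj_pow (h Gd) 0 (h Ga) \<otimes>\<^bsub>P\<^esub> h Gs"
    by (rule P.s_commutes[OF D mem(2) aa]) (use sa mem in simp)
  have sb': "h Gs \<otimes>\<^bsub>P\<^esub> h Gb = P.conj_pow (h Gd) m (h Gb) \<otimes>\<^bsub>P\<^esub> h Gs"
    by (rule P.s_commutes[OF D mem(3) bb sb])
  \<comment> \<open>The possible elements of the dihedral group. Left multiplication by s takes d^i
    to d^(qi) s, as s inverts d and q is -1 modulo q + 1.\<close>
  define H where "H = range (\<lambda>i::nat. h Gd [^]\<^bsub>P\<^esub> i) \<union> range (\<lambda>i::nat. h Gd [^]\<^bsub>P\<^esub> i \<otimes>\<^bsub>P\<^esub> h Gs)"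
  have HI: "h Gd [^]\<^bsub>P\<^esub> i \<in> H" "h Gd [^]\<^bsub>P\<^esub> i \<otimes>\<^bsub>P\<^esub> h Gs \<in> H" for i :: nat
    unfolding H_def by blast+
  have HE: "(\<exists>i::nat. y = h Gd [^]\<^bsub>P\<^esub> i) \<or> (\<exists>i::nat. y = h Gd [^]\<^bsub>P\<^esub> i \<otimes>\<^bsub>P\<^esub> h Gs)" if "y \<in> H" for y
    using that unfolding H_def by blast
  have \<phi>': "\<phi> \<in> hom P (GK c)" using \<phi> by (rule hom_Gset)
  interpret \<phi>: group_hom P "GK c" \<phi> using \<phi>' by unfold_locales
  have vals: "\<phi> (h Gd) = CC dl" "\<phi> (h Ga) = GG \<iota>" "\<phi> (h Gb) = GG (\<iota> / ze)" "\<phi> (h Gs) = SS"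
    by (simp_all only: \<phi>h gv_simps insert_iff simp_thms)
  show "inj_on \<phi> (carrier P)"
  proof (rule hom_injective[where D = "{h Gd, h Gs}" and H = H, OF P \<phi>' mem vals(1-3)])
    show "generate P (insert (h Ga) (insert (h Gb) {h Gd, h Gs})) = carrier P"
      using gen by (simp add: insert_commute)
    show "h Gd [^]\<^bsub>P\<^esub> (q + 1) = \<one>\<^bsub>P\<^esub>" by (rule dq)
    show "h Ga \<otimes>\<^bsub>P\<^esub> h Ga = \<one>\<^bsub>P\<^esub>" "h Gb \<otimes>\<^bsub>P\<^esub> h Gb = \<one>\<^bsub>P\<^esub>" by (rule aa, rule bb)
    show "P.conj_pow (h Gd) i (h Ga) \<otimes>\<^bsub>P\<^esub> P.conj_pow (h Gd) j (h Gb) = P.conj_pow (h Gd) l (h Gb) \<otimes>\<^bsub>P\<^esub> P.conj_pow (h Gd) k (h Ga)"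
      if "i \<le> q" "j \<le> q" "k \<le> q" "l \<le> q" "star_cond c (zq dl) (zq ze) i j k l" for i j k l
      using conjunct1[OF sat'] that by blast
    show "\<exists>m::nat>0. y [^]\<^bsub>P\<^esub> m = \<one>\<^bsub>P\<^esub>" if y: "y \<in> {h Gd, h Gs}" for y
    proof -
      have s2: "h Gs [^]\<^bsub>P\<^esub> (2 :: nat) = \<one>\<^bsub>P\<^esub>" using s ss by (simp add: numeral_2_eq_2)
      have pos: "(0 :: nat) < q + 1" "(0 :: nat) < 2" by simp_all
      from y consider "y = h Gd" | "y = h Gs" by blast
      then show ?thesis
      proof cases
        case 1
        then show ?thesis using dq pos(1) by (intro exI[of _ "q + 1"] conjI) (simp_all only:)
      next
        case 2
        then show ?thesis using s2 pos(2) by (intro exI[of _ 2] conjI) (simp_all only:)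
      qed
    qed
    show "\<exists>i'. y \<otimes>\<^bsub>P\<^esub> P.conj_pow (h Gd) i x = P.conj_pow (h Gd) i' x \<otimes>\<^bsub>P\<^esub> y"
      if "y \<in> {h Gd, h Gs}" "x = h Ga \<or> x = h Gb" for y x i
    proof -
      have "x \<in> carrier P" using that(2) mem by blast
      then have "\<exists>i'. h Gd \<otimes>\<^bsub>P\<^esub> P.conj_pow (h Gd) i x = P.conj_pow (h Gd) i' x \<otimes>\<^bsub>P\<^esub> h Gd"
        using P.conj_pow_push[OF mem(1) dq'] by blast
      moreover have "\<exists>i'. h Gs \<otimes>\<^bsub>P\<^esub> P.conj_pow (h Gd) i x = P.conj_pow (h Gd) i' x \<otimes>\<^bsub>P\<^esub> h Gs"
        using that(2) P.s_conj_pow[OF D mem(2) sa'] P.s_conj_pow[OF D mem(3) sb'] by blast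
      ultimately show ?thesis using that(1) by blast
    qed
    show "H \<subseteq> carrier P" using mem s unfolding H_def by auto
    show "\<one>\<^bsub>P\<^esub> \<in> H" using HI(1)[of 0] by simp
    show "y \<otimes>\<^bsub>P\<^esub> z \<in> H" if y: "y \<in> {h Gd, h Gs}" and z: "z \<in> H" for y z
    proof -
      obtain i :: nat where i: "z = h Gd [^]\<^bsub>P\<^esub> i \<or> z = h Gd [^]\<^bsub>P\<^esub> i \<otimes>\<^bsub>P\<^esub> h Gs" using HE[OF z] by blast
      have d1: "h Gd \<otimes>\<^bsub>P\<^esub> h Gd [^]\<^bsub>P\<^esub> i = h Gd [^]\<^bsub>P\<^esub> Suc i" using P.nat_pow_Suc2[OF mem(1), of i] by simp
      have d2: "h Gd \<otimes>\<^bsub>P\<^esub> (h Gd [^]\<^bsub>P\<^esub> i \<otimes>\<^bsub>P\<^esub> h Gs) = h Gd [^]\<^bsub>P\<^esub> Suc i \<otimes>\<^bsub>P\<^esub> h Gs"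
        unfolding d1[symmetric] using mem s by (simp add: P.m_assoc)
      have s1: "h Gs \<otimes>\<^bsub>P\<^esub> h Gd [^]\<^bsub>P\<^esub> i = h Gd [^]\<^bsub>P\<^esub> (q * i) \<otimes>\<^bsub>P\<^esub> h Gs"
        unfolding P.s_pow[OF D] P.inv_pow[OF mem(1) dq'] ..
      have "h Gs \<otimes>\<^bsub>P\<^esub> (h Gd [^]\<^bsub>P\<^esub> i \<otimes>\<^bsub>P\<^esub> h Gs) = (h Gs \<otimes>\<^bsub>P\<^esub> h Gd [^]\<^bsub>P\<^esub> i) \<otimes>\<^bsub>P\<^esub> h Gs"
        using mem s by (simp add: P.m_assoc)
      also have "\<dots> = h Gd [^]\<^bsub>P\<^esub> (q * i)" unfolding s1 using mem s by (simp add: P.m_assoc ss)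
      finally have s2: "h Gs \<otimes>\<^bsub>P\<^esub> (h Gd [^]\<^bsub>P\<^esub> i \<otimes>\<^bsub>P\<^esub> h Gs) = h Gd [^]\<^bsub>P\<^esub> (q * i)" .
      have "h Gd \<otimes>\<^bsub>P\<^esub> h Gd [^]\<^bsub>P\<^esub> i \<in> H" "h Gd \<otimes>\<^bsub>P\<^esub> (h Gd [^]\<^bsub>P\<^esub> i \<otimes>\<^bsub>P\<^esub> h Gs) \<in> H"
        "h Gs \<otimes>\<^bsub>P\<^esub> h Gd [^]\<^bsub>P\<^esub> i \<in> H" "h Gs \<otimes>\<^bsub>P\<^esub> (h Gd [^]\<^bsub>P\<^esub> i \<otimes>\<^bsub>P\<^esub> h Gs) \<in> H"
        unfolding d1 d2 s1 s2 by (rule HI)+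
      then show ?thesis using y i by blast
    qed
    show "\<exists>i::nat. y = h Gd [^]\<^bsub>P\<^esub> i \<or> \<phi> y = CC (dl ^ i) \<cdot> SS" if "y \<in> H" for y
    proof -
      have "\<phi> (h Gd [^]\<^bsub>P\<^esub> i \<otimes>\<^bsub>P\<^esub> h Gs) = CC (dl ^ i) \<cdot> SS" for i :: nat
        using mem s by (simp add: \<phi>.hom_nat_pow vals CC_pow)
      then show ?thesis using HE[OF that] by blast
    qed
  qed
qed

lemma presentations_and_decompositions:
  "has_finite_presentation (GS c (ringR \<tau>)) gv {Gd, Gs, Ga, Gb} (relsR c (zq dl) (zq ze)) \<and>
    has_finite_presentation (GS c (ringR' \<tau>)) gv {Gd, Ga, Gb} (relsR' c (zq dl) (zq ze)) \<and>
    G_pts c (ringR \<tau>) = Lambda c (zq dl) (zq ze) \<and>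
    is_semidirect (GS c (ringR \<tau>)) (Gamma c \<tau>) (Delta c (zq dl)) \<and>
    G_pts c (ringR' \<tau>) = Lambda' c (zq dl) (zq ze) \<and>
    is_semidirect (GS c (ringR' \<tau>)) (Gamma c \<tau>) (generate (GK c) {cls c (zq dl)})"
proof -
  have GS: "GS c (ringR \<tau>) = (GK c)\<lparr>carrier := Gset True\<rparr>" "GS c (ringR' \<tau>) = (GK c)\<lparr>carrier := Gset False\<rparr>"
    by (simp_all only: GS_def G_pts_ringR G_pts_ringR')
  have L: "Lambda c (zq dl) (zq ze) = Gset True" "Lambda' c (zq dl) (zq ze) = Gset False"
    using generate_gv[of True] generate_gv[of False]
    by (simp_all only: Lambda_def Lambda'_def gen_letters_def if_True if_False)
  have D: "Delta c (zq dl) = Hset True" "generate (GK c) {cls c (zq dl)} = Hset False"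
    using generate_Hset[of True] generate_Hset[of False]
    by (simp_all only: Delta_def CC_eq SS_eq if_True if_False)
  have "subgroup (Hset J) (GK c)" for J
  proof -
    have "(if J then {CC dl, SS} else {CC dl}) \<subseteq> carrier (GK c)" using dl by simp
    from G.generate_is_subgroup[OF this] show ?thesis unfolding generate_Hset .
  qed
  then show ?thesis
    unfolding GS L D G_pts_ringR G_pts_ringR' using presentation_R presentation_R' semidirect_Gset by blast
qed

end

theorem theorem29:
  fixes p n :: nat and c \<tau> :: "'a::{field,finite}" and \<delta> \<zeta> :: "'a poly fract quat"
  assumes "Factorial_Ring.prime p" and "odd p" and "CARD('a) = p ^ n"
    and "c \<noteq> 0" and "\<not> (\<exists>x. c = x\<^sup>2)"
    and "\<tau> \<noteq> 0" and "\<tau> \<noteq> 1"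
    and "\<delta> \<in> carrier (FqZ_star c)" and "generate (FqZ_star c) {\<delta>} = carrier (FqZ_star c)"
    and "\<zeta> \<in> carrier (FqZ_star c)" and "nrm c \<zeta> = scalar (fq ((\<tau> - 1) / \<tau>))"
  shows "has_finite_presentation (GS c (ringR \<tau>)) (gen_val c \<delta> \<zeta>) {Gd, Gs, Ga, Gb} (relsR c \<delta> \<zeta>) \<and>
    has_finite_presentation (GS c (ringR' \<tau>)) (gen_val c \<delta> \<zeta>) {Gd, Ga, Gb} (relsR' c \<delta> \<zeta>) \<and>
    G_pts c (ringR \<tau>) = Lambda c \<delta> \<zeta> \<and>
    is_semidirect (GS c (ringR \<tau>)) (Gamma c \<tau>) (Delta c \<delta>) \<and>
    G_pts c (ringR' \<tau>) = Lambda' c \<delta> \<zeta> \<and>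
    is_semidirect (GS c (ringR' \<tau>)) (Gamma c \<tau>) (generate (GK c) {cls c \<delta>})"
proof -
  interpret finite_params c \<tau> p n
    using assms(1,3,5,6,7) by unfold_locales auto
  interpret S: group "FqZ_star c" by (rule group_FqZ_star)
  obtain dl where d: "\<delta> = zq dl" "dl \<in> F2" "dl \<noteq> 0" using assms(8) unfolding FqZ_star_simps by blast
  obtain ze where z: "\<zeta> = zq ze" "ze \<in> F2" "ze \<noteq> 0" using assms(10) unfolding FqZ_star_simps by blast
  have norm: "ze * ze ^ q = to_ac ((\<tau> - 1) / \<tau>)"
    using assms(11) unfolding z(1) zq_nrm[OF z(2)] mult_pow_q[OF z(2)] scalar_def quat.inject fq_eq_iff by simp
  have fin: "finite (carrier (FqZ_star c))"
    unfolding FqZ_star_simps F2_def by (intro finite_imageI finite_Diff) simp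
  \<comment> \<open>In a finite group the subgroup generated by \<delta> consists of powers with
    natural exponents.\<close>
  have pow: "\<exists>k::nat. w = dl ^ k" if w: "w \<in> F2" "w \<noteq> 0" for w
  proof -
    have "zq w \<in> generate (FqZ_star c) {\<delta>}" unfolding assms(9) FqZ_star_simps using w by simp
    then obtain k :: nat where "zq w = \<delta> [^]\<^bsub>FqZ_star c\<^esub> k"
      unfolding S.generate_pow_on_finite_carrier[OF fin assms(8)] by blast
    then have "zq w = zq (dl ^ k)" unfolding d(1) FqZ_star_pow[OF d(2)] .
    then have "w = dl ^ k" using w d by (simp add: zq_inject)
    then show ?thesis by blast
  qed
  interpret lattice_generators c \<tau> p n dl ze
    using d z norm pow by unfold_locales auto
  show ?thesis unfolding d(1) z(1) by (rule presentations_and_decompositions)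
qed

end
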